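(* Let $m_c=\frac{(N-\sigma)_+}{N}$ and $0<m<m_c$. Let $u$ be a nonnegative weak solution of the Cauchy problem $\partial_t u+\mathcal{L}\varphi(u)=0$ in $\mathbb{R}^N\times(0,\infty)$, $u(\cdot,0)=u_0$. If there is a constant $c>0$ such that $\varphi'(s)\ge c\,s^{m-1}$ for all $s>0$, and $u_0\in L^1(\mathbb{R}^N)\cap L^\infty(\mathbb{R}^N)$, then there is a time $T>0$ such that $u(x,t)=0$ for a.e. $x\in\mathbb{R}^N$, for all $t\ge T$.
   Context: Setting. $N\ge1$ is an integer, $\sigma\in(0,2)$, $\Lambda>0$, $Q=\mathbb{R}^N\times(0,\infty)$. The kernel $J$ is measurable and satisfies, for all $x\neq y$ and $z\ne0$ in $\mathbb{R}^N$: $J(x,y)=J(y,x)$; $J(x,x+z)=J(x,x-z)$; $\frac{1}{\Lambda|x-y|^{N+\sigma}}\le J(x,y)\le\frac{\Lambda}{|x-y|^{N+\sigma}}$. For smooth $f$, $\mathcal{L}f(x)=P.V.\int_{\mathbb{R}^N}(f(x)-f(y))J(x,y)\,dy$. The associated bilinear form is $\mathcal{E}(f,g)=\frac12\int_{\mathbb{R}^N}\int_{\mathbb{R}^N}(f(x)-f(y))(g(x)-g(y))J(x,y)\,dx\,dy$. Nonlinearity. $\varphi\in C([0,\infty))\cap C^1((0,\infty))$, $\varphi(0)=0$, $\varphi$ strictly increasing, and $\varphi^{1+A}$ is concave for some constant $A>0$. Spaces. $[f]_{\dot H^{\sigma/2}(\mathbb{R}^N)}^2=\iint_{\mathbb{R}^N\times\mathbb{R}^N}\frac{(f(x)-f(y))^2}{|x-y|^{N+\sigma}}\,dx\,dy$,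 and $\dot H^{\sigma/2}(\mathbb{R}^N)$ is the corresponding homogeneous fractional Sobolev space (note that $m_c>0$ forces $N>\sigma$, in which case it consists of the functions in $L^{2N/(N-\sigma)}(\mathbb{R}^N)$ with finite seminorm). Weak solution. A weak solution of the Cauchy problem is a function $u\in C([0,\infty):L^1(\mathbb{R}^N))$ with $\varphi(u)\in L^2_{\rm loc}((0,\infty):\dot H^{\sigma/2}(\mathbb{R}^N))$, such that $\int_0^\infty\int_{\mathbb{R}^N}u\,\partial_t\zeta\,dx\,dt-\int_0^\infty\mathcal{E}(\varphi(u),\zeta)\,dt=0$ for every $\zeta\in C_c^\infty(Q)$, and $u(\cdot,0)=u_0$ a.e. The equation satisfies a comparison principle; in particular $0\le u_0\le\mathcal{M}$ implies $0\le u(t)\le\mathcal{M}$ a.e. for all $t>0$. *)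

theory Defs
  imports "HOL-Analysis.Analysis"
begin

text \<open>
  Throughout, \<open>N = CARD('n)\<close>. All integrals are Lebesgue integrals with respect to the
  completed measure \<^const>\<open>lebesgue\<close>. A time-dependent function \<open>u(x,t)\<close> is written \<open>u t x\<close>,
  with \<open>u t\<close> a representative of its class modulo null sets; points of
  \<open>Q = \<real>\<^sup>N \<times> (0,\<infinity>)\<close> are pairs \<open>(x,t)\<close>.
\<close>

definition admissible_kernel ::
    "real \<Rightarrow> real \<Rightarrow> (real^'n \<Rightarrow> real^'n \<Rightarrow> real) \<Rightarrow> bool" where
  "admissible_kernel \<sigma> \<Lambda> J \<longleftrightarrow>
     (\<lambda>p. J (fst p) (snd p)) \<in> borel_measurable lebesgue \<and>
     (\<forall>x y. x \<noteq> y \<longrightarrow> J x y = J y x) \<and>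
     (\<forall>x z. z \<noteq> 0 \<longrightarrow> J x (x + z) = J x (x - z)) \<and>
     (\<forall>x y. x \<noteq> y \<longrightarrow>
        1 / (\<Lambda> * norm (x - y) powr (real CARD('n) + \<sigma>)) \<le> J x y \<and>
        J x y \<le> \<Lambda> / norm (x - y) powr (real CARD('n) + \<sigma>))"

text \<open>
  The double integral is taken over the product space. By the Cauchy--Schwarz inequality the
  integrand is integrable whenever \<open>f\<close> and \<open>g\<close> have finite Gagliardo seminorm.
\<close>

definition energy_form ::
    "(real^'n \<Rightarrow> real^'n \<Rightarrow> real) \<Rightarrow> (real^'n \<Rightarrow> real) \<Rightarrow> (real^'n \<Rightarrow> real) \<Rightarrow> real" where
  "energy_form J f g = 1/2 *
     (LINT p|lebesgue. (f (fst p) - f (snd p)) * (g (fst p) - g (snd p)) * J (fst p) (snd p))"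

definition nonlinearity :: "(real \<Rightarrow> real) \<Rightarrow> bool" where
  "nonlinearity \<phi> \<longleftrightarrow>
     continuous_on {0..} \<phi> \<and>
     (\<forall>s>0. \<phi> differentiable (at s)) \<and> continuous_on {0<..} (deriv \<phi>) \<and>
     \<phi> 0 = 0 \<and> strict_mono_on {0..} \<phi> \<and>
     (\<exists>A>0. concave_on {0..} (\<lambda>s. \<phi> s powr (1 + A)))"

text \<open>The square of the seminorm of the homogeneous space of order \<open>\<sigma>/2\<close>.\<close>

definition gagliardo_sq :: "real \<Rightarrow> (real^'n \<Rightarrow> real) \<Rightarrow> ennreal" where
  "gagliardo_sq \<sigma> f =
     (\<integral>\<^sup>+ p. ennreal ((f (fst p) - f (snd p))\<^sup>2 /
        norm (fst p - snd p) powr (real CARD('n) + \<sigma>)) \<partial>lebesgue)"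

text \<open>
  The homogeneous space of order \<open>\<sigma>/2\<close>, in the concrete description valid for \<open>\<sigma> < N\<close>.
  Only this range is meant.
\<close>

definition Hdot :: "real \<Rightarrow> (real^'n \<Rightarrow> real) set" where
  "Hdot \<sigma> = {f \<in> borel_measurable lebesgue.
     integrable lebesgue (\<lambda>x. \<bar>f x\<bar> powr (2 * real CARD('n) / (real CARD('n) - \<sigma>))) \<and>
     gagliardo_sq \<sigma> f < \<infinity>}"

text \<open>
  Membership in \<open>L\<^sup>2\<^sub>l\<^sub>o\<^sub>c((0,\<infinity>) : H)\<close> in the sense of Bochner, where \<open>H\<close> is the homogeneous space
  above: the first clause is strong measurability, i.e. almost everywhere approximation
  in \<open>H\<close> by simple \<open>H\<close>-valued functions.
\<close>

definition L2_loc_Hdot :: "real \<Rightarrow> (real \<Rightarrow> real^'n \<Rightarrow> real) \<Rightarrow> bool" where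
  "L2_loc_Hdot \<sigma> v \<longleftrightarrow>
     (\<exists>s :: nat \<Rightarrow> real \<Rightarrow> real^'n \<Rightarrow> real.
        (\<forall>k. finite (s k ` {0<..}) \<and> s k ` {0<..} \<subseteq> Hdot \<sigma> \<and>
             (\<forall>w. {t \<in> {0<..}. s k t = w} \<in> sets lebesgue)) \<and>
        (AE t in lebesgue. t > 0 \<longrightarrow>
             (\<lambda>k. gagliardo_sq \<sigma> (\<lambda>x. s k t x - v t x)) \<longlonglongrightarrow> 0)) \<and>
     (AE t in lebesgue. t > 0 \<longrightarrow> v t \<in> Hdot \<sigma>) \<and>
     (\<forall>a b. 0 < a \<and> a < b \<longrightarrow>
        (\<integral>\<^sup>+ t. gagliardo_sq \<sigma> (v t) * indicator {a..b} t \<partial>lebesgue) < \<infinity>)"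

definition C_L1 :: "(real \<Rightarrow> real^'n \<Rightarrow> real) \<Rightarrow> bool" where
  "C_L1 u \<longleftrightarrow>
     (\<forall>t\<ge>0. integrable lebesgue (u t)) \<and>
     (\<forall>t\<ge>0. ((\<lambda>s. LINT x|lebesgue. \<bar>u s x - u t x\<bar>) \<longlongrightarrow> 0) (at t within {0..}))"

text \<open>\<open>k\<close> times continuously differentiable on the whole space, by iterated partial derivatives.\<close>

primrec C_k :: "nat \<Rightarrow> ('a::euclidean_space \<Rightarrow> real) \<Rightarrow> bool" where
  "C_k 0 f \<longleftrightarrow> continuous_on UNIV f"
| "C_k (Suc k) f \<longleftrightarrow>
     (\<forall>x. f differentiable (at x)) \<and>
     (\<forall>b\<in>Basis. C_k k (\<lambda>x. frechet_derivative f (at x) b))"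

text \<open>Test functions on \<open>Q\<close>, identified with their extension by zero.\<close>

definition test_function :: "((real^'n) \<times> real \<Rightarrow> real) \<Rightarrow> bool" where
  "test_function \<zeta> \<longleftrightarrow>
     (\<forall>k. C_k k \<zeta>) \<and>
     compact (closure {p. \<zeta> p \<noteq> 0}) \<and>
     closure {p. \<zeta> p \<noteq> 0} \<subseteq> UNIV \<times> {0<..}"

definition weak_solution ::
    "real \<Rightarrow> (real^'n \<Rightarrow> real^'n \<Rightarrow> real) \<Rightarrow> (real \<Rightarrow> real) \<Rightarrow>
     (real^'n \<Rightarrow> real) \<Rightarrow> (real \<Rightarrow> real^'n \<Rightarrow> real) \<Rightarrow> bool" where
  "weak_solution \<sigma> J \<phi> u0 u \<longleftrightarrow>
     C_L1 u \<and>
     L2_loc_Hdot \<sigma> (\<lambda>t x. \<phi> (u t x)) \<and>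
     (\<forall>\<zeta>. test_function \<zeta> \<longrightarrow>
        (LINT t:{0<..}|lebesgue. LINT x|lebesgue. u t x * deriv (\<lambda>s. \<zeta> (x, s)) t)
        - (LINT t:{0<..}|lebesgue. energy_form J (\<lambda>x. \<phi> (u t x)) (\<lambda>x. \<zeta> (x, t))) = 0) \<and>
     (AE x in lebesgue. u 0 x = u0 x)"

end

theory Submission
  imports Defs "HOL-Computational_Algebra.Polynomial"
begin

text \<open>
  Write \<open>w = \<phi>(u)\<close>, \<open>p = N (1 - m) / \<sigma> > 1\<close> and \<open>Z(t) = \<integral>u(t)\<^sup>p\<close>. Testing the equation with \<open>u\<^bsup>p-1\<^esup>\<close> gives,
  formally, \<open>Z' = - p E(w, u\<^bsup>p-1\<^esup>)\<close>. The lower bound on \<open>\<phi>'\<close> and Chebyshev's inequality yield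
  \<open>E(w, u\<^bsup>p-1\<^esup>) \<ge> C Z\<^bsup>1-\<sigma>/N\<^esup>\<close>, so that \<open>Z\<close> vanishes in finite time.

  To justify the test, \<open>u\<^bsup>p-1\<^esup>\<close> is replaced by a bounded \<open>\<psi>(u)\<close> that vanishes for \<open>u \<le> \<delta>\<close> and is
  Lipschitz with respect to \<open>\<phi>\<close>, so \<open>\<psi>(u)\<close> inherits the finite seminorm of \<open>w\<close>. The weak
  formulation extends to such test functions because their cut-off mollifications converge weakly in
  the seminorm. Instead of a chain rule, the convexity inequality
  \<open>\<Psi>(u(t)) - \<Psi>(u(t-h)) \<le> \<psi>(u(t)) (u(t) - u(t-h))\<close>, with \<open>\<Psi>' = \<psi>\<close>, is averaged over \<open>t\<close>; the limit
  \<open>h \<rightarrow> 0\<close> uses the continuity of translations in \<open>L\<^sup>2(0,T;H)\<close>. With \<open>\<psi>\<close> supported above the supremum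
  of \<open>u\<^sub>0\<close> the same inequality bounds \<open>u\<close>.
\<close>

section \<open>Square integrable functions\<close>

text \<open>The obstacle is the low regularity in time: \<open>u\<close> comes without a time
  derivative and \<open>w\<close> is merely locally square integrable in time, so
  \<open>\<psi>(u)\<close> is not an admissible test function. Freezing \<open>\<psi>(u(t))\<close>
  at the later time of each increment leaves a test function of \<open>x\<close> alone, for which
  the weak formulation becomes an identity between two times. The price is the energy of
  \<open>w(s)\<close> against \<open>\<psi>(u(t))\<close> with \<open>s\<close> slightly before
  \<open>t\<close>; replacing \<open>w(s)\<close> by \<open>w(t)\<close> is possible only in the
  mean, which is why the increments are averaged. The Lipschitz constant of \<open>\<psi>\<close>
  relative to \<open>\<phi>\<close> may blow up as \<open>\<delta>\<close> tends to 0, but it does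
  not occur in the resulting inequality, and the lower bound of the energy has a constant free of
  \<open>\<delta>\<close>. That lower bound uses only pairs of points at which one value of
  \<open>u\<close> is at most half of the other; there the increments of \<open>\<phi>\<close> and
  \<open>\<psi>\<close> are at least multiples of powers of the larger value. Extinction is due to
  the exponent \<open>1 - \<sigma>/N\<close> being less than 1.\<close>

definition L2f :: "'a measure \<Rightarrow> ('a \<Rightarrow> real) \<Rightarrow> bool" where
  "L2f M F \<longleftrightarrow> F \<in> borel_measurable M \<and> integrable M (\<lambda>x. (F x)\<^sup>2)"

text \<open>A seminorm on functions, not on classes. It is meaningful only together with
  \<open>L2f\<close>, since the Bochner integral of a non-integrable function is 0.\<close>

definition l2norm :: "'a measure \<Rightarrow> ('a \<Rightarrow> real) \<Rightarrow> real" where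
  "l2norm M F = sqrt (LINT x|M. (F x)\<^sup>2)"

lemma L2f_measurable: "L2f M F \<Longrightarrow> F \<in> borel_measurable M"
  and L2f_integrable: "L2f M F \<Longrightarrow> integrable M (\<lambda>x. (F x)\<^sup>2)"
  by (auto simp: L2f_def)

lemma l2norm_nonneg [simp]: "0 \<le> l2norm M F"
  by (simp add: l2norm_def)

lemma l2norm_power2: "(l2norm M F)\<^sup>2 = (LINT x|M. (F x)\<^sup>2)"
  by (simp add: l2norm_def)

lemma L2f_mult_integrable:
  assumes "L2f M F" "L2f M G"
  shows "integrable M (\<lambda>x. F x * G x)"
proof (rule Bochner_Integration.integrable_bound)
  show "integrable M (\<lambda>x. (F x)\<^sup>2 + (G x)\<^sup>2)"
    using assms by (auto simp: L2f_def)
  show "(\<lambda>x. F x * G x) \<in> borel_measurable M"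
    using assms by (auto simp: L2f_def)
  have "\<bar>a * b\<bar> \<le> a\<^sup>2 + b\<^sup>2" for a b :: real
  proof -
    have "2 * (\<bar>a\<bar> * \<bar>b\<bar>) \<le> a\<^sup>2 + b\<^sup>2" using sum_squares_bound[of "\<bar>a\<bar>" "\<bar>b\<bar>"] by simp
    moreover have "0 \<le> \<bar>a\<bar> * \<bar>b\<bar>" by simp
    ultimately show ?thesis unfolding abs_mult by linarith
  qed
  then show "AE x in M. norm (F x * G x) \<le> norm ((F x)\<^sup>2 + (G x)\<^sup>2)"
    by simp
qed

lemma L2f_bounded_mult:
  assumes F: "L2f M F" and K: "K \<in> borel_measurable M" "\<And>x. \<bar>K x\<bar> \<le> C"
  shows "L2f M (\<lambda>x. K x * F x)"
  unfolding L2f_def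
proof
  have C: "0 \<le> C" using K(2)[of undefined] by linarith
  show m: "(\<lambda>x. K x * F x) \<in> borel_measurable M" using assms by (auto simp: L2f_def)
  show "integrable M (\<lambda>x. (K x * F x)\<^sup>2)"
  proof (rule Bochner_Integration.integrable_bound)
    show "integrable M (\<lambda>x. C\<^sup>2 * (F x)\<^sup>2)"
      using F by (auto simp: L2f_def)
    show "(\<lambda>x. (K x * F x)\<^sup>2) \<in> borel_measurable M" using m by auto
    have "(K x)\<^sup>2 \<le> C\<^sup>2" for x
      using K(2)[of x] by (metis abs_ge_zero power2_abs power_mono)
    then show "AE x in M. norm ((K x * F x)\<^sup>2) \<le> norm (C\<^sup>2 * (F x)\<^sup>2)"
      by (auto simp: power_mult_distrib intro!: mult_right_mono)
  qed
qed

lemma L2f_cmult: "L2f M F \<Longrightarrow> L2f M (\<lambda>x. c * F x)"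
  using L2f_bounded_mult[of M F "\<lambda>_. c" "\<bar>c\<bar>"] by auto

lemma L2f_add:
  assumes "L2f M F" "L2f M G" shows "L2f M (\<lambda>x. F x + G x)"
proof -
  have "integrable M (\<lambda>x. (F x)\<^sup>2 + (G x)\<^sup>2 + 2 * (F x * G x))"
    using assms L2f_mult_integrable[OF assms] by (auto simp: L2f_def)
  then show ?thesis using assms by (auto simp: L2f_def power2_sum mult.assoc)
qed

lemma L2f_diff:
  assumes "L2f M F" "L2f M G" shows "L2f M (\<lambda>x. F x - G x)"
  using L2f_add[OF assms(1) L2f_cmult[OF assms(2), of "-1"]] by simp

lemma L2f_zero [simp]: "L2f M (\<lambda>x. 0)"
  by (simp add: L2f_def)

lemma L2f_sum: "finite I \<Longrightarrow> (\<And>i. i \<in> I \<Longrightarrow> L2f M (F i)) \<Longrightarrow> L2f M (\<lambda>x. \<Sum>i\<in>I. F i x)"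
  by (induction I rule: finite_induct) (auto intro: L2f_add)

lemma L2f_abs: "L2f M F \<Longrightarrow> L2f M (\<lambda>x. \<bar>F x\<bar>)"
  by (auto simp: L2f_def)

lemma l2norm_abs [simp]: "l2norm M (\<lambda>x. \<bar>F x\<bar>) = l2norm M F"
  by (simp add: l2norm_def)

lemma l2norm_cmult: "l2norm M (\<lambda>x. c * F x) = \<bar>c\<bar> * l2norm M F"
  by (simp add: l2norm_def power_mult_distrib real_sqrt_mult)

text \<open>If one seminorm vanishes, that factor vanishes almost everywhere. Otherwise Young's
  inequality with weights \<open>b/a\<close> and \<open>a/b\<close> balances both terms to
  \<open>a * b / 2\<close> each.\<close>

lemma l2norm_Cauchy_Schwarz:
  assumes F: "L2f M F" and G: "L2f M G"
  shows "(LINT x|M. \<bar>F x * G x\<bar>) \<le> l2norm M F * l2norm M G"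
proof -
  have z: "(LINT x|M. \<bar>F x * G x\<bar>) \<le> l2norm M F * l2norm M G"
    if "L2f M F" "l2norm M F = 0" for F G
  proof -
    have "(LINT x|M. (F x)\<^sup>2) = 0" using that(2) by (simp add: l2norm_def)
    then have "AE x in M. (F x)\<^sup>2 = 0"
      using that(1) integral_nonneg_eq_0_iff_AE[of M "\<lambda>x. (F x)\<^sup>2"] by (auto simp: L2f_def)
    then have "AE x in M. \<bar>F x * G x\<bar> = 0" by auto
    then have "(LINT x|M. \<bar>F x * G x\<bar>) = 0" by (rule integral_eq_zero_AE)
    then show ?thesis using that by simp
  qed
  consider "l2norm M F = 0" | "l2norm M G = 0" | "l2norm M F > 0" "l2norm M G > 0"
    using l2norm_nonneg[of M F] l2norm_nonneg[of M G] by linarith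
  then show ?thesis
  proof cases
    case 1 then show ?thesis using z F by blast
  next
    case 2 then show ?thesis using z[OF G, of F] by (simp add: mult.commute)
  next
    case 3
    define a b where "a = l2norm M F" and "b = l2norm M G"
    have ab: "a > 0" "b > 0" using 3 by (auto simp: a_def b_def)
    have "(LINT x|M. \<bar>F x * G x\<bar>) \<le> (LINT x|M. (b/a/2) * (F x)\<^sup>2 + (a/b/2) * (G x)\<^sup>2)"
    proof (rule integral_mono)
      show "integrable M (\<lambda>x. \<bar>F x * G x\<bar>)"
        using L2f_mult_integrable[OF F G] by simp
      show "integrable M (\<lambda>x. (b/a/2) * (F x)\<^sup>2 + (a/b/2) * (G x)\<^sup>2)"
        using F G by (auto simp: L2f_def)
      fix x
      have "0 \<le> (b * \<bar>F x\<bar> - a * \<bar>G x\<bar>)\<^sup>2" by simp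
      then have "2 * (a * b) * \<bar>F x * G x\<bar> \<le> b\<^sup>2 * (F x)\<^sup>2 + a\<^sup>2 * (G x)\<^sup>2"
        by (simp add: power2_diff power_mult_distrib abs_mult algebra_simps)
      then show "\<bar>F x * G x\<bar> \<le> (b/a/2) * (F x)\<^sup>2 + (a/b/2) * (G x)\<^sup>2"
        using ab by (simp add: field_simps power2_eq_square)
    qed
    also have "\<dots> = (b/a/2) * a\<^sup>2 + (a/b/2) * b\<^sup>2"
      using F G by (simp add: L2f_def a_def b_def l2norm_power2)
    also have "\<dots> = a * b" using ab by (simp add: field_simps power2_eq_square)
    finally show ?thesis by (simp add: a_def b_def)
  qed
qed

lemma l2norm_Cauchy_Schwarz':
  assumes F: "L2f M F" and G: "L2f M G"
  shows "\<bar>LINT x|M. F x * G x\<bar> \<le> l2norm M F * l2norm M G"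
  using integral_abs_bound[of M "\<lambda>x. F x * G x"] l2norm_Cauchy_Schwarz[OF F G] by linarith

lemma l2norm_triangle:
  assumes F: "L2f M F" and G: "L2f M G"
  shows "l2norm M (\<lambda>x. F x + G x) \<le> l2norm M F + l2norm M G"
proof (rule power2_le_imp_le)
  have "(l2norm M (\<lambda>x. F x + G x))\<^sup>2 = (LINT x|M. (F x)\<^sup>2 + (G x)\<^sup>2 + 2 * (F x * G x))"
    by (simp add: l2norm_power2 power2_sum mult.assoc)
  also have "\<dots> = (l2norm M F)\<^sup>2 + (l2norm M G)\<^sup>2 + 2 * (LINT x|M. F x * G x)"
    using F G L2f_mult_integrable[OF F G] by (simp add: l2norm_power2 L2f_def)
  also have "\<dots> \<le> (l2norm M F + l2norm M G)\<^sup>2"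
    using l2norm_Cauchy_Schwarz'[OF F G] by (simp add: power2_sum)
  finally show "(l2norm M (\<lambda>x. F x + G x))\<^sup>2 \<le> (l2norm M F + l2norm M G)\<^sup>2" .
qed simp

lemma l2norm_triangle_diff:
  assumes F: "L2f M F" and G: "L2f M G"
  shows "l2norm M (\<lambda>x. F x - G x) \<le> l2norm M F + l2norm M G"
  using l2norm_triangle[OF F L2f_cmult[OF G, of "-1"]] l2norm_cmult[of M "-1" G] by simp

lemma l2norm_sum:
  "finite I \<Longrightarrow> (\<And>i. i \<in> I \<Longrightarrow> L2f M (F i)) \<Longrightarrow>
    l2norm M (\<lambda>x. \<Sum>i\<in>I. F i x) \<le> (\<Sum>i\<in>I. l2norm M (F i))"
proof (induction I rule: finite_induct)
  case empty then show ?case by (simp add: l2norm_def)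
next
  case (insert i I)
  have "l2norm M (\<lambda>x. F i x + (\<Sum>i\<in>I. F i x)) \<le> l2norm M (F i) + l2norm M (\<lambda>x. \<Sum>i\<in>I. F i x)"
    using insert by (intro l2norm_triangle L2f_sum) auto
  also have "\<dots> \<le> l2norm M (F i) + (\<Sum>i\<in>I. l2norm M (F i))"
    using insert by simp
  finally show ?case using insert by simp
qed

text \<open>A bounded sequence in \<open>L\<^sup>2\<close> that converges almost everywhere converges weakly: where
  \<open>\<bar>H\<^sub>k\<bar> \<le> c \<bar>G\<bar>\<close> dominated convergence applies, and elsewhere
  \<open>\<bar>H\<^sub>k G\<bar> \<le> H\<^sub>k\<^sup>2 / c\<close>.\<close>

lemma L2_weak_convergence:
  assumes G: "L2f M G" and F: "L2f M F" and Fk: "\<And>k. L2f M (Fk k)"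
    and bd: "\<And>k. l2norm M (Fk k) \<le> C"
    and lim: "AE x in M. (\<lambda>k. Fk k x) \<longlonglongrightarrow> F x"
  shows "(\<lambda>k. LINT x|M. G x * Fk k x) \<longlonglongrightarrow> (LINT x|M. G x * F x)"
proof -
  define H where "H k x = Fk k x - F x" for k x
  have H: "L2f M (H k)" for k unfolding H_def by (intro L2f_diff Fk F)
  define B where "B = C + l2norm M F"
  have HB: "l2norm M (H k) \<le> B" for k
    unfolding H_def B_def using l2norm_triangle_diff[OF Fk F, of k] bd[of k] by linarith
  have B0: "0 \<le> B" using HB[of 0] l2norm_nonneg[of M "H 0"] by linarith
  have [measurable]: "G \<in> borel_measurable M" "\<And>k. H k \<in> borel_measurable M"
    using G H by (auto simp: L2f_def)
  have Hlim: "AE x in M. (\<lambda>k. H k x) \<longlonglongrightarrow> 0"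
    using lim unfolding H_def by eventually_elim (metis LIM_zero)
  define D where "D c k = (LINT x|M. min \<bar>G x * H k x\<bar> (c * (G x)\<^sup>2))" for c k
  have D0: "D c \<longlonglongrightarrow> 0" if "c > 0" for c
  proof -
    have "(\<lambda>k. LINT x|M. min \<bar>G x * H k x\<bar> (c * (G x)\<^sup>2)) \<longlonglongrightarrow> (LINT x|M. 0)"
    proof (rule integral_dominated_convergence[where w="\<lambda>x. c * (G x)\<^sup>2"])
      show "AE x in M. (\<lambda>k. min \<bar>G x * H k x\<bar> (c * (G x)\<^sup>2)) \<longlonglongrightarrow> 0"
        using Hlim
      proof eventually_elim
        fix x assume "(\<lambda>k. H k x) \<longlonglongrightarrow> 0"
        then have "(\<lambda>k. \<bar>G x * H k x\<bar>) \<longlonglongrightarrow> \<bar>G x * 0\<bar>" by (intro tendsto_intros)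
        then have "(\<lambda>k. min \<bar>G x * H k x\<bar> (c * (G x)\<^sup>2)) \<longlonglongrightarrow> min \<bar>G x * 0\<bar> (c * (G x)\<^sup>2)"
          by (intro tendsto_min tendsto_const)
        then show "(\<lambda>k. min \<bar>G x * H k x\<bar> (c * (G x)\<^sup>2)) \<longlonglongrightarrow> 0" using that by simp
      qed
      show "AE x in M. norm (min \<bar>G x * H k x\<bar> (c * (G x)\<^sup>2)) \<le> c * (G x)\<^sup>2" for k
        using that by (auto simp: min_def)
    qed (use G in \<open>auto simp: L2f_def\<close>)
    then show ?thesis by (simp add: D_def[abs_def])
  qed
  have est: "\<bar>LINT x|M. G x * H k x\<bar> \<le> D c k + B\<^sup>2 / c" if "c > 0" for c k
  proof -
    have iGH: "integrable M (\<lambda>x. G x * H k x)" by (rule L2f_mult_integrable[OF G H])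
    have imin: "integrable M (\<lambda>x. min \<bar>G x * H k x\<bar> (c * (G x)\<^sup>2))"
      using iGH G by (intro integrable_min) (auto simp: L2f_def)
    have "\<bar>LINT x|M. G x * H k x\<bar> \<le> (LINT x|M. \<bar>G x * H k x\<bar>)" by (rule integral_abs_bound)
    also have "\<dots> \<le> (LINT x|M. min \<bar>G x * H k x\<bar> (c * (G x)\<^sup>2) + (H k x)\<^sup>2 / c)"
    proof (rule integral_mono)
      show "integrable M (\<lambda>x. min \<bar>G x * H k x\<bar> (c * (G x)\<^sup>2) + (H k x)\<^sup>2 / c)"
        using imin H[of k] by (auto simp: L2f_def)
      fix x
      show "\<bar>G x * H k x\<bar> \<le> min \<bar>G x * H k x\<bar> (c * (G x)\<^sup>2) + (H k x)\<^sup>2 / c"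
      proof (cases "\<bar>G x * H k x\<bar> \<le> c * (G x)\<^sup>2")
        case True then show ?thesis using that by simp
      next
        case False
        then have "(c * \<bar>G x\<bar>) * \<bar>G x\<bar> < \<bar>H k x\<bar> * \<bar>G x\<bar>"
          by (simp add: abs_mult power2_eq_square mult.assoc mult.commute[of "\<bar>H k x\<bar>"])
        then have "c * \<bar>G x\<bar> < \<bar>H k x\<bar>" by (rule mult_right_less_imp_less) simp
        then have "(c * \<bar>G x\<bar>) * \<bar>H k x\<bar> \<le> \<bar>H k x\<bar> * \<bar>H k x\<bar>" by (intro mult_right_mono) auto
        then have "\<bar>G x * H k x\<bar> \<le> (H k x)\<^sup>2 / c"
          using that by (simp add: abs_mult power2_eq_square pos_le_divide_eq mult.assoc mult.commute[of _ c])
        moreover have "0 \<le> min \<bar>G x * H k x\<bar> (c * (G x)\<^sup>2)" using that by auto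
        ultimately show ?thesis by linarith
      qed
    qed (use iGH in auto)
    also have "\<dots> = D c k + (l2norm M (H k))\<^sup>2 / c"
      using imin H[of k] by (simp add: D_def L2f_def l2norm_power2)
    also have "\<dots> \<le> D c k + B\<^sup>2 / c"
      using HB[of k] that by (intro add_left_mono divide_right_mono power_mono) auto
    finally show ?thesis .
  qed
  have "(\<lambda>k. LINT x|M. G x * H k x) \<longlonglongrightarrow> 0"
  proof (rule LIMSEQ_I)
    fix e :: real assume "0 < e"
    \<comment> \<open>Large enough that \<open>B^2 / c < e / 2\<close>; the summand 1 keeps
      \<open>c\<close> positive when \<open>B = 0\<close>.\<close>
    define c where "c = 2 * (B\<^sup>2 + 1) / e"
    have "c > 0" using \<open>0 < e\<close> by (auto simp: c_def intro!: divide_pos_pos add_nonneg_pos)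
    obtain k0 where k0: "\<And>k. k \<ge> k0 \<Longrightarrow> \<bar>D c k\<bar> < e/2"
      using LIMSEQ_D[OF D0[OF \<open>c > 0\<close>], of "e/2"] \<open>0 < e\<close> by auto
    have "B\<^sup>2 / c < e / 2"
      using \<open>0 < e\<close> by (simp add: c_def divide_simps) (smt (verit) zero_le_power2)
    then have "norm ((LINT x|M. G x * H k x) - 0) < e" if "k \<ge> k0" for k
      using est[OF \<open>c > 0\<close>, of k] k0[OF that] unfolding diff_0_right real_norm_def by linarith
    then show "\<exists>no. \<forall>n\<ge>no. norm ((LINT x|M. G x * H n x) - 0) < e" by blast
  qed
  moreover have "(LINT x|M. G x * H k x) = (LINT x|M. G x * Fk k x) - (LINT x|M. G x * F x)" for k
    unfolding H_def using L2f_mult_integrable[OF G Fk] L2f_mult_integrable[OF G F]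
    by (simp add: right_diff_distrib)
  ultimately show ?thesis by (simp add: LIM_zero_iff)
qed

section \<open>Difference quotients, seminorm and energy\<close>

text \<open>A null set times the whole space is null because \<open>0 * \<infinity> = 0\<close> for
  extended nonnegative reals. This carries properties of almost every point over to almost every
  pair of points.\<close>

lemma AE_lborel_fst:
  assumes "AE x in (lborel :: 'a::euclidean_space measure). P x"
  shows "AE p in (lborel :: ('a \<times> 'b::euclidean_space) measure). P (fst p)"
proof -
  obtain N where N: "{x \<in> space lborel. \<not> P x} \<subseteq> N" "emeasure lborel N = 0" "N \<in> sets lborel"
    using AE_E[OF assms] .
  have "emeasure (lborel \<Otimes>\<^sub>M lborel) (N \<times> (UNIV :: 'b set)) = emeasure lborel N * emeasure lborel (UNIV :: 'b set)"
    using N(3) by (intro lborel.emeasure_pair_measure_Times) auto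
  then have 0: "emeasure (lborel :: ('a \<times> 'b) measure) (N \<times> UNIV) = 0"
    using N(2) by (simp add: lborel_prod)
  have "N \<times> (UNIV :: 'b set) \<in> sets (borel :: ('a \<times> 'b) measure)"
    using N(3) unfolding borel_prod[symmetric] by (intro pair_measureI) auto
  then have "N \<times> (UNIV :: 'b set) \<in> null_sets lborel" using 0 by (intro null_setsI) auto
  then show ?thesis by (rule AE_I') (use N(1) in auto)
qed

lemma AE_lborel_snd:
  assumes "AE x in (lborel :: 'b::euclidean_space measure). P x"
  shows "AE p in (lborel :: ('a::euclidean_space \<times> 'b) measure). P (snd p)"
proof -
  obtain N where N: "{x \<in> space lborel. \<not> P x} \<subseteq> N" "emeasure lborel N = 0" "N \<in> sets lborel"
    using AE_E[OF assms] .
  have "emeasure (lborel \<Otimes>\<^sub>M lborel) ((UNIV :: 'a set) \<times> N) = emeasure lborel (UNIV :: 'a set) * emeasure lborel N"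
    using N(3) by (intro lborel.emeasure_pair_measure_Times) auto
  then have 0: "emeasure (lborel :: ('a \<times> 'b) measure) (UNIV \<times> N) = 0"
    using N(2) by (simp add: lborel_prod)
  have "(UNIV :: 'a set) \<times> N \<in> sets (borel :: ('a \<times> 'b) measure)"
    using N(3) unfolding borel_prod[symmetric] by (intro pair_measureI) auto
  then have "(UNIV :: 'a set) \<times> N \<in> null_sets lborel" using 0 by (intro null_setsI) auto
  then show ?thesis by (rule AE_I') (use N(1) in auto)
qed

lemma borel_representative:
  fixes f :: "'a::euclidean_space \<Rightarrow> real"
  assumes "f \<in> borel_measurable lebesgue"
  obtains f' where "f' \<in> borel_measurable borel" "AE x in lborel. f x = f' x"
  using completion_ex_borel_measurable_real[OF assms] by auto

lemma borel_measurable_lebesgue_AE: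
  fixes f g :: "'a::euclidean_space \<Rightarrow> real"
  assumes "f \<in> borel_measurable borel" "AE x in lborel. g x = f x"
  shows "g \<in> borel_measurable lebesgue"
proof (rule borel_measurable_AE)
  show "f \<in> borel_measurable lebesgue" using assms(1) by (simp add: measurable_completion)
  show "AE x in lebesgue. f x = g x" using assms(2) by (intro AE_completion) auto
qed

text \<open>Lebesgue measurability does not survive composition with Borel maps in general, so a
  Borel representative is composed instead and the exceptional null set is lifted to the
  product.\<close>

lemma lebesgue_measurable_fst_snd:
  fixes f :: "'a::euclidean_space \<Rightarrow> real"
  assumes "f \<in> borel_measurable lebesgue"
  shows "(\<lambda>p. f (fst p)) \<in> borel_measurable (lebesgue :: ('a \<times> 'b::euclidean_space) measure)"
    and "(\<lambda>p. f (snd p)) \<in> borel_measurable (lebesgue :: ('b \<times> 'a) measure)"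
proof -
  obtain f' where f': "f' \<in> borel_measurable borel" "AE x in lborel. f x = f' x"
    using borel_representative[OF assms] .
  have [measurable]: "f' \<in> borel_measurable borel" by fact
  show "(\<lambda>p. f (fst p)) \<in> borel_measurable (lebesgue :: ('a \<times> 'b::euclidean_space) measure)"
    by (rule borel_measurable_lebesgue_AE[OF _ AE_lborel_fst[OF f'(2)]]) (simp flip: borel_prod)
  show "(\<lambda>p. f (snd p)) \<in> borel_measurable (lebesgue :: ('b \<times> 'a) measure)"
    by (rule borel_measurable_lebesgue_AE[OF _ AE_lborel_snd[OF f'(2)]]) (simp flip: borel_prod)
qed

text \<open>The square root, with sign, of the Gagliardo integrand. The seminorm becomes an
  \<open>L^2\<close> norm on pairs of points, so the estimates above apply to it directly. On the
  diagonal numerator and denominator vanish and the value is 0.\<close>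

definition gagliardo_quotient :: "real \<Rightarrow> (real^'n \<Rightarrow> real) \<Rightarrow> (real^'n) \<times> (real^'n) \<Rightarrow> real" where
  "gagliardo_quotient \<sigma> f p =
     (f (fst p) - f (snd p)) / norm (fst p - snd p) powr ((real CARD('n) + \<sigma>) / 2)"

text \<open>Finiteness of the seminorm is what the energy estimates use, since only differences of
  values enter. The class is closed under differences.\<close>

definition gagliardo_finite :: "real \<Rightarrow> (real^'n \<Rightarrow> real) \<Rightarrow> bool" where
  "gagliardo_finite \<sigma> f \<longleftrightarrow> f \<in> borel_measurable lebesgue \<and> gagliardo_sq \<sigma> f < \<infinity>"

definition gagliardo_norm :: "real \<Rightarrow> (real^'n \<Rightarrow> real) \<Rightarrow> real" where
  "gagliardo_norm \<sigma> f = l2norm lebesgue (gagliardo_quotient \<sigma> f)"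

lemma powr_half_power2: "(x powr (a / 2))\<^sup>2 = x powr a" for x a :: real
  by (simp add: power2_eq_square flip: powr_add)

lemma gagliardo_quotient_power2:
  "(gagliardo_quotient \<sigma> f p)\<^sup>2 =
     (f (fst p) - f (snd p))\<^sup>2 / norm (fst p - snd p) powr (real CARD('n) + \<sigma>)" for f :: "real^'n \<Rightarrow> real"
  by (simp add: gagliardo_quotient_def power_divide powr_half_power2)

lemma gagliardo_sq_eq: "gagliardo_sq \<sigma> f = (\<integral>\<^sup>+ p. ennreal ((gagliardo_quotient \<sigma> f p)\<^sup>2) \<partial>lebesgue)"
  by (simp add: gagliardo_sq_def gagliardo_quotient_power2)

lemma gagliardo_quotient_measurable:
  fixes f :: "real^'n \<Rightarrow> real"
  assumes "f \<in> borel_measurable lebesgue"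
  shows "gagliardo_quotient \<sigma> f \<in> borel_measurable lebesgue"
proof -
  have "(\<lambda>p :: (real^'n) \<times> (real^'n). norm (fst p - snd p) powr ((real CARD('n) + \<sigma>) / 2)) \<in> borel_measurable borel"
    by (simp flip: borel_prod)
  then have "(\<lambda>p :: (real^'n) \<times> (real^'n). norm (fst p - snd p) powr ((real CARD('n) + \<sigma>) / 2)) \<in> borel_measurable lebesgue"
    by (simp add: measurable_completion)
  then show ?thesis
    unfolding gagliardo_quotient_def[abs_def]
    by (intro borel_measurable_divide borel_measurable_diff lebesgue_measurable_fst_snd assms)
qed

lemma gagliardo_finite_iff:
  "gagliardo_finite \<sigma> f \<longleftrightarrow> f \<in> borel_measurable lebesgue \<and> L2f lebesgue (gagliardo_quotient \<sigma> f)"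
  using gagliardo_quotient_measurable[of f \<sigma>]
  by (auto simp: gagliardo_finite_def L2f_def gagliardo_sq_eq integrable_iff_bounded)

lemma gagliardo_finite_L2f: "gagliardo_finite \<sigma> f \<Longrightarrow> L2f lebesgue (gagliardo_quotient \<sigma> f)"
  by (simp add: gagliardo_finite_iff)

lemma gagliardo_sq_norm:
  assumes "gagliardo_finite \<sigma> f"
  shows "gagliardo_sq \<sigma> f = ennreal ((gagliardo_norm \<sigma> f)\<^sup>2)"
  unfolding gagliardo_sq_eq gagliardo_norm_def l2norm_power2
  by (rule nn_integral_eq_integral) (use gagliardo_finite_L2f[OF assms] in \<open>auto simp: L2f_def\<close>)

lemma gagliardo_quotient_diff:
  "gagliardo_quotient \<sigma> (\<lambda>x. f x - g x) = (\<lambda>p. gagliardo_quotient \<sigma> f p - gagliardo_quotient \<sigma> g p)"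
  by (rule ext) (simp add: gagliardo_quotient_def diff_divide_distrib)

lemma gagliardo_quotient_cong_AE:
  assumes "AE x in lborel. f x = g x"
  shows "AE p in lebesgue. gagliardo_quotient \<sigma> f p = gagliardo_quotient \<sigma> g p"
  using AE_completion[OF AE_lborel_fst[OF assms]] AE_completion[OF AE_lborel_snd[OF assms]]
  by eventually_elim (simp add: gagliardo_quotient_def)

lemma gagliardo_finite_diff:
  "gagliardo_finite \<sigma> f \<Longrightarrow> gagliardo_finite \<sigma> g \<Longrightarrow> gagliardo_finite \<sigma> (\<lambda>x. f x - g x)"
  by (auto simp: gagliardo_finite_iff gagliardo_quotient_diff intro: L2f_diff)

lemma gagliardo_norm_triangle_diff:
  assumes "gagliardo_finite \<sigma> f" "gagliardo_finite \<sigma> g"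
  shows "gagliardo_norm \<sigma> (\<lambda>x. f x - g x) \<le> gagliardo_norm \<sigma> f + gagliardo_norm \<sigma> g"
  unfolding gagliardo_norm_def gagliardo_quotient_diff
  by (intro l2norm_triangle_diff gagliardo_finite_L2f assms)

lemma gagliardo_norm_commute: "gagliardo_norm \<sigma> (\<lambda>x. f x - g x) = gagliardo_norm \<sigma> (\<lambda>x. g x - f x)"
  using l2norm_cmult[of lebesgue "-1" "gagliardo_quotient \<sigma> (\<lambda>x. f x - g x)"]
  by (simp add: gagliardo_norm_def gagliardo_quotient_diff)

lemma gagliardo_norm_triangle3:
  assumes "gagliardo_finite \<sigma> f" "gagliardo_finite \<sigma> g" "gagliardo_finite \<sigma> h"
  shows "gagliardo_norm \<sigma> (\<lambda>x. f x - h x)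
    \<le> gagliardo_norm \<sigma> (\<lambda>x. f x - g x) + gagliardo_norm \<sigma> (\<lambda>x. g x - h x)"
  using gagliardo_norm_triangle_diff[OF gagliardo_finite_diff[OF assms(1,2)] gagliardo_finite_diff[OF assms(3,2)]]
    gagliardo_norm_commute[of \<sigma> h g] by simp

lemma gagliardo_norm_nonneg [simp]: "0 \<le> gagliardo_norm \<sigma> f"
  by (simp add: gagliardo_norm_def)

text \<open>The kernel with its singularity divided out: an admissible \<open>J\<close> turns into a
  measurable weight bounded by \<open>\<Lambda>\<close>, and the energy into a weighted
  \<open>L^2\<close> pairing of difference quotients.\<close>

definition rescaled_kernel :: "real \<Rightarrow> (real^'n \<Rightarrow> real^'n \<Rightarrow> real) \<Rightarrow> (real^'n) \<times> (real^'n) \<Rightarrow> real" where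
  "rescaled_kernel \<sigma> J p = J (fst p) (snd p) * norm (fst p - snd p) powr (real CARD('n) + \<sigma>)"

lemma energy_integrand_eq:
  fixes f g :: "real^'n \<Rightarrow> real"
  shows "(f (fst p) - f (snd p)) * (g (fst p) - g (snd p)) * J (fst p) (snd p) =
    (rescaled_kernel \<sigma> J p * gagliardo_quotient \<sigma> f p) * gagliardo_quotient \<sigma> g p"
proof (cases "fst p = snd p")
  case False
  define d where "d = norm (fst p - snd p)"
  have "d > 0" using False by (simp add: d_def)
  define e where "e = d powr ((real CARD('n) + \<sigma>) / 2)"
  have "e > 0" "d powr (real CARD('n) + \<sigma>) = e\<^sup>2"
    using \<open>d > 0\<close> powr_half_power2[of d "real CARD('n) + \<sigma>"] by (auto simp: e_def)
  then show ?thesis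
    by (simp add: gagliardo_quotient_def rescaled_kernel_def flip: d_def e_def)
      (simp add: field_simps power2_eq_square)
qed (simp add: gagliardo_quotient_def rescaled_kernel_def)

lemma energy_form_eq:
  fixes f g :: "real^'n \<Rightarrow> real"
  shows "energy_form J f g = 1/2 *
    (LINT p|lebesgue. (rescaled_kernel \<sigma> J p * gagliardo_quotient \<sigma> f p) * gagliardo_quotient \<sigma> g p)"
  unfolding energy_form_def energy_integrand_eq[where \<sigma>=\<sigma>] ..

section \<open>Bounds and weak continuity of the energy form\<close>

context
  fixes \<sigma> \<Lambda> :: real and J :: "real^'n \<Rightarrow> real^'n \<Rightarrow> real"
  assumes adm: "admissible_kernel \<sigma> \<Lambda> J" and \<Lambda>: "\<Lambda> > 0"
begin

lemma rescaled_kernel_measurable: "rescaled_kernel \<sigma> J \<in> borel_measurable lebesgue"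
proof -
  have "(\<lambda>p :: (real^'n) \<times> (real^'n). norm (fst p - snd p) powr (real CARD('n) + \<sigma>)) \<in> borel_measurable borel"
    by (simp flip: borel_prod)
  then have "(\<lambda>p :: (real^'n) \<times> (real^'n). norm (fst p - snd p) powr (real CARD('n) + \<sigma>)) \<in> borel_measurable lebesgue"
    by (simp add: measurable_completion)
  then show ?thesis using adm
    unfolding rescaled_kernel_def[abs_def] admissible_kernel_def by (intro borel_measurable_times) auto
qed

lemma kernel_bounds:
  assumes "x \<noteq> y"
  shows "1 / (\<Lambda> * norm (x - y) powr (real CARD('n) + \<sigma>)) \<le> J x y"
    and "J x y \<le> \<Lambda> / norm (x - y) powr (real CARD('n) + \<sigma>)" and "0 < J x y"
proof -
  show 1: "1 / (\<Lambda> * norm (x - y) powr (real CARD('n) + \<sigma>)) \<le> J x y"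
    and "J x y \<le> \<Lambda> / norm (x - y) powr (real CARD('n) + \<sigma>)"
    using adm assms by (auto simp: admissible_kernel_def)
  have "0 < 1 / (\<Lambda> * norm (x - y) powr (real CARD('n) + \<sigma>))" using assms \<Lambda> by simp
  then show "0 < J x y" using 1 by linarith
qed

lemma rescaled_kernel_bound: "\<bar>rescaled_kernel \<sigma> J p\<bar> \<le> \<Lambda>"
proof (cases "fst p = snd p")
  case False
  then have "norm (fst p - snd p) powr (real CARD('n) + \<sigma>) > 0" by simp
  then show ?thesis using kernel_bounds[OF False] \<Lambda>
    by (simp add: rescaled_kernel_def abs_mult field_simps)
qed (use \<Lambda> in \<open>simp add: rescaled_kernel_def\<close>)

lemma L2f_rescaled_kernel:
  "L2f lebesgue F \<Longrightarrow> L2f lebesgue (\<lambda>p. rescaled_kernel \<sigma> J p * F p)"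
  by (rule L2f_bounded_mult[OF _ rescaled_kernel_measurable rescaled_kernel_bound])

lemma energy_form_integrable:
  assumes "gagliardo_finite \<sigma> f" "gagliardo_finite \<sigma> g"
  shows "integrable lebesgue (\<lambda>p. (rescaled_kernel \<sigma> J p * gagliardo_quotient \<sigma> f p) * gagliardo_quotient \<sigma> g p)"
  by (intro L2f_mult_integrable L2f_rescaled_kernel gagliardo_finite_L2f assms)

lemma energy_form_bound:
  assumes f: "gagliardo_finite \<sigma> f" and g: "gagliardo_finite \<sigma> g"
  shows "\<bar>energy_form J f g\<bar> \<le> \<Lambda> * gagliardo_norm \<sigma> f * gagliardo_norm \<sigma> g"
proof -
  let ?f = "gagliardo_quotient \<sigma> f" and ?g = "gagliardo_quotient \<sigma> g"
  have "\<bar>LINT p|lebesgue. (rescaled_kernel \<sigma> J p * ?f p) * ?g p\<bar>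
      \<le> (LINT p|lebesgue. \<bar>(rescaled_kernel \<sigma> J p * ?f p) * ?g p\<bar>)"
    by (rule integral_abs_bound)
  also have "\<dots> \<le> (LINT p|lebesgue. \<Lambda> * \<bar>?f p * ?g p\<bar>)"
  proof (rule integral_mono)
    show "integrable lebesgue (\<lambda>p. \<bar>(rescaled_kernel \<sigma> J p * ?f p) * ?g p\<bar>)"
      using energy_form_integrable[OF f g] by simp
    show "integrable lebesgue (\<lambda>p. \<Lambda> * \<bar>?f p * ?g p\<bar>)"
      using L2f_mult_integrable[OF gagliardo_finite_L2f[OF f] gagliardo_finite_L2f[OF g]] by simp
    show "\<bar>(rescaled_kernel \<sigma> J p * ?f p) * ?g p\<bar> \<le> \<Lambda> * \<bar>?f p * ?g p\<bar>" for p
      using rescaled_kernel_bound[of p] by (simp add: abs_mult mult.assoc mult_right_mono)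
  qed
  also have "\<dots> = \<Lambda> * (LINT p|lebesgue. \<bar>?f p * ?g p\<bar>)" by simp
  also have "\<dots> \<le> \<Lambda> * (l2norm lebesgue ?f * l2norm lebesgue ?g)"
    using \<Lambda> by (intro mult_left_mono l2norm_Cauchy_Schwarz gagliardo_finite_L2f f g) auto
  also have "\<dots> = \<Lambda> * gagliardo_norm \<sigma> f * gagliardo_norm \<sigma> g" by (simp add: gagliardo_norm_def)
  finally show ?thesis unfolding energy_form_eq[of J f g \<sigma>] by simp
qed

lemma energy_form_diff_left:
  assumes "gagliardo_finite \<sigma> f" "gagliardo_finite \<sigma> h" "gagliardo_finite \<sigma> g"
  shows "energy_form J (\<lambda>x. f x - h x) g = energy_form J f g - energy_form J h g"
  using energy_form_integrable[OF assms(1,3)] energy_form_integrable[OF assms(2,3)]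
  unfolding energy_form_eq[of J _ g \<sigma>] gagliardo_quotient_diff
  by (simp add: right_diff_distrib left_diff_distrib)

lemma energy_form_cmult_right: "energy_form J f (\<lambda>x. c * g x) = c * energy_form J f g"
proof -
  have "(f (fst p) - f (snd p)) * (c * g (fst p) - c * g (snd p)) * J (fst p) (snd p) =
      c * ((f (fst p) - f (snd p)) * (g (fst p) - g (snd p)) * J (fst p) (snd p))" for p
    by (simp add: algebra_simps)
  then show ?thesis unfolding energy_form_def by (simp only: integral_mult_right_zero mult.left_commute)
qed

text \<open>Almost everywhere convergence passes to the difference quotients at almost every pair,
  and the quotient of \<open>f\<close> times the bounded weight is a fixed \<open>L^2\<close>
  function. Bounded seminorms thus replace convergence in the seminorm.\<close>

lemma energy_form_weak_convergence:
  assumes f: "gagliardo_finite \<sigma> f" and g: "gagliardo_finite \<sigma> g" and gk: "\<And>k. gagliardo_finite \<sigma> (gk k)"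
    and bd: "\<And>k. gagliardo_norm \<sigma> (gk k) \<le> C"
    and lim: "AE x in lborel. (\<lambda>k. gk k x) \<longlonglongrightarrow> g x"
  shows "(\<lambda>k. energy_form J f (gk k)) \<longlonglongrightarrow> energy_form J f g"
  unfolding energy_form_eq[of J f _ \<sigma>]
proof (intro tendsto_intros L2_weak_convergence L2f_rescaled_kernel gagliardo_finite_L2f f g gk)
  show "l2norm lebesgue (gagliardo_quotient \<sigma> (gk k)) \<le> C" for k
    using bd by (simp add: gagliardo_norm_def)
  show "AE p in lebesgue. (\<lambda>k. gagliardo_quotient \<sigma> (gk k) p) \<longlonglongrightarrow> gagliardo_quotient \<sigma> g p"
    using AE_completion[OF AE_lborel_fst[OF lim]] AE_completion[OF AE_lborel_snd[OF lim]]
    unfolding gagliardo_quotient_def divide_inverse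
    by eventually_elim (intro tendsto_mult tendsto_diff tendsto_const)
qed

end

section \<open>Smooth functions and mollifiers\<close>

lemma C_k_continuous: "C_k k f \<Longrightarrow> continuous_on UNIV f"
proof (cases k)
  case (Suc j)
  assume "C_k k f"
  then have "f differentiable_on UNIV" by (simp add: Suc differentiable_on_def)
  then show ?thesis by (rule differentiable_imp_continuous_on)
qed simp

lemma C_k_SucD: "C_k (Suc k) f \<Longrightarrow> C_k k f"
proof (induction k arbitrary: f)
  case 0 then show ?case using C_k_continuous by fastforce
next
  case (Suc k)
  then show ?case by (metis C_k.simps(2))
qed

text \<open>Frees later proofs from the chosen \<open>frechet_derivative\<close>: any explicit
  derivative coincides with it by uniqueness.\<close>

lemma C_k_SucI:
  assumes "\<And>x. (f has_derivative f' x) (at x)" "\<And>b. b \<in> Basis \<Longrightarrow> C_k k (\<lambda>x. f' x b)"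
  shows "C_k (Suc k) f"
proof -
  have "frechet_derivative f (at x) = f' x" for x
    using frechet_derivative_at[OF assms(1)] by simp
  then show ?thesis using assms by (auto intro: differentiableI)
qed

lemma C_k_has_derivative: "C_k (Suc k) f \<Longrightarrow> (f has_derivative frechet_derivative f (at x)) (at x)"
  by (simp add: frechet_derivative_works)

lemma C_k_const [simp]: "C_k k (\<lambda>x. c)"
proof (induction k arbitrary: c)
  case (Suc k)
  then show ?case by (intro C_k_SucI[where f'="\<lambda>_ _. 0"]) auto
qed simp

lemma C_k_linear: "bounded_linear f \<Longrightarrow> C_k k f"
proof (cases k)
  case (Suc j)
  assume "bounded_linear f"
  then show ?thesis unfolding Suc
    by (intro C_k_SucI[where f'="\<lambda>_. f"] bounded_linear_imp_has_derivative) auto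
qed (auto intro: linear_continuous_on)

lemma C_k_add: "C_k k f \<Longrightarrow> C_k k g \<Longrightarrow> C_k k (\<lambda>x. f x + g x)"
proof (induction k arbitrary: f g)
  case (Suc k)
  show ?case
  proof (rule C_k_SucI)
    show "((\<lambda>x. f x + g x) has_derivative (\<lambda>h. frechet_derivative f (at x) h + frechet_derivative g (at x) h)) (at x)" for x
      using Suc.prems by (intro has_derivative_add C_k_has_derivative)
  qed (use Suc in auto)
qed (auto intro: continuous_intros)

lemma C_k_mult: "C_k k f \<Longrightarrow> C_k k g \<Longrightarrow> C_k k (\<lambda>x. f x * g x)"
proof (induction k arbitrary: f g)
  case (Suc k)
  show ?case
  proof (rule C_k_SucI)
    show "((\<lambda>x. f x * g x) has_derivative (\<lambda>h. f x * frechet_derivative g (at x) h + frechet_derivative f (at x) h * g x)) (at x)" for x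
      using Suc.prems by (intro has_derivative_mult C_k_has_derivative)
    show "C_k k (\<lambda>x. f x * frechet_derivative g (at x) b + frechet_derivative f (at x) b * g x)" if "b \<in> Basis" for b
      using Suc.prems C_k_SucD[OF Suc.prems(1)] C_k_SucD[OF Suc.prems(2)] that by (intro C_k_add Suc.IH) auto
  qed
qed (auto intro: continuous_intros)

text \<open>The derivative of \<open>F j\<close> composed with \<open>g\<close> is
  \<open>F (Suc j)\<close> composed with \<open>g\<close>, times the derivative of \<open>g\<close>.
  Carrying the whole sequence of derivatives, with \<open>j\<close> left free, makes the induction
  on the order close.\<close>

lemma C_k_compose_real:
  fixes F :: "nat \<Rightarrow> real \<Rightarrow> real"
  assumes F: "\<And>j x. (F j has_real_derivative F (Suc j) (g x)) (at (g x))"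
    and g: "C_k k g"
  shows "C_k k (\<lambda>x. F j (g x))"
  using g
proof (induction k arbitrary: j)
  case 0
  have "continuous (at x) (\<lambda>x. F j (g x))" for x
    using 0 F[of j x] continuous_at_compose[of x g "F j"]
    by (simp add: o_def continuous_on_eq_continuous_at DERIV_isCont)
  then show ?case by (simp add: continuous_on_eq_continuous_at)
next
  case (Suc k)
  show ?case
  proof (rule C_k_SucI)
    show "((\<lambda>x. F j (g x)) has_derivative (\<lambda>h. F (Suc j) (g x) * frechet_derivative g (at x) h)) (at x)" for x
      by (rule has_derivative_compose[OF C_k_has_derivative[OF Suc.prems] F[unfolded has_field_derivative_def]])
    show "C_k k (\<lambda>x. F (Suc j) (g x) * frechet_derivative g (at x) b)" if "b \<in> Basis" for b
      using that Suc.prems C_k_SucD[OF Suc.prems] by (intro C_k_mult Suc.IH) auto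
  qed
qed

lemma C_k_fst:
  assumes "C_k k f"
  shows "C_k k (\<lambda>p :: 'a::euclidean_space \<times> 'b::euclidean_space. f (fst p))"
  using assms
proof (induction k arbitrary: f)
  case 0
  then show ?case by (simp add: continuous_on_compose2[OF _ continuous_on_fst[OF continuous_on_id]])
next
  case (Suc k)
  show ?case
  proof (rule C_k_SucI)
    show "((\<lambda>p :: 'a \<times> 'b. f (fst p)) has_derivative (\<lambda>h. frechet_derivative f (at (fst p)) (fst h))) (at p)" for p
      by (rule has_derivative_compose[OF has_derivative_fst[OF has_derivative_ident] C_k_has_derivative[OF Suc.prems]])
    fix b :: "'a \<times> 'b" assume "b \<in> Basis"
    \<comment> \<open>A basis vector of the product lies in one of the factors; those of the second
      factor give the zero derivative.\<close>
    then consider "fst b \<in> Basis" | "fst b = 0" by (auto simp: Basis_prod_def)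
    then show "C_k k (\<lambda>p :: 'a \<times> 'b. frechet_derivative f (at (fst p)) (fst b))"
    proof cases
      case 1
      then show ?thesis using Suc.prems by (intro Suc.IH[of "\<lambda>x. frechet_derivative f (at x) (fst b)"]) auto
    next
      case 2
      have "frechet_derivative f (at x) 0 = 0" for x
        using C_k_has_derivative[OF Suc.prems] by (meson has_derivative_bounded_linear linear_simps(3))
      then show ?thesis by (simp add: 2)
    qed
  qed
qed

text \<open>The derivatives of \<open>exp (-1/x)\<close> have the form \<open>P (1/x) exp (-1/x)\<close>.\<close>

primrec exp_recip_poly :: "nat \<Rightarrow> real poly" where
  "exp_recip_poly 0 = 1"
| "exp_recip_poly (Suc j) = [:0, 0, 1:] * (exp_recip_poly j - pderiv (exp_recip_poly j))"

definition exp_recip :: "nat \<Rightarrow> real \<Rightarrow> real" where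
  "exp_recip j x = (if x \<le> 0 then 0 else poly (exp_recip_poly j) (1 / x) * exp (- (1 / x)))"

lemma poly_div_exp_tendsto_0: "((\<lambda>x::real. poly p x * exp (- x)) \<longlongrightarrow> 0) at_top"
proof -
  have "((\<lambda>x. \<Sum>i\<le>degree p. coeff p i * (x ^ i / exp x)) \<longlongrightarrow> (\<Sum>i\<le>degree p. coeff p i * 0)) at_top"
    by (intro tendsto_sum tendsto_mult tendsto_const tendsto_power_div_exp_0)
  then show ?thesis
    by (simp add: poly_altdef exp_minus divide_inverse sum_distrib_right mult.assoc)
qed

lemma exp_recip_derivative: "(exp_recip j has_real_derivative exp_recip (Suc j) x) (at x)"
proof -
  consider "x < 0" | "x > 0" | "x = 0" by linarith
  then show ?thesis
  proof cases
    case 1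
    have "((\<lambda>x. 0) has_real_derivative exp_recip (Suc j) x) (at x)"
      using 1 by (simp add: exp_recip_def)
    then show ?thesis
      by (rule has_field_derivative_transform_within_open[where S="{..<0}"])
        (use 1 in \<open>auto simp: exp_recip_def\<close>)
  next
    case 2
    have "((\<lambda>x. poly (exp_recip_poly j) (1 / x) * exp (- (1 / x))) has_real_derivative exp_recip (Suc j) x) (at x)"
      using 2
      by (auto intro!: derivative_eq_intros DERIV_chain'[where g="poly (exp_recip_poly j)" and f="\<lambda>x. 1/x"] poly_DERIV
          simp: exp_recip_def power2_eq_square) (simp add: field_simps)
    then show ?thesis
      by (rule has_field_derivative_transform_within_open[where S="{0<..}"])
        (use 2 in \<open>auto simp: exp_recip_def\<close>)
  next
    case 3
    let ?q = "\<lambda>h. (exp_recip j (0 + h) - exp_recip j 0) / h"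
    \<comment> \<open>With \<open>y = 1/h\<close> the right difference quotient at 0 is
      \<open>y\<close> times the polynomial times \<open>exp (- y)\<close>; the left one is
      identically 0.\<close>
    have "((\<lambda>y. poly ([:0, 1:] * exp_recip_poly j) y * exp (- y)) \<longlongrightarrow> 0) at_top"
      by (rule poly_div_exp_tendsto_0)
    from filterlim_compose[OF this filterlim_inverse_at_top_right]
    have "((\<lambda>h. poly ([:0, 1:] * exp_recip_poly j) (inverse h) * exp (- inverse h)) \<longlongrightarrow> 0) (at_right 0)" .
    then have r: "(?q \<longlongrightarrow> 0) (at_right 0)"
      by (rule Lim_transform_eventually)
        (auto simp: eventually_at_filter exp_recip_def divide_inverse mult_ac)
    have "(?q \<longlongrightarrow> 0) (at_left 0)"
      by (rule Lim_transform_eventually[OF tendsto_const])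
        (auto simp: eventually_at_filter exp_recip_def)
    with r have "(?q \<longlongrightarrow> 0) (at 0)" by (simp add: filterlim_at_split)
    then show ?thesis by (simp add: 3 DERIV_def exp_recip_def)
  qed
qed

lemma exp_recip_pos: "x > 0 \<Longrightarrow> exp_recip 0 x > 0"
  and exp_recip_nonpos: "x \<le> 0 \<Longrightarrow> exp_recip j x = 0"
  and exp_recip_nonneg: "exp_recip 0 x \<ge> 0"
  by (auto simp: exp_recip_def)

lemma C_k_exp_recip: "C_k k g \<Longrightarrow> C_k k (\<lambda>x. exp_recip 0 (g x))"
  by (rule C_k_compose_real[where F=exp_recip]) (rule exp_recip_derivative)

lemma C_k_inner_self: "C_k k (\<lambda>x. x \<bullet> x)"
proof (cases k)
  case (Suc j)
  show ?thesis unfolding Suc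
  proof (rule C_k_SucI)
    show "((\<lambda>x. x \<bullet> x) has_derivative (\<lambda>h. x \<bullet> h + h \<bullet> x)) (at x)" for x :: 'a
      by (auto intro!: derivative_eq_intros)
    show "C_k j (\<lambda>x. x \<bullet> b + b \<bullet> x)" for b :: 'a
      by (intro C_k_add C_k_linear bounded_linear_inner_left bounded_linear_inner_right)
  qed
qed (auto intro: continuous_intros)

lemma C_k_recip:
  assumes g: "C_k k g" "\<And>x. g x > 0"
  shows "C_k k (\<lambda>x. 1 / g x)"
proof -
  \<comment> \<open>The successive derivatives of \<open>1/x\<close> on the positive
    half-line.\<close>
  define F :: "nat \<Rightarrow> real \<Rightarrow> real" where "F j x = (-1)^j * fact j / x ^ Suc j" for j x
  have "(F j has_real_derivative F (Suc j) x) (at x)" if "x > 0" for j x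
  proof -
    have "((\<lambda>x. x ^ Suc j) has_real_derivative real (Suc j) * x ^ j) (at x)"
      using DERIV_pow[of "Suc j" x] by simp
    from DERIV_divide[OF DERIV_const[of "(-1)^j * fact j"] this]
    have "(F j has_real_derivative (0 * x ^ Suc j - (-1)^j * fact j * (real (Suc j) * x ^ j)) / (x ^ Suc j * x ^ Suc j)) (at x)"
      using that by (simp add: F_def[abs_def])
    moreover have "(0 * x ^ Suc j - (-1)^j * fact j * (real (Suc j) * x ^ j)) / (x ^ Suc j * x ^ Suc j) = F (Suc j) x"
      using that by (simp add: F_def field_simps)
    ultimately show ?thesis by simp
  qed
  then have "C_k k (\<lambda>x. F 0 (g x))"
    by (intro C_k_compose_real[where F=F, OF _ g(1)]) (use g(2) in simp)
  then show ?thesis by (simp add: F_def)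
qed

text \<open>The quotient \<open>e(t) / (e(t) + e(1 - t))\<close> of the flat function
  \<open>e\<close>. Its denominator never vanishes because \<open>t\<close> or \<open>1 - t\<close>
  is positive.\<close>

lemma smooth_step_exists:
  obtains s :: "real \<Rightarrow> real" where "\<And>k. C_k k s" "\<And>t. t \<le> 0 \<Longrightarrow> s t = 0" "\<And>t. t \<ge> 1 \<Longrightarrow> s t = 1"
    "\<And>t. 0 \<le> s t" "\<And>t. s t \<le> 1"
proof
  define e where "e = exp_recip 0"
  define s where "s t = e t * (1 / (e t + e (1 - t)))" for t
  have pos: "e t + e (1 - t) > 0" for t
    using exp_recip_pos[of t] exp_recip_pos[of "1 - t"] exp_recip_nonneg[of t] exp_recip_nonneg[of "1-t"]
    unfolding e_def by (cases "t > 0") (auto intro: add_pos_nonneg add_nonneg_pos)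
  have ck: "C_k k (\<lambda>t::real. t)" for k by (intro C_k_linear bounded_linear_ident)
  have "C_k k (\<lambda>t::real. 1 + (-1) * t)" for k by (intro C_k_add C_k_mult ck C_k_const)
  then have "C_k k (\<lambda>t::real. 1 - t)" for k by simp
  then show "C_k k s" for k
    unfolding s_def[abs_def] using pos
    by (intro C_k_mult C_k_recip C_k_add) (auto simp: e_def intro: C_k_exp_recip ck)
  show "s t = 0" if "t \<le> 0" for t using that by (simp add: s_def e_def exp_recip_nonpos)
  show "s t = 1" if "t \<ge> 1" for t using that pos[of t] by (simp add: s_def e_def exp_recip_nonpos)
  show "0 \<le> s t" "s t \<le> 1" for t
    using pos[of t] exp_recip_nonneg[of t] exp_recip_nonneg[of "1-t"] by (auto simp: s_def e_def)
qed

section \<open>Convolution with smooth compactly supported functions\<close>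

definition smooth_supported :: "real \<Rightarrow> ('a::euclidean_space \<Rightarrow> real) \<Rightarrow> bool" where
  "smooth_supported r \<rho> \<longleftrightarrow> (\<forall>k. C_k k \<rho>) \<and> (\<forall>x. x \<notin> cball 0 r \<longrightarrow> \<rho> x = 0)"

lemma compact_support_uniformly_continuous:
  fixes f :: "'a::euclidean_space \<Rightarrow> real"
  assumes "continuous_on UNIV f" "\<And>x. x \<notin> cball 0 r \<Longrightarrow> f x = 0" "e > 0"
  obtains d where "d > 0" "\<And>x y. dist x y < d \<Longrightarrow> \<bar>f x - f y\<bar> < e"
proof -
  \<comment> \<open>The margin 1 in the radius: two points closer than 1 either both lie in the
    larger ball or both lie outside the ball that carries \<open>f\<close>.\<close>
  have "uniformly_continuous_on (cball 0 (r + 1)) f"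
    using assms(1) by (intro compact_uniformly_continuous) (auto intro: continuous_on_subset)
  then obtain d where d: "d > 0" "\<And>x y. x \<in> cball 0 (r+1) \<Longrightarrow> y \<in> cball 0 (r+1) \<Longrightarrow> dist x y < d \<Longrightarrow> dist (f x) (f y) < e"
    unfolding uniformly_continuous_on_def using \<open>e > 0\<close> by (metis dist_commute)
  show ?thesis
  proof
    show "min d 1 > 0" using d by simp
    fix x y :: 'a assume xy: "dist x y < min d 1"
    show "\<bar>f x - f y\<bar> < e"
    proof (cases "x \<in> cball 0 (r+1) \<and> y \<in> cball 0 (r+1)")
      case True then show ?thesis using d(2)[of x y] xy by (simp add: dist_real_def)
    next
      case False
      have "norm x \<le> norm y + dist x y" "norm y \<le> norm x + dist x y"
        by (metis dist_norm norm_triangle_sub) (metis dist_commute dist_norm norm_triangle_sub)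
      then have "x \<notin> cball 0 r \<and> y \<notin> cball 0 r" using False xy by auto
      then show ?thesis using assms(2,3) by simp
    qed
  qed
qed

lemma smooth_supported_derivative:
  assumes "smooth_supported r \<rho>" "b \<in> Basis"
  shows "smooth_supported r (\<lambda>x. frechet_derivative \<rho> (at x) b)"
  unfolding smooth_supported_def
proof (intro conjI allI impI)
  show "C_k k (\<lambda>x. frechet_derivative \<rho> (at x) b)" for k
    using assms C_k.simps(2)[of k \<rho>] unfolding smooth_supported_def by blast
  fix x :: 'a assume x: "x \<notin> cball 0 r"
  have "(\<rho> has_derivative (\<lambda>h. 0)) (at x)"
  proof (rule has_derivative_transform_within_open[of "\<lambda>x. 0"])
    show "open (- cball 0 r :: 'a set)" by (simp add: open_Compl)
  qed (use x assms in \<open>auto simp: smooth_supported_def\<close>)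
  then show "frechet_derivative \<rho> (at x) b = 0" using frechet_derivative_at by metis
qed

text \<open>The mean value theorem along the segment from \<open>z\<close> to \<open>z + h\<close>,
  with uniformly continuous partial derivatives. The point is that \<open>d\<close> does not depend
  on \<open>z\<close>, so that the remainder can be integrated in
  \<open>convolution_has_derivative\<close>.\<close>

lemma smooth_supported_taylor:
  fixes \<rho> :: "'a::euclidean_space \<Rightarrow> real"
  assumes \<rho>: "smooth_supported r \<rho>" and "e > 0"
  obtains d where "d > 0"
    "\<And>z h. norm h < d \<Longrightarrow> \<bar>\<rho> (z + h) - \<rho> z - (\<Sum>b\<in>Basis. (h \<bullet> b) * frechet_derivative \<rho> (at z) b)\<bar> \<le> e * norm h"
proof -
  define n where "n = real DIM('a)"
  have n: "n > 0" by (simp add: n_def)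
  have "\<exists>d>0. \<forall>x y. dist x y < d \<longrightarrow> \<bar>frechet_derivative \<rho> (at x) b - frechet_derivative \<rho> (at y) b\<bar> < e / n"
    if "b \<in> Basis" for b
  proof -
    have *: "smooth_supported r (\<lambda>x. frechet_derivative \<rho> (at x) b)" using smooth_supported_derivative[OF \<rho> that] .
    show ?thesis
      by (rule compact_support_uniformly_continuous[of "\<lambda>x. frechet_derivative \<rho> (at x) b" r "e/n"])
        (use * n \<open>e > 0\<close> in \<open>auto simp: smooth_supported_def intro: C_k_continuous\<close>)
  qed
  then obtain D where D: "\<And>b. b \<in> Basis \<Longrightarrow> D b > 0"
    "\<And>b x y. b \<in> Basis \<Longrightarrow> dist x y < D b \<Longrightarrow> \<bar>frechet_derivative \<rho> (at x) b - frechet_derivative \<rho> (at y) b\<bar> < e / n"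
    by metis
  define d where "d = Min (D ` Basis)"
  have d: "d > 0" using D by (auto simp: d_def)
  have dD: "d \<le> D b" if "b \<in> Basis" for b using that by (auto simp: d_def)
  have der: "(\<rho> has_derivative (\<lambda>h. \<Sum>b\<in>Basis. (h \<bullet> b) * frechet_derivative \<rho> (at z) b)) (at z)" for z
  proof -
    have 1: "(\<rho> has_derivative frechet_derivative \<rho> (at z)) (at z)"
      using \<rho> by (intro C_k_has_derivative[of 0]) (auto simp: smooth_supported_def simp del: C_k.simps)
    have lin: "linear (frechet_derivative \<rho> (at z))"
      using has_derivative_linear[OF 1] .
    have "frechet_derivative \<rho> (at z) h = (\<Sum>b\<in>Basis. (h \<bullet> b) * frechet_derivative \<rho> (at z) b)" for h
      using linear_sum[OF lin, of "\<lambda>b. (h \<bullet> b) *\<^sub>R b" Basis]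
      by (simp add: euclidean_representation linear_scale[OF lin])
    then show ?thesis by (intro has_derivative_eq_rhs[OF 1] ext)
  qed
  show ?thesis
  proof
    show "d > 0" by fact
    fix z h :: 'a assume h: "norm h < d"
    let ?D = "\<lambda>z. \<Sum>b\<in>Basis. (h \<bullet> b) * frechet_derivative \<rho> (at z) b"
    have "((\<lambda>t. \<rho> (z + t *\<^sub>R h)) has_real_derivative ?D (z + t *\<^sub>R h)) (at t)" for t
    proof -
      have "((\<lambda>t. z + t *\<^sub>R h) has_derivative (\<lambda>s. s *\<^sub>R h)) (at t)"
        by (auto intro!: derivative_eq_intros)
      from has_derivative_compose[OF this der]
      show ?thesis unfolding has_field_derivative_def
        by (rule has_derivative_eq_rhs) (simp add: fun_eq_iff sum_distrib_left mult_ac)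
    qed
    then obtain t where t: "0 < t" "t < 1" "\<rho> (z + 1 *\<^sub>R h) - \<rho> (z + 0 *\<^sub>R h) = (1 - 0) * ?D (z + t *\<^sub>R h)"
      using MVT2[of 0 1 "\<lambda>t. \<rho> (z + t *\<^sub>R h)" "\<lambda>t. ?D (z + t *\<^sub>R h)"] by auto
    have "\<bar>\<rho> (z + h) - \<rho> z - ?D z\<bar> = \<bar>\<Sum>b\<in>Basis. (h \<bullet> b) * (frechet_derivative \<rho> (at (z + t *\<^sub>R h)) b - frechet_derivative \<rho> (at z) b)\<bar>"
      using t(3) by (simp add: right_diff_distrib sum_subtractf)
    also have "\<dots> \<le> (\<Sum>b\<in>(Basis::'a set). norm h * (e / n))"
    proof (intro order_trans[OF sum_abs] sum_mono)
      fix b :: 'a assume b: "b \<in> Basis"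
      have "dist (z + t *\<^sub>R h) z = t * norm h" using t by (simp add: dist_norm)
      also have "\<dots> \<le> norm h" using t by (simp add: mult_left_le_one_le)
      finally have "dist (z + t *\<^sub>R h) z < D b" using h dD[OF b] by linarith
      from D(2)[OF b this] show "\<bar>(h \<bullet> b) * (frechet_derivative \<rho> (at (z + t *\<^sub>R h)) b - frechet_derivative \<rho> (at z) b)\<bar> \<le> norm h * (e / n)"
        unfolding abs_mult by (intro mult_mono Basis_le_norm b) auto
    qed
    also have "\<dots> = e * norm h" using n by (simp add: n_def)
    finally show "\<bar>\<rho> (z + h) - \<rho> z - ?D z\<bar> \<le> e * norm h" .
  qed
qed

definition convolution :: "('a::euclidean_space \<Rightarrow> real) \<Rightarrow> ('a \<Rightarrow> real) \<Rightarrow> 'a \<Rightarrow> real" where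
  "convolution g \<rho> x = (LINT y|lborel. g y * \<rho> (x - y))"

lemma smooth_supported_bounded:
  fixes \<rho> :: "'a::euclidean_space \<Rightarrow> real"
  assumes "smooth_supported r \<rho>"
  obtains C where "C > 0" "\<And>x. \<bar>\<rho> x\<bar> \<le> C"
proof -
  have "continuous_on UNIV \<rho>" using assms by (auto simp: smooth_supported_def intro: C_k_continuous)
  then have "compact (\<rho> ` cball 0 r)" by (intro compact_continuous_image) (auto intro: continuous_on_subset)
  then obtain C where "C > 0" "\<forall>y\<in>\<rho> ` cball 0 r. norm y \<le> C" using compact_imp_bounded bounded_pos by blast
  then have "C > 0 \<and> (\<forall>x. \<bar>\<rho> x\<bar> \<le> C)" using assms unfolding smooth_supported_def
    by (metis abs_zero image_eqI less_imp_le real_norm_def)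
  then show ?thesis using that by blast
qed

lemma smooth_supported_measurable: "smooth_supported r \<rho> \<Longrightarrow> \<rho> \<in> borel_measurable borel"
  unfolding smooth_supported_def by (intro borel_measurable_continuous_onI) (auto intro: C_k_continuous)

lemma convolution_integrable:
  fixes g :: "'a::euclidean_space \<Rightarrow> real"
  assumes g: "integrable lborel g" and \<rho>: "smooth_supported r \<rho>"
  shows "integrable lborel (\<lambda>y. g y * \<rho> (x - y))"
proof -
  obtain C where C: "C > 0" "\<And>x. \<bar>\<rho> x\<bar> \<le> C" using smooth_supported_bounded[OF \<rho>] by blast
  have [measurable]: "\<rho> \<in> borel_measurable borel" using smooth_supported_measurable[OF \<rho>] .
  show ?thesis
  proof (rule Bochner_Integration.integrable_bound)
    show "integrable lborel (\<lambda>y. C * g y)" using g by simp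
    show "(\<lambda>y. g y * \<rho> (x - y)) \<in> borel_measurable lborel" using g by measurable
    show "AE y in lborel. norm (g y * \<rho> (x - y)) \<le> norm (C * g y)"
      using C by (auto simp: abs_mult mult.commute[of C] intro!: AE_I2 mult_left_mono)
  qed
qed

text \<open>Differentiation under the integral: the remainder in the expansion of
  \<open>\<rho>\<close> is uniform in the point, hence its integral against \<open>g\<close> is
  controlled by the \<open>L^1\<close> norm of \<open>g\<close>.\<close>

lemma convolution_has_derivative:
  fixes g :: "'a::euclidean_space \<Rightarrow> real"
  assumes g: "integrable lborel g" and \<rho>: "smooth_supported r \<rho>"
  shows "(convolution g \<rho> has_derivative
    (\<lambda>h. \<Sum>b\<in>Basis. (h \<bullet> b) * convolution g (\<lambda>x. frechet_derivative \<rho> (at x) b) x)) (at x)"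
  unfolding has_derivative_at_alt
proof (intro conjI allI impI)
  show "bounded_linear (\<lambda>h. \<Sum>b\<in>Basis. (h \<bullet> b) * convolution g (\<lambda>x. frechet_derivative \<rho> (at x) b) x)"
    by (intro bounded_linear_sum bounded_linear_mult_left[THEN bounded_linear_compose] bounded_linear_inner_left)
  fix e :: real assume "0 < e"
  \<comment> \<open>The summand 1 keeps the divisor of \<open>e\<close> positive when
    \<open>g\<close> vanishes almost everywhere.\<close>
  define G where "G = (LINT y|lborel. \<bar>g y\<bar>) + 1"
  have G: "G > 0" by (simp add: G_def add_nonneg_pos)
  obtain d where d: "d > 0"
    "\<And>z h. norm h < d \<Longrightarrow> \<bar>\<rho> (z + h) - \<rho> z - (\<Sum>b\<in>Basis. (h \<bullet> b) * frechet_derivative \<rho> (at z) b)\<bar> \<le> (e / G) * norm h"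
    using smooth_supported_taylor[OF \<rho>, of "e / G"] G \<open>0 < e\<close> by auto
  have main: "norm (convolution g \<rho> y - convolution g \<rho> x -
       (\<Sum>b\<in>Basis. ((y - x) \<bullet> b) * convolution g (\<lambda>x. frechet_derivative \<rho> (at x) b) x)) \<le> e * norm (y - x)"
    if "norm (y - x) < d" for y
  proof -
    define h where "h = y - x"
    let ?R = "\<lambda>z. \<rho> (x - z + h) - \<rho> (x - z) - (\<Sum>b\<in>Basis. (h \<bullet> b) * frechet_derivative \<rho> (at (x - z)) b)"
    have i1: "integrable lborel (\<lambda>z. g z * \<rho> (x - z + h))"
      using convolution_integrable[OF g \<rho>, of "x + h"] by (simp add: algebra_simps)
    have i2: "integrable lborel (\<lambda>z. g z * \<rho> (x - z))" by (rule convolution_integrable[OF g \<rho>])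
    have i3: "integrable lborel (\<lambda>z. g z * frechet_derivative \<rho> (at (x - z)) b)" if "b \<in> Basis" for b
      by (rule convolution_integrable[OF g smooth_supported_derivative[OF \<rho> that]])
    have i4: "integrable lborel (\<lambda>z. \<Sum>b\<in>Basis. (h \<bullet> b) * (g z * frechet_derivative \<rho> (at (x - z)) b))"
      using i3 by (intro Bochner_Integration.integrable_sum integrable_mult_right) auto
    have Req: "g z * ?R z = g z * \<rho> (x - z + h) - g z * \<rho> (x - z) - (\<Sum>b\<in>Basis. (h \<bullet> b) * (g z * frechet_derivative \<rho> (at (x - z)) b))" for z
      by (simp add: right_diff_distrib sum_distrib_left mult.left_commute)
    have "convolution g \<rho> y - convolution g \<rho> x -
       (\<Sum>b\<in>Basis. (h \<bullet> b) * convolution g (\<lambda>x. frechet_derivative \<rho> (at x) b) x) = (LINT z|lborel. g z * ?R z)"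
    proof -
      have "(LINT z|lborel. (\<Sum>b\<in>Basis. (h \<bullet> b) * (g z * frechet_derivative \<rho> (at (x - z)) b))) =
        (\<Sum>b\<in>Basis. (h \<bullet> b) * convolution g (\<lambda>x. frechet_derivative \<rho> (at x) b) x)"
        using i3 by (subst Bochner_Integration.integral_sum) (auto simp: convolution_def)
      moreover have "(LINT z|lborel. g z * \<rho> (x - z + h)) = convolution g \<rho> y"
        by (simp add: convolution_def h_def algebra_simps)
      moreover have "(LINT z|lborel. g z * \<rho> (x - z)) = convolution g \<rho> x"
        by (simp add: convolution_def)
      ultimately show ?thesis unfolding Req using i1 i2 i4 by simp
    qed
    also have "\<bar>\<dots>\<bar> \<le> (LINT z|lborel. (e / G * norm h) * \<bar>g z\<bar>)"
    proof (rule order_trans[OF integral_abs_bound integral_mono])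
      show "integrable lborel (\<lambda>z. \<bar>g z * ?R z\<bar>)" unfolding Req using i1 i2 i4 by auto
      show "integrable lborel (\<lambda>z. (e / G * norm h) * \<bar>g z\<bar>)" using g by auto
      show "\<bar>g z * ?R z\<bar> \<le> (e / G * norm h) * \<bar>g z\<bar>" for z
        using mult_right_mono[OF d(2)[of h "x - z"], of "\<bar>g z\<bar>"] that
        by (simp add: abs_mult h_def mult.commute)
    qed
    also have "\<dots> = e * norm h * ((G - 1) / G)" by (simp add: G_def)
    also have "\<dots> \<le> e * norm h * 1" using G \<open>0 < e\<close> by (intro mult_left_mono) auto
    finally show ?thesis by (simp add: h_def)
  qed
  then show "\<exists>d>0. \<forall>y. norm (y - x) < d \<longrightarrow> norm (convolution g \<rho> y - convolution g \<rho> x -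
       (\<Sum>b\<in>Basis. ((y - x) \<bullet> b) * convolution g (\<lambda>x. frechet_derivative \<rho> (at x) b) x)) \<le> e * norm (y - x)"
    using d(1) by blast
qed

text \<open>All derivatives fall on \<open>\<rho>\<close>, whose partial derivatives are again
  smooth with the same support bound; hence the induction varies \<open>\<rho>\<close> and keeps
  \<open>g\<close>.\<close>

lemma C_k_convolution:
  assumes "integrable lborel g" "smooth_supported r \<rho>"
  shows "C_k k (convolution g \<rho>)"
  using assms(2)
proof (induction k arbitrary: \<rho>)
  case 0
  have "convolution g \<rho> differentiable (at x)" for x
    using convolution_has_derivative[OF assms(1) 0] by (rule differentiableI)
  then show ?case by (simp add: continuous_at_imp_continuous_on differentiable_imp_continuous_within)
next
  case (Suc k)
  show ?case
  proof (rule C_k_SucI[OF convolution_has_derivative[OF assms(1) Suc.prems]])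
    fix b :: 'a assume b: "b \<in> Basis"
    have "(\<Sum>b'\<in>Basis. (b \<bullet> b') * convolution g (\<lambda>x. frechet_derivative \<rho> (at x) b') x) =
      convolution g (\<lambda>x. frechet_derivative \<rho> (at x) b) x" for x
      using b by (simp add: inner_Basis if_distrib[of "\<lambda>x. x * _"] sum.delta cong: if_cong)
    then show "C_k k (\<lambda>x. \<Sum>b'\<in>Basis. (b \<bullet> b') * convolution g (\<lambda>x. frechet_derivative \<rho> (at x) b') x)"
      using Suc.IH[OF smooth_supported_derivative[OF Suc.prems b]] by simp
  qed
qed

lemma mollifier_exists:
  assumes "r > 0"
  obtains \<rho> :: "'a::euclidean_space \<Rightarrow> real"
  where "smooth_supported r \<rho>" "\<And>x. 0 \<le> \<rho> x" "integrable lborel \<rho>" "(LINT x|lborel. \<rho> x) = 1"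
proof -
  \<comment> \<open>The standard bump \<open>exp (- 1 / (r^2 - |x|^2))\<close>, extended by 0
    outside the ball.\<close>
  define \<eta> :: "'a \<Rightarrow> real" where "\<eta> x = exp_recip 0 (r\<^sup>2 + (-1) * (x \<bullet> x))" for x
  have "C_k k \<eta>" for k unfolding \<eta>_def[abs_def]
    by (intro C_k_exp_recip C_k_add C_k_mult C_k_const C_k_inner_self)
  moreover have "\<eta> x = 0" if "x \<notin> cball 0 r" for x
  proof -
    have "r\<^sup>2 \<le> (norm x)\<^sup>2" using that assms by (intro power_mono) auto
    then show ?thesis by (simp add: \<eta>_def power2_norm_eq_inner exp_recip_nonpos)
  qed
  ultimately have s: "smooth_supported r \<eta>" by (simp add: smooth_supported_def)
  have [measurable]: "\<eta> \<in> borel_measurable borel" by (rule smooth_supported_measurable[OF s])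
  have nn: "0 \<le> \<eta> x" for x by (simp add: \<eta>_def exp_recip_nonneg)
  obtain C where C: "C > 0" "\<And>x. \<bar>\<eta> x\<bar> \<le> C" using smooth_supported_bounded[OF s] by blast
  have "integrable lborel (\<lambda>x. indicator (cball 0 r) x *\<^sub>R \<eta> x)"
    by (rule integrableI_bounded_set_indicator[where B=C])
      (use C emeasure_bounded_finite[OF bounded_cball, of "0::'a" r] in \<open>auto simp: less_top intro!: AE_I2\<close>)
  then have int: "integrable lborel \<eta>"
    by (rule Bochner_Integration.integrable_cong[THEN iffD1, rotated 2])
      (use s in \<open>auto simp: smooth_supported_def indicator_def\<close>)
  define I where "I = (LINT x|lborel. \<eta> x)"
  \<comment> \<open>Otherwise the bump, which is positive on the open ball, would make that ball a
    null set.\<close>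
  have "I \<noteq> 0"
  proof
    assume "I = 0"
    then have "AE x in lborel. \<eta> x = 0"
      using integral_nonneg_eq_0_iff_AE[OF int] nn by (simp add: I_def)
    then have "AE x in lborel. x \<notin> ball (0::'a) r"
    proof eventually_elim
      fix x assume "\<eta> x = 0"
      show "x \<notin> ball 0 r"
      proof
        assume "x \<in> ball 0 r"
        then have "(norm x)\<^sup>2 < r\<^sup>2" by (intro power_strict_mono) auto
        then have "\<eta> x > 0" by (simp add: \<eta>_def power2_norm_eq_inner exp_recip_pos)
        then show False using \<open>\<eta> x = 0\<close> by simp
      qed
    qed
    moreover have "{x \<in> space lborel. \<not> x \<notin> ball (0::'a) r} = ball 0 r" by (simp add: ball_def)
    ultimately have "emeasure lborel (ball (0::'a) r) = 0"
      using AE_iff_measurable[of "ball (0::'a) r" lborel "\<lambda>x. x \<notin> ball 0 r"] by (simp only:) simp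
    then show False using assms unit_ball_vol_pos[of "real DIM('a)"] by (simp add: emeasure_ball)
  qed
  moreover have "I \<ge> 0" unfolding I_def by (rule integral_nonneg_AE) (simp add: nn)
  ultimately have I: "I > 0" by simp
  show ?thesis
  proof
    show "smooth_supported r (\<lambda>x. (1 / I) * \<eta> x)"
      using s by (auto simp: smooth_supported_def simp del: times_divide_eq_left intro!: C_k_mult)
  qed (use I nn int in \<open>auto simp: I_def\<close>)
qed

section \<open>Approximation by test functions\<close>

text \<open>Domination by the series of \<open>c k\<close> times the indicator of the ball of radius
  \<open>r k\<close>, whose integrals decay geometrically. The radii may grow or shrink, so both a
  tail at infinity and a singularity at 0 are covered.\<close>

lemma dyadic_nn_integral_finite:
  fixes f :: "'a::euclidean_space \<Rightarrow> real"
  assumes c: "\<And>k. 0 \<le> c k" and r: "\<And>k. 0 \<le> r k" and q: "0 \<le> q" "q < 1" and C: "0 \<le> C"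
    and bd: "\<And>k. c k * r k ^ DIM('a) \<le> C * q ^ k"
    and f: "\<And>z. f z \<noteq> 0 \<Longrightarrow> \<exists>k :: nat. norm z \<le> r k \<and> f z \<le> c k"
  shows "(\<integral>\<^sup>+ z. ennreal (f z) \<partial>lborel) < \<infinity>"
proof -
  let ?t = "\<lambda>k z. ennreal (c k) * indicator (cball (0::'a) (r k)) z"
  let ?w = "unit_ball_vol (real DIM('a))"
  have "(\<integral>\<^sup>+ z. ennreal (f z) \<partial>lborel) \<le> (\<integral>\<^sup>+ z. (\<Sum>k. ?t k z) \<partial>lborel)"
  proof (rule nn_integral_mono)
    fix z :: 'a
    show "ennreal (f z) \<le> (\<Sum>k. ?t k z)"
    proof (cases "f z = 0")
      case False
      then obtain k where k: "norm z \<le> r k" "f z \<le> c k" using f by blast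
      then have "ennreal (f z) \<le> ?t k z" by (simp add: ennreal_leI)
      also have "\<dots> \<le> (\<Sum>k. ?t k z)"
      proof -
        define T where "T = (\<lambda>k. ?t k z)"
        have "T k \<le> suminf T" using sum_le_suminf[of T "{k}"] by simp
        then show ?thesis by (simp only: T_def)
      qed
      finally show ?thesis .
    qed simp
  qed
  also have "\<dots> = (\<Sum>k. ennreal (c k) * emeasure lborel (cball (0::'a) (r k)))"
  proof (subst nn_integral_suminf)
    have [measurable]: "cball (0::'a) (r k) \<in> sets borel" for k by (intro borel_closed closed_cball)
    show "?t k \<in> borel_measurable lborel" for k by measurable
    have "(\<integral>\<^sup>+ z. ?t k z \<partial>lborel) = ennreal (c k) * emeasure lborel (cball (0::'a) (r k))" for k
      by (rule nn_integral_cmult_indicator) simp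
    then show "(\<Sum>k. \<integral>\<^sup>+ z. ?t k z \<partial>lborel) = (\<Sum>k. ennreal (c k) * emeasure lborel (cball (0::'a) (r k)))" by simp
  qed
  also have "\<dots> = (\<Sum>k. ennreal (?w * (c k * r k ^ DIM('a))))"
    using c r by (simp add: emeasure_cball mult_ac flip: ennreal_mult)
  also have "\<dots> \<le> (\<Sum>k. ennreal (?w * (C * q ^ k)))"
    by (intro suminf_le summableI ennreal_leI mult_left_mono bd) auto
  also have "\<dots> < \<infinity>"
  proof -
    have "summable (\<lambda>k. ?w * (C * q ^ k))"
      using q by (intro summable_mult summable_geometric) auto
    then show ?thesis using C q by (subst suminf_ennreal2) auto
  qed
  finally show ?thesis .
qed

lemma ex_power_interval:
  assumes "(x::real) \<ge> 1"
  obtains k where "2 ^ k \<le> x" "x \<le> 2 ^ Suc k"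
proof
  define k where "k = nat \<lfloor>log 2 x\<rfloor>"
  have l: "log 2 x \<ge> 0" using assms by simp
  have "real k \<le> log 2 x" using l by (simp add: k_def)
  then show "2 ^ k \<le> x" using assms by (simp add: le_log_iff powr_realpow)
  have "log 2 x \<le> real (Suc k)" using l unfolding k_def by linarith
  then show "x \<le> 2 ^ Suc k" using assms by (simp only: log_le_iff powr_realpow)
qed

text \<open>The squared increment of a cut-off with Lipschitz constant 1 and values in the unit
  interval is at most \<open>min 1 ((norm z)^2)\<close>; this is that bound divided by the power in
  the Gagliardo seminorm.\<close>

definition levy_density :: "real \<Rightarrow> 'a::euclidean_space \<Rightarrow> real" where
  "levy_density s z = min 1 ((norm z)\<^sup>2) / norm z powr (real DIM('a) + s)"

lemma levy_density_nonneg: "0 \<le> levy_density s z"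
  by (simp add: levy_density_def)

text \<open>Split at \<open>norm z = 1\<close>. On the shell of radius \<open>2^k\<close> the mass
  is of order \<open>2^(-s k)\<close>, on the shell of radius \<open>2^(-k)\<close> of order
  \<open>2^((s - 2) k)\<close>; these decay because \<open>0 < s\<close> and \<open>s < 2\<close>
  respectively.\<close>

lemma levy_density_finite:
  assumes "0 < s" "s < 2"
  shows "(\<integral>\<^sup>+ z. ennreal (levy_density s (z::'a::euclidean_space)) \<partial>lborel) < \<infinity>"
proof -
  define n where "n = real DIM('a)"
  define f1 f2 :: "'a \<Rightarrow> real" where "f1 z = (if norm z \<ge> 1 then levy_density s z else 0)"
    and "f2 z = (if norm z \<ge> 1 then 0 else levy_density s z)" for z
  have "(\<integral>\<^sup>+ z. ennreal (f1 z) \<partial>lborel) < \<infinity>"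
  proof (rule dyadic_nn_integral_finite)
    show "(2^k) powr (-(n + s)) * (2 ^ Suc k) ^ DIM('a) \<le> 2 powr n * (2 powr (-s)) ^ k" for k
      by (simp add: n_def powr_powr mult.commute flip: powr_realpow powr_add) (simp add: algebra_simps)
    show "(2::real) powr (-s) < 1" using assms by (simp add: powr_less_one)
    fix z :: 'a assume "f1 z \<noteq> 0"
    then have z: "norm z \<ge> 1" by (auto simp: f1_def split: if_splits)
    obtain k where k: "2 ^ k \<le> norm z" "norm z \<le> 2 ^ Suc k" using ex_power_interval[OF z] by blast
    have "f1 z \<le> 1 / norm z powr (n + s)"
      using z by (simp add: f1_def levy_density_def n_def divide_right_mono)
    also have "\<dots> = norm z powr (-(n+s))" by (rule powr_minus_divide[symmetric])
    also have "\<dots> \<le> (2^k) powr (-(n+s))" using k(1) assms by (intro powr_mono2') (auto simp: n_def)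
    finally show "\<exists>k. norm z \<le> 2 ^ Suc k \<and> f1 z \<le> (2^k) powr (-(n+s))" using k by blast
  qed auto
  moreover have "(\<integral>\<^sup>+ z. ennreal (f2 z) \<partial>lborel) < \<infinity>"
  proof (rule dyadic_nn_integral_finite)
    show "((1/2)^k)\<^sup>2 * (2 ^ Suc k) powr (n + s) * ((1/2) ^ k) ^ DIM('a) \<le> 2 powr (n + s) * (2 powr (s - 2)) ^ k" for k
    proof -
      have h: "((1/2::real)^k) = 2 powr (- real k)" by (simp add: powr_minus powr_realpow power_one_over inverse_eq_divide)
      have t: "(2::real)^Suc k = 2 powr (real k + 1)" by (simp add: powr_add powr_realpow)
      have pw: "(x powr a) ^ m = x powr (a * real m)" if "x > 0" for x a :: real and m
        using that by (simp add: powr_powr flip: powr_realpow)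
      have e1: "((1/2::real)^k)\<^sup>2 = 2 powr (- real k * 2)" unfolding h by (subst pw) auto
      have e2: "((2::real)^Suc k) powr (n + s) = 2 powr ((real k + 1) * (n + s))" unfolding t powr_powr ..
      have e3: "((1/2::real)^k) ^ DIM('a) = 2 powr (- real k * n)" unfolding h n_def by (subst pw) auto
      have "((1/2)^k)\<^sup>2 * (2 ^ Suc k) powr (n + s) * ((1/2) ^ k) ^ DIM('a) =
         2 powr (- real k * 2 + (real k + 1) * (n + s) + - real k * n)"
        by (subst e1, subst e2, subst e3) (simp only: powr_add)
      also have "\<dots> = 2 powr ((n + s) + (s - 2) * real k)" by (simp add: algebra_simps)
      also have "\<dots> = 2 powr (n + s) * (2 powr (s - 2)) ^ k"
        by (simp add: powr_add powr_powr flip: powr_realpow)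
      finally show ?thesis by simp
    qed
    have "2 powr (s - 2) < (2::real) powr 0" using assms by (intro powr_less_mono) auto
    then show "(2::real) powr (s - 2) < 1" by simp
    fix z :: 'a assume "f2 z \<noteq> 0"
    then have z: "norm z < 1" "z \<noteq> 0" by (auto simp: f2_def levy_density_def split: if_splits)
    then have "1 / norm z \<ge> 1" by simp
    then obtain k where k: "2 ^ k \<le> 1 / norm z" "1 / norm z \<le> 2 ^ Suc k" using ex_power_interval by blast
    have nz: "norm z \<le> (1/2)^k" using k(1) z by (simp add: field_simps power_one_over)
    have "f2 z \<le> (norm z)\<^sup>2 / norm z powr (n + s)"
      using z by (simp add: f2_def levy_density_def n_def divide_right_mono)
    also have "\<dots> = (norm z)\<^sup>2 * (1 / norm z) powr (n + s)" using z by (simp add: powr_divide)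
    also have "\<dots> \<le> ((1/2)^k)\<^sup>2 * (2 ^ Suc k) powr (n + s)"
      using nz k(2) assms by (intro mult_mono power_mono powr_mono2) (auto simp: n_def)
    finally show "\<exists>k. norm z \<le> (1/2) ^ k \<and> f2 z \<le> ((1/2)^k)\<^sup>2 * (2 ^ Suc k) powr (n + s)" using nz by blast
  qed auto
  moreover have "(\<integral>\<^sup>+ z. ennreal (levy_density s (z::'a)) \<partial>lborel) =
     (\<integral>\<^sup>+ z. ennreal (f1 z) \<partial>lborel) + (\<integral>\<^sup>+ z. ennreal (f2 z) \<partial>lborel)"
  proof (subst nn_integral_add[symmetric])
    have [measurable]: "levy_density s \<in> borel_measurable (borel :: 'a measure)"
      unfolding levy_density_def[abs_def] by measurable
    show "(\<lambda>z. ennreal (f1 z)) \<in> borel_measurable lborel" unfolding f1_def by measurable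
    show "(\<lambda>z. ennreal (f2 z)) \<in> borel_measurable lborel" unfolding f2_def by measurable
  qed (auto intro!: nn_integral_cong simp: f1_def f2_def)
  ultimately show ?thesis by simp
qed

section \<open>Stability of the seminorm under cut-off and mollification\<close>

lemma nn_integral_lborel_shift:
  fixes f :: "'a::euclidean_space \<Rightarrow> ennreal"
  assumes [measurable]: "f \<in> borel_measurable borel"
  shows "(\<integral>\<^sup>+ x. f (x - c) \<partial>lborel) = (\<integral>\<^sup>+ x. f x \<partial>lborel)"
proof -
  have "(\<integral>\<^sup>+ x. f x \<partial>lborel) = (\<integral>\<^sup>+ x. f x \<partial>(distr lborel borel ((+) (-c))))"
    by (simp add: lborel_distr_plus)
  also have "\<dots> = (\<integral>\<^sup>+ x. f (-c + x) \<partial>lborel)" by (subst nn_integral_distr) auto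
  finally show ?thesis by simp
qed

lemma lborel_distr_reflect: "distr lborel borel (\<lambda>x. c - x) = (lborel :: 'a::euclidean_space measure)"
proof -
  have "(lborel :: 'a measure) = density (distr lborel borel (\<lambda>x. 0 + (-1::real) *\<^sub>R x)) (\<lambda>_. ennreal (\<bar>-1::real\<bar>^DIM('a)))"
    by (rule lborel_affine) simp
  then have "distr lborel borel (\<lambda>x. - x) = (lborel :: 'a measure)" by (simp add: density_1)
  then have "distr (distr lborel borel (\<lambda>x. - x)) borel ((+) c) = (lborel :: 'a measure)"
    by (simp add: lborel_distr_plus)
  then show ?thesis by (subst (asm) distr_distr) (auto simp: o_def)
qed

lemma nn_integral_lborel_reflect:
  fixes f :: "'a::euclidean_space \<Rightarrow> ennreal"
  assumes [measurable]: "f \<in> borel_measurable borel"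
  shows "(\<integral>\<^sup>+ x. f (c - x) \<partial>lborel) = (\<integral>\<^sup>+ x. f x \<partial>lborel)"
proof -
  have "(\<integral>\<^sup>+ x. f x \<partial>lborel) = (\<integral>\<^sup>+ x. f x \<partial>(distr lborel borel (\<lambda>x. c - x)))"
    by (simp add: lborel_distr_reflect)
  also have "\<dots> = (\<integral>\<^sup>+ x. f (c - x) \<partial>lborel)" by (subst nn_integral_distr) auto
  finally show ?thesis by simp
qed

lemma convolution_commute:
  fixes f :: "'a::euclidean_space \<Rightarrow> real"
  assumes [measurable]: "f \<in> borel_measurable borel" "\<rho> \<in> borel_measurable borel"
  shows "convolution f \<rho> x = (LINT y|lborel. f (x - y) * \<rho> y)"
proof -
  have "convolution f \<rho> x = (LINT y|distr lborel borel (\<lambda>y. x - y). f y * \<rho> (x - y))"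
    by (simp add: lborel_distr_reflect convolution_def)
  also have "\<dots> = (LINT y|lborel. f (x - y) * \<rho> (x - (x - y)))" by (subst integral_distr) auto
  finally show ?thesis by simp
qed

text \<open>Lipschitz instead of smooth: the mollification that follows restores smoothness, and the
  estimates involve only the increments of the cut-off.\<close>

definition cutoff :: "real \<Rightarrow> 'a::euclidean_space \<Rightarrow> real" where
  "cutoff R x = max 0 (min 1 (2 - norm x / R))"

lemma cutoff_range: "0 \<le> cutoff R x" "cutoff R x \<le> 1"
  by (auto simp: cutoff_def)

lemma cutoff_one: "R > 0 \<Longrightarrow> norm x \<le> R \<Longrightarrow> cutoff R x = 1"
  by (auto simp: cutoff_def)

lemma cutoff_zero: "R > 0 \<Longrightarrow> norm x \<ge> 2 * R \<Longrightarrow> cutoff R x = 0"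
  by (auto simp: cutoff_def field_simps)

lemma cutoff_continuous: "R > 0 \<Longrightarrow> continuous_on UNIV (cutoff R)"
  unfolding cutoff_def[abs_def] by (intro continuous_intros) auto

lemma cutoff_lipschitz:
  assumes "R \<ge> 1"
  shows "(cutoff R x - cutoff R y)\<^sup>2 \<le> min 1 ((norm (x - y))\<^sup>2)"
proof -
  have "\<bar>cutoff R x - cutoff R y\<bar> \<le> \<bar>norm x / R - norm y / R\<bar>"
    by (auto simp: cutoff_def max_def min_def)
  also have "\<dots> = \<bar>norm x - norm y\<bar> / R" using assms by (simp flip: diff_divide_distrib)
  also have "\<dots> \<le> norm (x - y) / 1" using assms by (intro frac_le norm_triangle_ineq3) auto
  finally have 1: "\<bar>cutoff R x - cutoff R y\<bar> \<le> norm (x - y)" by simp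
  have 2: "\<bar>cutoff R x - cutoff R y\<bar> \<le> 1"
    using cutoff_range[of R x] cutoff_range[of R y] by linarith
  have "\<bar>cutoff R x - cutoff R y\<bar>\<^sup>2 \<le> (norm (x - y))\<^sup>2" by (rule power_mono[OF 1]) simp
  moreover have "\<bar>cutoff R x - cutoff R y\<bar>\<^sup>2 \<le> 1\<^sup>2" by (rule power_mono[OF 2]) simp
  ultimately show ?thesis by simp
qed

text \<open>The increment of the product is
  \<open>(g x - g y) * cutoff R y + g x * (cutoff R x - cutoff R y)\<close>. The square of the
  second part integrates in \<open>y\<close> to at most the mass of \<open>levy_density\<close>
  times \<open>(g x)^2\<close>, uniformly in \<open>R \<ge> 1\<close>, at the price of the
  \<open>L^2\<close> norm of \<open>g\<close>.\<close>

lemma gagliardo_sq_cutoff: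
  fixes g :: "real^'n \<Rightarrow> real"
  assumes [measurable]: "g \<in> borel_measurable borel" and R: "R \<ge> 1"
  shows "gagliardo_sq \<sigma> (\<lambda>x. cutoff R x * g x) \<le> 2 * gagliardo_sq \<sigma> g +
    2 * ((\<integral>\<^sup>+ z. ennreal (levy_density \<sigma> (z :: real^'n)) \<partial>lborel) * (\<integral>\<^sup>+ x. ennreal ((g x)\<^sup>2) \<partial>lborel))"
proof -
  have [measurable]: "levy_density \<sigma> \<in> borel_measurable (borel :: (real^'n) measure)"
    unfolding levy_density_def[abs_def] by measurable
  let ?D = "\<lambda>p :: (real^'n) \<times> (real^'n). norm (fst p - snd p) powr (real CARD('n) + \<sigma>)"
  let ?q = "\<lambda>p. ennreal ((g (fst p) - g (snd p))\<^sup>2 / ?D p)"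
  let ?l = "\<lambda>p. ennreal ((g (fst p))\<^sup>2 * levy_density \<sigma> (fst p - snd p))"
  have pt: "ennreal ((cutoff R (fst p) * g (fst p) - cutoff R (snd p) * g (snd p))\<^sup>2 / ?D p) \<le> 2 * ?q p + 2 * ?l p"
    for p :: "(real^'n) \<times> (real^'n)"
  proof -
    obtain x y where p: "p = (x, y)" by force
    define a b where "a = (g x - g y) * cutoff R y" and "b = g x * (cutoff R x - cutoff R y)"
    have ab: "cutoff R x * g x - cutoff R y * g y = a + b" by (simp add: a_def b_def algebra_simps)
    have "(a + b)\<^sup>2 \<le> 2 * a\<^sup>2 + 2 * b\<^sup>2"
      using sum_squares_bound[of a b] by (simp add: power2_sum)
    moreover have "a\<^sup>2 \<le> (g x - g y)\<^sup>2"
      unfolding a_def power_mult_distrib using cutoff_range[of R y]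
      by (intro mult_left_le) (auto simp: power_le_one)
    moreover have "b\<^sup>2 \<le> (g x)\<^sup>2 * min 1 ((norm (x - y))\<^sup>2)"
      unfolding b_def power_mult_distrib by (intro mult_left_mono cutoff_lipschitz R) auto
    ultimately have "(cutoff R x * g x - cutoff R y * g y)\<^sup>2 \<le>
        2 * (g x - g y)\<^sup>2 + 2 * ((g x)\<^sup>2 * min 1 ((norm (x - y))\<^sup>2))" unfolding ab by linarith
    then have "(cutoff R x * g x - cutoff R y * g y)\<^sup>2 / ?D p \<le>
        (2 * (g x - g y)\<^sup>2 + 2 * ((g x)\<^sup>2 * min 1 ((norm (x - y))\<^sup>2))) / ?D p"
      by (intro divide_right_mono) auto
    also have "\<dots> = 2 * ((g x - g y)\<^sup>2 / ?D p) + 2 * ((g x)\<^sup>2 * levy_density \<sigma> (x - y))"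
      by (simp add: p levy_density_def add_divide_distrib)
    finally show ?thesis unfolding p
      by (simp add: ennreal_leI levy_density_nonneg flip: ennreal_plus ennreal_mult' ennreal_numeral)
  qed
  have lm: "?l \<in> borel_measurable (lborel \<Otimes>\<^sub>M lborel)" by measurable
  have qm: "?q \<in> borel_measurable (lborel \<Otimes>\<^sub>M lborel)" by measurable
  have "gagliardo_sq \<sigma> (\<lambda>x. cutoff R x * g x) \<le> (\<integral>\<^sup>+ p. 2 * ?q p + 2 * ?l p \<partial>(lborel \<Otimes>\<^sub>M lborel))"
    unfolding gagliardo_sq_def nn_integral_completion lborel_prod by (intro nn_integral_mono pt)
  also have "\<dots> = 2 * (\<integral>\<^sup>+ p. ?q p \<partial>(lborel \<Otimes>\<^sub>M lborel)) + 2 * (\<integral>\<^sup>+ p. ?l p \<partial>(lborel \<Otimes>\<^sub>M lborel))"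
    using lm qm by (subst nn_integral_add) (auto simp: nn_integral_cmult)
  also have "(\<integral>\<^sup>+ p. ?q p \<partial>(lborel \<Otimes>\<^sub>M lborel)) = gagliardo_sq \<sigma> g"
    unfolding gagliardo_sq_def nn_integral_completion lborel_prod ..
  also have "(\<integral>\<^sup>+ p. ?l p \<partial>(lborel \<Otimes>\<^sub>M lborel)) = (\<integral>\<^sup>+ x. \<integral>\<^sup>+ y. ?l (x, y) \<partial>lborel \<partial>lborel)"
    by (rule lborel.nn_integral_fst[symmetric]) (rule lm)
  also have "\<dots> = (\<integral>\<^sup>+ x. ennreal ((g x)\<^sup>2) * (\<integral>\<^sup>+ z. ennreal (levy_density \<sigma> (z :: real^'n)) \<partial>lborel) \<partial>lborel)"
  proof (rule nn_integral_cong)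
    fix x :: "real^'n"
    have "(\<integral>\<^sup>+ y. ?l (x, y) \<partial>lborel) = ennreal ((g x)\<^sup>2) * (\<integral>\<^sup>+ y. ennreal (levy_density \<sigma> (x - y)) \<partial>lborel)"
      by (simp add: ennreal_mult levy_density_nonneg nn_integral_cmult)
    also have "(\<integral>\<^sup>+ y. ennreal (levy_density \<sigma> (x - y)) \<partial>lborel) = (\<integral>\<^sup>+ y. ennreal (levy_density \<sigma> (y :: real^'n)) \<partial>lborel)"
      by (rule nn_integral_lborel_reflect) measurable
    finally show "(\<integral>\<^sup>+ y. ?l (x, y) \<partial>lborel) = ennreal ((g x)\<^sup>2) * (\<integral>\<^sup>+ z. ennreal (levy_density \<sigma> (z :: real^'n)) \<partial>lborel)" .
  qed
  also have "\<dots> = (\<integral>\<^sup>+ z. ennreal (levy_density \<sigma> (z :: real^'n)) \<partial>lborel) * (\<integral>\<^sup>+ x. ennreal ((g x)\<^sup>2) \<partial>lborel)"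
    by (simp add: nn_integral_multc mult.commute)
  finally show ?thesis .
qed

text \<open>Jensen's inequality for the probability density \<open>\<rho>\<close>, then Fubini and
  the invariance of the singular weight under simultaneous translation of both points.\<close>

lemma gagliardo_sq_convolution:
  fixes f :: "real^'n \<Rightarrow> real"
  assumes f[measurable]: "f \<in> borel_measurable borel" and K: "\<And>x. \<bar>f x\<bar> \<le> K"
    and \<rho>[measurable]: "\<rho> \<in> borel_measurable borel" and \<rho>0: "\<And>x. 0 \<le> \<rho> x" and \<rho>i: "integrable lborel \<rho>"
    and \<rho>1: "(LINT x|lborel. \<rho> x) = 1"
  shows "gagliardo_sq \<sigma> (convolution f \<rho>) \<le> gagliardo_sq \<sigma> f"
proof -
  let ?D = "\<lambda>p :: (real^'n) \<times> (real^'n). norm (fst p - snd p) powr (real CARD('n) + \<sigma>)"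
  let ?h = "\<lambda>p. ennreal ((f (fst p) - f (snd p))\<^sup>2 / ?D p)"
  let ?H = "\<lambda>p y. ennreal ((f (fst p - y) - f (snd p - y))\<^sup>2 / ?D p * \<rho> y)"
  have f1: "(f (x - y) - f (z - y))\<^sup>2 \<le> (2 * K)\<^sup>2" for x y z
  proof -
    have "\<bar>f (x - y) - f (z - y)\<bar> \<le> 2 * K" using K[of "x - y"] K[of "z - y"] by linarith
    then have "\<bar>f (x - y) - f (z - y)\<bar>\<^sup>2 \<le> (2 * K)\<^sup>2" by (rule power_mono) simp
    then show ?thesis by simp
  qed
  have i1: "integrable lborel (\<lambda>y. f (x - y) * \<rho> y)" for x
  proof (rule Bochner_Integration.integrable_bound)
    show "integrable lborel (\<lambda>y. K * \<rho> y)" using \<rho>i by simp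
    have "\<bar>f (x - y)\<bar> * \<rho> y \<le> \<bar>K\<bar> * \<rho> y" for y
      using K[of "x - y"] by (intro mult_right_mono \<rho>0) auto
    then show "AE y in lborel. norm (f (x - y) * \<rho> y) \<le> norm (K * \<rho> y)"
      using \<rho>0 by (simp add: abs_mult)
  qed measurable
  have i2: "integrable lborel (\<lambda>y. (f (x - y) - f (z - y))\<^sup>2 * \<rho> y)" for x z
  proof (rule Bochner_Integration.integrable_bound)
    show "integrable lborel (\<lambda>y. (2 * K)\<^sup>2 * \<rho> y)" using \<rho>i by simp
    have "(f (x - y) - f (z - y))\<^sup>2 * \<rho> y \<le> (2*K)\<^sup>2 * \<rho> y" for y
      by (intro mult_right_mono \<rho>0 f1)
    then show "AE y in lborel. norm ((f (x - y) - f (z - y))\<^sup>2 * \<rho> y) \<le> norm ((2*K)\<^sup>2 * \<rho> y)"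
      using \<rho>0 by (simp add: abs_mult)
  qed measurable
  \<comment> \<open>Cauchy-Schwarz with the density \<open>\<rho>\<close> written as the product of
    two square roots.\<close>
  have jensen: "(convolution f \<rho> x - convolution f \<rho> z)\<^sup>2 \<le> (LINT y|lborel. (f (x - y) - f (z - y))\<^sup>2 * \<rho> y)" for x z
  proof -
    let ?F = "\<lambda>y. (f (x - y) - f (z - y)) * sqrt (\<rho> y)" and ?G = "\<lambda>y. sqrt (\<rho> y)"
    have F: "L2f lborel ?F" and G: "L2f lborel ?G"
      using i2[of x z] \<rho>i \<rho>0 by (auto simp: L2f_def power_mult_distrib)
    have "convolution f \<rho> x - convolution f \<rho> z = (LINT y|lborel. ?F y * ?G y)"
      unfolding convolution_commute[OF f \<rho>] using i1 \<rho>0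
      by (simp add: left_diff_distrib mult.assoc flip: Bochner_Integration.integral_diff)
    then have "\<bar>convolution f \<rho> x - convolution f \<rho> z\<bar> \<le> l2norm lborel ?F * l2norm lborel ?G"
      using l2norm_Cauchy_Schwarz'[OF F G] by simp
    moreover have "l2norm lborel ?G = 1" using \<rho>0 \<rho>1 by (simp add: l2norm_def)
    ultimately have "\<bar>convolution f \<rho> x - convolution f \<rho> z\<bar> \<le> l2norm lborel ?F" by simp
    then have "\<bar>convolution f \<rho> x - convolution f \<rho> z\<bar>\<^sup>2 \<le> (l2norm lborel ?F)\<^sup>2" by (rule power_mono) simp
    then show ?thesis using \<rho>0 by (simp add: l2norm_power2 power_mult_distrib)
  qed
  have pt: "ennreal ((convolution f \<rho> (fst p) - convolution f \<rho> (snd p))\<^sup>2 / ?D p) \<le> (\<integral>\<^sup>+ y. ?H p y \<partial>lborel)" for p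
  proof -
    have "ennreal ((convolution f \<rho> (fst p) - convolution f \<rho> (snd p))\<^sup>2 / ?D p) \<le>
      ennreal ((LINT y|lborel. (f (fst p - y) - f (snd p - y))\<^sup>2 * \<rho> y) / ?D p)"
      by (intro ennreal_leI divide_right_mono jensen) auto
    also have "\<dots> = ennreal (LINT y|lborel. (f (fst p - y) - f (snd p - y))\<^sup>2 / ?D p * \<rho> y)"
      by simp
    also have "\<dots> = (\<integral>\<^sup>+ y. ?H p y \<partial>lborel)"
      using i2[of "fst p" "snd p"] \<rho>0 by (intro nn_integral_eq_integral[symmetric]) auto
    finally show ?thesis .
  qed
  have m: "(\<lambda>(p, y). ?H p y) \<in> borel_measurable (lborel \<Otimes>\<^sub>M lborel)"
  proof -
    have "(\<lambda>(p, y). ?H p y) \<in> borel_measurable ((borel \<Otimes>\<^sub>M borel) \<Otimes>\<^sub>M borel)" by measurable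
    moreover have "sets (lborel \<Otimes>\<^sub>M lborel) = sets ((borel \<Otimes>\<^sub>M borel) \<Otimes>\<^sub>M (borel :: (real^'n) measure))"
      by (intro sets_pair_measure_cong) (simp_all only: sets_lborel borel_prod)
    ultimately show ?thesis using measurable_cong_sets[OF _ refl] by blast
  qed
  have hm[measurable]: "?h \<in> borel_measurable borel" by (simp flip: borel_prod)
  have inner: "(\<integral>\<^sup>+ p. ?H p y \<partial>lborel) = ennreal (\<rho> y) * gagliardo_sq \<sigma> f" for y
  proof -
    have "(\<integral>\<^sup>+ p. ?H p y \<partial>lborel) = (\<integral>\<^sup>+ p. ennreal (\<rho> y) * ?h (p - (y, y)) \<partial>lborel)"
      using \<rho>0 by (intro nn_integral_cong) (simp add: mult.commute flip: ennreal_mult)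
    also have "\<dots> = ennreal (\<rho> y) * (\<integral>\<^sup>+ p. ?h (p - (y, y)) \<partial>lborel)"
      by (intro nn_integral_cmult) measurable
    also have "(\<integral>\<^sup>+ p. ?h (p - (y, y)) \<partial>lborel) = (\<integral>\<^sup>+ p. ?h p \<partial>lborel)"
      by (rule nn_integral_lborel_shift[OF hm])
    finally show ?thesis by (simp add: gagliardo_sq_def nn_integral_completion)
  qed
  have "gagliardo_sq \<sigma> (convolution f \<rho>) \<le> (\<integral>\<^sup>+ p. \<integral>\<^sup>+ y. ?H p y \<partial>lborel \<partial>lborel)"
    unfolding gagliardo_sq_def nn_integral_completion by (intro nn_integral_mono pt)
  also have "\<dots> = (\<integral>\<^sup>+ y. \<integral>\<^sup>+ p. ?H p y \<partial>lborel \<partial>lborel)"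
    using lborel_pair.Fubini'[OF m] by simp
  also have "\<dots> = gagliardo_sq \<sigma> f"
    unfolding inner using \<rho>i \<rho>0 \<rho>1 by (simp add: nn_integral_multc nn_integral_eq_integral)
  finally show ?thesis .
qed

section \<open>Approximation in the mean\<close>

lemma bounded_support_integrable:
  fixes f :: "'a::euclidean_space \<Rightarrow> real"
  assumes "f \<in> borel_measurable borel" "\<And>x. \<bar>f x\<bar> \<le> K" "\<And>x. x \<notin> cball 0 R \<Longrightarrow> f x = 0"
  shows "integrable lborel f"
proof -
  have "integrable lborel (\<lambda>x. indicator (cball 0 R) x *\<^sub>R f x)"
    by (rule integrableI_bounded_set_indicator[where B=K])
      (use assms emeasure_bounded_finite[OF bounded_cball, of "0::'a" R] in \<open>auto simp: less_top intro!: AE_I2\<close>)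
  moreover have "(\<lambda>x. indicator (cball 0 R) x *\<^sub>R f x) = f"
    using assms(3) by (auto simp: indicator_def fun_eq_iff)
  ultimately show ?thesis by simp
qed

text \<open>A measurable function is an almost everywhere limit of continuous ones; clamping these
  to \<open>[-K, K]\<close> and cutting them off supplies a dominating function without disturbing
  the limit.\<close>

lemma continuous_L1_approximation:
  fixes f :: "'a::euclidean_space \<Rightarrow> real"
  assumes f[measurable]: "f \<in> borel_measurable borel" and K: "\<And>x. \<bar>f x\<bar> \<le> K"
    and supp: "\<And>x. x \<notin> cball 0 R \<Longrightarrow> f x = 0" and R: "R > 0" and e: "e > 0"
  obtains h where "continuous_on UNIV h" "\<And>x. \<bar>h x\<bar> \<le> K" "\<And>x. x \<notin> cball 0 (2 * R) \<Longrightarrow> h x = 0"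
    "(LINT x|lborel. \<bar>f x - h x\<bar>) < e"
proof -
  have K0: "K \<ge> 0" using K[of 0] by linarith
  have "f measurable_on UNIV"
    by (subst measurable_on_iff_borel_measurable) (auto simp: measurable_completion lebesgue_on_UNIV_eq)
  then obtain N g where N: "negligible N" and g: "\<And>n. continuous_on UNIV (g n)"
    and lim: "\<And>x. x \<notin> N \<Longrightarrow> (\<lambda>n. g n x) \<longlonglongrightarrow> f x"
    unfolding measurable_on_def by auto
  define h where "h n x = cutoff R x * max (-K) (min K (g n x))" for n x
  have hc: "continuous_on UNIV (h n)" for n
    unfolding h_def by (intro continuous_intros cutoff_continuous[OF R] g)
  then have [measurable]: "h n \<in> borel_measurable borel" for n by (rule borel_measurable_continuous_onI)
  have clamp: "\<bar>max (-K) (min K t)\<bar> \<le> K" for t using K0 by auto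
  have hK: "\<bar>h n x\<bar> \<le> K" for n x
    unfolding h_def abs_mult using clamp[of "g n x"] cutoff_range[of R x] K0
    by (smt (verit) mult_left_le_one_le)
  have hs: "h n x = 0" if "x \<notin> cball 0 (2 * R)" for n x
    using that cutoff_zero[OF R, of x] by (simp add: h_def)
  have "(\<lambda>n. LINT x|lborel. \<bar>f x - h n x\<bar>) \<longlonglongrightarrow> (LINT x|(lborel :: 'a measure). (0::real))"
  proof (rule integral_dominated_convergence[where w="\<lambda>x. (2 * K) * indicator (cball (0::'a) (2*R)) x"])
    show "integrable lborel (\<lambda>x::'a. (2 * K) * indicator (cball 0 (2*R)) x)"
      by (rule bounded_support_integrable[where K="2*K" and R="2*R"]) (use K0 in \<open>auto simp: indicator_def\<close>)
    have "AE x in lebesgue. x \<notin> N"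
      using N by (intro AE_not_in) (simp add: negligible_iff_null_sets)
    then have "AE x in lborel. x \<notin> N" by (simp add: AE_completion_iff)
    then show "AE x in lborel. (\<lambda>n. \<bar>f x - h n x\<bar>) \<longlonglongrightarrow> 0"
    proof eventually_elim
      fix x assume "x \<notin> N"
      then have "(\<lambda>n. \<bar>f x - h n x\<bar>) \<longlonglongrightarrow> \<bar>f x - cutoff R x * max (-K) (min K (f x))\<bar>"
        unfolding h_def by (intro tendsto_intros lim)
      moreover have "cutoff R x * max (-K) (min K (f x)) = f x"
        using K[of x] supp[of x] cutoff_one[OF R, of x] K0 by (cases "x \<in> cball 0 R") auto
      ultimately show "(\<lambda>n. \<bar>f x - h n x\<bar>) \<longlonglongrightarrow> 0" by simp
    qed
    show "AE x in lborel. norm \<bar>f x - h n x\<bar> \<le> (2 * K) * indicator (cball 0 (2*R)) x" for n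
    proof (rule AE_I2)
      fix x
      show "norm \<bar>f x - h n x\<bar> \<le> (2 * K) * indicator (cball 0 (2*R)) x"
      proof (cases "x \<in> cball 0 (2*R)")
        case True then show ?thesis using K[of x] hK[of n x] by (simp add: indicator_def)
      next
        case False
        then have "x \<notin> cball 0 R" using R by auto
        then show ?thesis using False supp hs by (simp add: indicator_def)
      qed
    qed
  qed auto
  then have "(\<lambda>n. LINT x|lborel. \<bar>f x - h n x\<bar>) \<longlonglongrightarrow> 0" by simp
  from order_tendstoD(2)[OF this e] obtain n where "(LINT x|lborel. \<bar>f x - h n x\<bar>) < e"
    by (auto simp: eventually_sequentially)
  then show ?thesis using that[OF hc hK hs] by blast
qed

text \<open>The continuous approximant is uniformly continuous with bounded support, so its
  translates are close. The approximation errors of \<open>f\<close> and of its translate coincide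
  by translation invariance.\<close>

lemma L1_translation_continuous:
  fixes f :: "'a::euclidean_space \<Rightarrow> real"
  assumes f[measurable]: "f \<in> borel_measurable borel" and K: "\<And>x. \<bar>f x\<bar> \<le> K"
    and supp: "\<And>x. x \<notin> cball 0 R \<Longrightarrow> f x = 0" and R: "R > 0" and e: "e > 0"
  obtains d where "d > 0" "\<And>y. norm y < d \<Longrightarrow> (\<integral>\<^sup>+ x. ennreal \<bar>f (x - y) - f x\<bar> \<partial>lborel) \<le> ennreal e"
proof -
  obtain h where h: "continuous_on UNIV h" "\<And>x. \<bar>h x\<bar> \<le> K" "\<And>x. x \<notin> cball 0 (2 * R) \<Longrightarrow> h x = 0"
    "(LINT x|lborel. \<bar>f x - h x\<bar>) < e / 3"
    using continuous_L1_approximation[OF f K supp R, of "e/3"] e by auto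
  have [measurable]: "h \<in> borel_measurable borel" using h(1) by (rule borel_measurable_continuous_onI)
  have ih: "integrable lborel h" by (rule bounded_support_integrable[OF _ h(2,3)]) auto
  have "integrable lborel f" by (rule bounded_support_integrable[OF _ K supp]) auto
  then have "(\<integral>\<^sup>+ x. ennreal \<bar>f x - h x\<bar> \<partial>lborel) = ennreal (LINT x|lborel. \<bar>f x - h x\<bar>)"
    using ih by (intro nn_integral_eq_integral) auto
  also have "\<dots> \<le> ennreal (e / 3)" using h(4) by (intro ennreal_leI) auto
  finally have fh: "(\<integral>\<^sup>+ x. ennreal \<bar>f x - h x\<bar> \<partial>lborel) \<le> ennreal (e / 3)" .
  define B where "B = measure lborel (cball (0::'a) (2 * R + 1))"
  have B: "emeasure lborel (cball (0::'a) (2 * R + 1)) = ennreal B" "B \<ge> 0"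
    using emeasure_eq_ennreal_measure[of lborel "cball (0::'a) (2 * R + 1)"]
      emeasure_bounded_finite[OF bounded_cball, of "0::'a" "2 * R + 1"] by (auto simp: B_def)
  \<comment> \<open>Scaled so that the uniform error, integrated over a ball containing the supports
    of \<open>h\<close> and of its translates by vectors shorter than 1, is at most
    \<open>e / 3\<close>.\<close>
  define e' where "e' = e / (3 * (B + 1))"
  have e': "e' > 0" "e' * B \<le> e / 3" using e B(2) by (auto simp: e'_def field_simps)
  obtain d where d: "d > 0" "\<And>x y. dist x y < d \<Longrightarrow> \<bar>h x - h y\<bar> < e'"
    using compact_support_uniformly_continuous[OF h(1,3) e'(1)] by blast
  show ?thesis
  proof
    show "min d 1 > 0" using d by simp
    fix y :: 'a assume y: "norm y < min d 1"
    have pt: "ennreal \<bar>f (x - y) - f x\<bar> \<le> ennreal \<bar>f (x - y) - h (x - y)\<bar> +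
        ennreal e' * indicator (cball 0 (2*R+1)) x + ennreal \<bar>f x - h x\<bar>" for x
    proof -
      have "\<bar>h (x - y) - h x\<bar> \<le> e' * indicator (cball 0 (2*R+1)) x"
      proof (cases "x \<in> cball 0 (2*R+1)")
        case True
        then show ?thesis using d(2)[of "x - y" x] y by (simp add: dist_norm)
      next
        case False
        then have "x \<notin> cball 0 (2*R)" "x - y \<notin> cball 0 (2*R)"
          using y norm_triangle_sub[of x y] by auto
        then show ?thesis using h(3) False by simp
      qed
      then have "\<bar>f (x - y) - f x\<bar> \<le> \<bar>f (x - y) - h (x - y)\<bar> + e' * indicator (cball 0 (2*R+1)) x + \<bar>f x - h x\<bar>"
        by linarith
      then show ?thesis using e'
        by (simp add: ennreal_leI flip: ennreal_plus ennreal_mult' ennreal_indicator)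
    qed
    have "(\<integral>\<^sup>+ x. ennreal \<bar>f (x - y) - f x\<bar> \<partial>lborel) \<le> (\<integral>\<^sup>+ x. ennreal \<bar>f (x - y) - h (x - y)\<bar> +
        ennreal e' * indicator (cball 0 (2*R+1)) x + ennreal \<bar>f x - h x\<bar> \<partial>lborel)"
      by (intro nn_integral_mono pt)
    also have "\<dots> = (\<integral>\<^sup>+ x. ennreal \<bar>f (x - y) - h (x - y)\<bar> \<partial>lborel) + ennreal e' * ennreal B +
        (\<integral>\<^sup>+ x. ennreal \<bar>f x - h x\<bar> \<partial>lborel)"
    proof -
      have [measurable]: "cball (0::'a) (2*R+1) \<in> sets borel" by (intro borel_closed closed_cball)
      have "(\<integral>\<^sup>+ x. ennreal e' * indicator (cball (0::'a) (2*R+1)) x \<partial>lborel) = ennreal e' * ennreal B"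
        using B by (subst nn_integral_cmult_indicator) auto
      then show ?thesis by (subst nn_integral_add, measurable)+
    qed
    also have "(\<integral>\<^sup>+ x. ennreal \<bar>f (x - y) - h (x - y)\<bar> \<partial>lborel) = (\<integral>\<^sup>+ x. ennreal \<bar>f x - h x\<bar> \<partial>lborel)"
      by (rule nn_integral_lborel_shift) measurable
    also have "(\<integral>\<^sup>+ x. ennreal \<bar>f x - h x\<bar> \<partial>lborel) + ennreal e' * ennreal B + (\<integral>\<^sup>+ x. ennreal \<bar>f x - h x\<bar> \<partial>lborel)
      \<le> ennreal (e / 3) + ennreal (e / 3) + ennreal (e / 3)"
      using e' B(2) by (intro add_mono fh) (simp add: ennreal_leI flip: ennreal_mult)
    also have "\<dots> = ennreal e" using e by (simp flip: ennreal_plus)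
    finally show "(\<integral>\<^sup>+ x. ennreal \<bar>f (x - y) - f x\<bar> \<partial>lborel) \<le> ennreal e" .
  qed
qed

text \<open>The error is an average over \<open>y\<close> of translation errors, and only
  translations with \<open>norm y \<le> r\<close> carry weight.\<close>

lemma convolution_L1_close:
  fixes f :: "'a::euclidean_space \<Rightarrow> real"
  assumes f[measurable]: "f \<in> borel_measurable borel" and K: "\<And>x. \<bar>f x\<bar> \<le> K"
    and \<rho>: "smooth_supported r \<rho>" and \<rho>0: "\<And>x. 0 \<le> \<rho> x" and \<rho>i: "integrable lborel \<rho>"
    and \<rho>1: "(LINT x|lborel. \<rho> x) = 1"
    and close: "\<And>y. norm y \<le> r \<Longrightarrow> (\<integral>\<^sup>+ x. ennreal \<bar>f (x - y) - f x\<bar> \<partial>lborel) \<le> ennreal e"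
  shows "(\<integral>\<^sup>+ x. ennreal \<bar>convolution f \<rho> x - f x\<bar> \<partial>lborel) \<le> ennreal e"
proof -
  have [measurable]: "\<rho> \<in> borel_measurable borel" by (rule smooth_supported_measurable[OF \<rho>])
  have i1: "integrable lborel (\<lambda>y. f (x - y) * \<rho> y)" for x
  proof (rule Bochner_Integration.integrable_bound)
    show "integrable lborel (\<lambda>y. K * \<rho> y)" using \<rho>i by simp
    have "\<bar>f (x - y)\<bar> * \<rho> y \<le> \<bar>K\<bar> * \<rho> y" for y
      using K[of "x - y"] by (intro mult_right_mono \<rho>0) auto
    then show "AE y in lborel. norm (f (x - y) * \<rho> y) \<le> norm (K * \<rho> y)"
      using \<rho>0 by (simp add: abs_mult)
  qed measurable
  have pt: "ennreal \<bar>convolution f \<rho> x - f x\<bar> \<le> (\<integral>\<^sup>+ y. ennreal (\<rho> y) * ennreal \<bar>f (x - y) - f x\<bar> \<partial>lborel)" for x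
  proof -
    have "convolution f \<rho> x - f x = (LINT y|lborel. f (x - y) * \<rho> y) - f x * (LINT y|lborel. \<rho> y)"
      by (simp add: \<rho>1 convolution_commute)
    also have "\<dots> = (LINT y|lborel. (f (x - y) - f x) * \<rho> y)"
      using i1[of x] \<rho>i by (simp add: left_diff_distrib)
    also have "\<bar>\<dots>\<bar> \<le> (LINT y|lborel. \<bar>(f (x - y) - f x) * \<rho> y\<bar>)" by (rule integral_abs_bound)
    finally have "ennreal \<bar>convolution f \<rho> x - f x\<bar> \<le> ennreal (LINT y|lborel. \<bar>(f (x - y) - f x) * \<rho> y\<bar>)"
      by (rule ennreal_leI)
    also have "\<dots> = (\<integral>\<^sup>+ y. ennreal \<bar>(f (x - y) - f x) * \<rho> y\<bar> \<partial>lborel)"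
      using i1[of x] \<rho>i by (intro nn_integral_eq_integral[symmetric]) (auto simp: left_diff_distrib)
    also have "\<dots> = (\<integral>\<^sup>+ y. ennreal (\<rho> y) * ennreal \<bar>f (x - y) - f x\<bar> \<partial>lborel)"
      using \<rho>0 by (intro nn_integral_cong) (simp add: abs_mult mult.commute flip: ennreal_mult)
    finally show ?thesis .
  qed
  have m: "(\<lambda>(x, y). ennreal (\<rho> y) * ennreal \<bar>f (x - y) - f x\<bar>) \<in> borel_measurable (lborel \<Otimes>\<^sub>M lborel)"
    by measurable
  have "(\<integral>\<^sup>+ x. ennreal \<bar>convolution f \<rho> x - f x\<bar> \<partial>lborel) \<le>
     (\<integral>\<^sup>+ x. \<integral>\<^sup>+ y. ennreal (\<rho> y) * ennreal \<bar>f (x - y) - f x\<bar> \<partial>lborel \<partial>lborel)"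
    by (intro nn_integral_mono pt)
  also have "\<dots> = (\<integral>\<^sup>+ y. \<integral>\<^sup>+ x. ennreal (\<rho> y) * ennreal \<bar>f (x - y) - f x\<bar> \<partial>lborel \<partial>lborel)"
    using lborel_pair.Fubini'[OF m] by simp
  also have "\<dots> = (\<integral>\<^sup>+ y. ennreal (\<rho> y) * (\<integral>\<^sup>+ x. ennreal \<bar>f (x - y) - f x\<bar> \<partial>lborel) \<partial>lborel)"
    by (intro nn_integral_cong nn_integral_cmult) measurable
  also have "\<dots> \<le> (\<integral>\<^sup>+ y. ennreal (\<rho> y) * ennreal e \<partial>lborel)"
  proof (rule nn_integral_mono)
    fix y show "ennreal (\<rho> y) * (\<integral>\<^sup>+ x. ennreal \<bar>f (x - y) - f x\<bar> \<partial>lborel) \<le> ennreal (\<rho> y) * ennreal e"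
      using \<rho> close[of y] by (cases "norm y \<le> r") (auto intro: mult_left_mono simp: smooth_supported_def)
  qed
  also have "\<dots> = ennreal e"
    using \<rho>i \<rho>0 \<rho>1 by (simp add: nn_integral_multc nn_integral_eq_integral)
  finally show ?thesis .
qed

lemma convolution_bound:
  fixes f :: "'a::euclidean_space \<Rightarrow> real"
  assumes [measurable]: "f \<in> borel_measurable borel" and K: "\<And>x. \<bar>f x\<bar> \<le> K"
    and [measurable]: "\<rho> \<in> borel_measurable borel" and \<rho>0: "\<And>x. 0 \<le> \<rho> x" and \<rho>i: "integrable lborel \<rho>"
    and \<rho>1: "(LINT x|lborel. \<rho> x) = 1"
  shows "\<bar>convolution f \<rho> x\<bar> \<le> K"
proof -
  have le: "\<bar>f (x - y) * \<rho> y\<bar> \<le> K * \<rho> y" for y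
    using K[of "x - y"] \<rho>0[of y] by (simp add: abs_mult mult_right_mono)
  have i: "integrable lborel (\<lambda>y. f (x - y) * \<rho> y)"
  proof (rule Bochner_Integration.integrable_bound)
    show "integrable lborel (\<lambda>y. K * \<rho> y)" using \<rho>i by simp
    show "AE y in lborel. norm (f (x - y) * \<rho> y) \<le> norm (K * \<rho> y)"
      using le by (auto intro!: AE_I2 order_trans[OF _ abs_ge_self])
  qed measurable
  have "\<bar>convolution f \<rho> x\<bar> \<le> (LINT y|lborel. \<bar>f (x - y) * \<rho> y\<bar>)"
    by (simp add: convolution_commute integral_abs_bound)
  also have "\<dots> \<le> (LINT y|lborel. K * \<rho> y)"
    using i \<rho>i by (intro integral_mono le) auto
  finally show ?thesis using \<rho>1 by simp
qed

lemma smooth_supported_convolution: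
  assumes f: "integrable lborel f" "\<And>x. x \<notin> cball 0 R \<Longrightarrow> f x = 0" and \<rho>: "smooth_supported r \<rho>"
  shows "smooth_supported (R + r) (convolution f \<rho>)"
  unfolding smooth_supported_def
proof (intro conjI allI impI)
  show "C_k k (convolution f \<rho>)" for k by (rule C_k_convolution[OF f(1) \<rho>])
  fix x :: 'a assume x: "x \<notin> cball 0 (R + r)"
  have "f y * \<rho> (x - y) = 0" for y
  proof (cases "y \<in> cball 0 R")
    case True
    then have "x - y \<notin> cball 0 r" using x norm_triangle_sub[of x y] by auto
    then show ?thesis using \<rho> by (simp add: smooth_supported_def)
  qed (simp add: f(2))
  then have "(\<lambda>y. f y * \<rho> (x - y)) = (\<lambda>y. 0)" by (rule ext)
  then show "convolution f \<rho> x = 0" by (simp only: convolution_def) simp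
qed

text \<open>Cut off at radius \<open>k + 1\<close>, then mollify at a scale fine enough for an
  \<open>L^1\<close> error of at most \<open>1 / (k + 1)\<close>. The cut-off costs the
  \<open>L^2\<close> norm of \<open>g\<close>, finite because \<open>g\<close> is bounded and
  integrable; the mollification does not increase the seminorm. Hence one bound serves all
  \<open>k\<close>.\<close>

lemma smooth_approximation:
  fixes g :: "real^'n \<Rightarrow> real"
  assumes \<sigma>: "0 < \<sigma>" "\<sigma> < 2" and g[measurable]: "g \<in> borel_measurable borel" and K: "\<And>x. \<bar>g x\<bar> \<le> K"
    and gi: "integrable lborel g" and gf: "gagliardo_finite \<sigma> g"
  obtains \<eta> C where "\<And>k::nat. \<exists>r. smooth_supported r (\<eta> k)" "\<And>k x. \<bar>\<eta> k x\<bar> \<le> K"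
    "\<And>k. gagliardo_finite \<sigma> (\<eta> k)" "\<And>k. gagliardo_norm \<sigma> (\<eta> k) \<le> C"
    "AE x in lborel. (\<lambda>k. \<eta> k x) \<longlonglongrightarrow> g x"
proof -
  define f where "f k x = cutoff (real k + 1) x * g x" for k :: nat and x
  have [measurable]: "cutoff (real k + 1) \<in> borel_measurable (borel :: (real^'n) measure)" for k
    by (intro borel_measurable_continuous_onI cutoff_continuous) simp
  have fm[measurable]: "f k \<in> borel_measurable borel" for k unfolding f_def by measurable
  have fK: "\<bar>f k x\<bar> \<le> K" for k x
    unfolding f_def abs_mult using K[of x] cutoff_range[of "real k + 1" x]
    by (metis abs_ge_zero abs_of_nonneg mult_left_le_one_le order_trans)
  have fs: "f k x = 0" if "x \<notin> cball 0 (2 * (real k + 1))" for k x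
    using cutoff_zero[of "real k + 1" x] that by (simp add: f_def)
  have fi: "integrable lborel (f k)" for k
    using bounded_support_integrable[OF fm fK fs] .
  define B where "B = 2 * gagliardo_sq \<sigma> g +
    2 * ((\<integral>\<^sup>+ z. ennreal (levy_density \<sigma> (z :: real^'n)) \<partial>lborel) * (\<integral>\<^sup>+ x. ennreal ((g x)\<^sup>2) \<partial>lborel))"
  have fB: "gagliardo_sq \<sigma> (f k) \<le> B" for k
    unfolding f_def[abs_def] B_def by (rule gagliardo_sq_cutoff) auto
  have "(\<integral>\<^sup>+ x. ennreal ((g x)\<^sup>2) \<partial>lborel) \<le> (\<integral>\<^sup>+ x. ennreal (K * \<bar>g x\<bar>) \<partial>lborel)"
  proof (intro nn_integral_mono ennreal_leI)
    fix x show "(g x)\<^sup>2 \<le> K * \<bar>g x\<bar>"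
      using mult_right_mono[OF K[of x], of "\<bar>g x\<bar>"] by (simp add: power2_eq_square)
  qed
  also have "\<dots> < \<infinity>"
    using gi K[of 0] by (subst nn_integral_eq_integral) auto
  finally have Bfin: "B < \<infinity>"
    using gf levy_density_finite[OF \<sigma>, where 'a="real^'n"]
    by (simp add: B_def gagliardo_finite_def ennreal_mult_less_top)
  have "\<exists>\<eta>. (\<exists>r. smooth_supported r \<eta>) \<and> (\<forall>x. \<bar>\<eta> x\<bar> \<le> K) \<and> gagliardo_sq \<sigma> \<eta> \<le> B \<and>
      (\<integral>\<^sup>+ x. ennreal \<bar>\<eta> x - f k x\<bar> \<partial>lborel) \<le> ennreal (1 / (real k + 1))" for k
  proof -
    have "\<exists>d>0. \<forall>y. norm y < d \<longrightarrow> (\<integral>\<^sup>+ x. ennreal \<bar>f k (x - y) - f k x\<bar> \<partial>lborel) \<le> ennreal (1 / (real k + 1))"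
      by (rule L1_translation_continuous[where f="f k" and K=K and R="2 * (real k + 1)" and e="1 / (real k + 1)"])
        (use fm fK fs in auto)
    then obtain d where d: "d > 0" "\<And>y. norm y < d \<Longrightarrow> (\<integral>\<^sup>+ x. ennreal \<bar>f k (x - y) - f k x\<bar> \<partial>lborel) \<le> ennreal (1 / (real k + 1))"
      by blast
    obtain \<rho> :: "real^'n \<Rightarrow> real" where \<rho>: "smooth_supported (d/2) \<rho>" "\<And>x. 0 \<le> \<rho> x" "integrable lborel \<rho>" "(LINT x|lborel. \<rho> x) = 1"
      using mollifier_exists[of "d/2"] d(1) by auto
    have rm: "\<rho> \<in> borel_measurable borel" using smooth_supported_measurable[OF \<rho>(1)] .
    show ?thesis
    proof (intro exI[of _ "convolution (f k) \<rho>"] conjI allI)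
      show "\<exists>r. smooth_supported r (convolution (f k) \<rho>)"
        using smooth_supported_convolution[OF fi fs \<rho>(1)] by blast
      show "\<bar>convolution (f k) \<rho> x\<bar> \<le> K" for x
        by (rule convolution_bound[OF fm fK rm \<rho>(2,3,4)])
      show "gagliardo_sq \<sigma> (convolution (f k) \<rho>) \<le> B"
        using gagliardo_sq_convolution[OF fm fK rm \<rho>(2,3,4)] fB order_trans by blast
      show "(\<integral>\<^sup>+ x. ennreal \<bar>convolution (f k) \<rho> x - f k x\<bar> \<partial>lborel) \<le> ennreal (1 / (real k + 1))"
        by (rule convolution_L1_close[OF fm fK \<rho>]) (use d in auto)
    qed
  qed
  then obtain \<eta> where \<eta>: "\<And>k. \<exists>r. smooth_supported r (\<eta> k)" "\<And>k x. \<bar>\<eta> k x\<bar> \<le> K"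
    "\<And>k. gagliardo_sq \<sigma> (\<eta> k) \<le> B"
    "\<And>k. (\<integral>\<^sup>+ x. ennreal \<bar>\<eta> k x - f k x\<bar> \<partial>lborel) \<le> ennreal (1 / (real k + 1))"
    by metis
  have \<eta>m[measurable]: "\<eta> k \<in> borel_measurable borel" for k
    using \<eta>(1) smooth_supported_measurable by blast
  have \<eta>i: "integrable lborel (\<eta> k)" for k
  proof -
    obtain r where "smooth_supported r (\<eta> k)" using \<eta>(1) by blast
    then show ?thesis using bounded_support_integrable[OF \<eta>m[of k] \<eta>(2), of r] by (auto simp: smooth_supported_def)
  qed
  have \<eta>f: "gagliardo_finite \<sigma> (\<eta> k)" for k
    using \<eta>(3)[of k] Bfin by (auto simp: gagliardo_finite_def measurable_completion)
  have \<eta>n: "gagliardo_norm \<sigma> (\<eta> k) \<le> sqrt (enn2real B)" for k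
  proof -
    have "ennreal ((gagliardo_norm \<sigma> (\<eta> k))\<^sup>2) \<le> B" using \<eta>(3)[of k] gagliardo_sq_norm[OF \<eta>f[of k]] by simp
    then have "(gagliardo_norm \<sigma> (\<eta> k))\<^sup>2 \<le> enn2real B"
      using Bfin by (metis enn2real_ennreal enn2real_mono infinity_ennreal_def zero_le_power2)
    then show ?thesis by (rule real_le_rsqrt)
  qed
  have lim: "(\<lambda>k. LINT x|lborel. norm (\<eta> k x - g x)) \<longlonglongrightarrow> 0"
  proof (rule tendsto_sandwich[OF _ _ tendsto_const])
    have "(\<lambda>k. LINT x|lborel. \<bar>f k x - g x\<bar>) \<longlonglongrightarrow> (LINT x|(lborel :: (real^'n) measure). (0::real))"
    proof (rule integral_dominated_convergence[where w="\<lambda>x. \<bar>g x\<bar>"])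
      show "AE x in lborel. (\<lambda>k. \<bar>f k x - g x\<bar>) \<longlonglongrightarrow> 0"
      proof (rule AE_I2)
        fix x :: "real^'n"
        obtain n :: nat where n: "norm x \<le> real n" using real_arch_simple by blast
        have "\<forall>\<^sub>F k in sequentially. \<bar>f k x - g x\<bar> = 0"
          using eventually_ge_at_top[of n]
          by eventually_elim (use n cutoff_one[of _ x] in \<open>auto simp: f_def\<close>)
        then show "(\<lambda>k. \<bar>f k x - g x\<bar>) \<longlonglongrightarrow> 0" by (rule tendsto_eventually)
      qed
      show "AE x in lborel. norm \<bar>f k x - g x\<bar> \<le> \<bar>g x\<bar>" for k
      proof (rule AE_I2)
        fix x
        have "\<bar>f k x - g x\<bar> = \<bar>(1 - cutoff (real k + 1) x)\<bar> * \<bar>g x\<bar>"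
          by (simp add: f_def left_diff_distrib abs_minus_commute flip: abs_mult)
        also have "\<dots> \<le> \<bar>g x\<bar>" using cutoff_range[of "real k + 1" x] by (intro mult_left_le_one_le) auto
        finally show "norm \<bar>f k x - g x\<bar> \<le> \<bar>g x\<bar>" by simp
      qed
    qed (use gi in auto)
    then have "(\<lambda>k. LINT x|lborel. \<bar>f k x - g x\<bar>) \<longlonglongrightarrow> 0" by simp
    moreover have "(\<lambda>k. 1 / (real k + 1)) \<longlonglongrightarrow> 0"
      using LIMSEQ_inverse_real_of_nat by (simp add: inverse_eq_divide add.commute)
    ultimately show "(\<lambda>k. 1 / (real k + 1) + (LINT x|lborel. \<bar>f k x - g x\<bar>)) \<longlonglongrightarrow> 0"
      using tendsto_add by fastforce
    show "\<forall>\<^sub>F k in sequentially. (LINT x|lborel. norm (\<eta> k x - g x)) \<le> 1 / (real k + 1) + (LINT x|lborel. \<bar>f k x - g x\<bar>)"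
    proof (rule always_eventually, rule allI)
      fix k
      have "ennreal (LINT x|lborel. \<bar>\<eta> k x - f k x\<bar>) = (\<integral>\<^sup>+ x. ennreal \<bar>\<eta> k x - f k x\<bar> \<partial>lborel)"
        using \<eta>i fi by (intro nn_integral_eq_integral[symmetric]) auto
      with \<eta>(4)[of k] have "ennreal (LINT x|lborel. \<bar>\<eta> k x - f k x\<bar>) \<le> ennreal (1 / (real k + 1))"
        by (simp only:)
      then have 1: "(LINT x|lborel. \<bar>\<eta> k x - f k x\<bar>) \<le> 1 / (real k + 1)"
        by (subst (asm) ennreal_le_iff) auto
      have "(LINT x|lborel. norm (\<eta> k x - g x)) \<le> (LINT x|lborel. \<bar>\<eta> k x - f k x\<bar> + \<bar>f k x - g x\<bar>)"
        using \<eta>i fi gi by (intro integral_mono) auto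
      also have "\<dots> = (LINT x|lborel. \<bar>\<eta> k x - f k x\<bar>) + (LINT x|lborel. \<bar>f k x - g x\<bar>)"
        using \<eta>i fi gi by (intro Bochner_Integration.integral_add) auto
      finally show "(LINT x|lborel. norm (\<eta> k x - g x)) \<le> 1 / (real k + 1) + (LINT x|lborel. \<bar>f k x - g x\<bar>)"
        using 1 by linarith
    qed
  qed (auto intro!: always_eventually integral_nonneg_AE)
  \<comment> \<open>Convergence in \<open>L^1\<close> gives almost everywhere convergence along a
    subsequence; the uniform bounds survive the passage to it.\<close>
  obtain s :: "nat \<Rightarrow> nat" where s: "AE x in lborel. (\<lambda>k. \<eta> (s k) x - g x) \<longlonglongrightarrow> 0"
    using tendsto_L1_AE_subseq[OF _ lim] \<eta>i gi by auto
  show ?thesis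
  proof (rule that[of "\<lambda>k. \<eta> (s k)"])
    show "AE x in lborel. (\<lambda>k. \<eta> (s k) x) \<longlonglongrightarrow> g x" using s by eventually_elim (rule LIM_zero_cancel)
    show "\<exists>r. smooth_supported r (\<eta> (s k))" for k by (rule \<eta>(1))
    show "\<bar>\<eta> (s k) x\<bar> \<le> K" for k x by (rule \<eta>(2))
    show "gagliardo_finite \<sigma> (\<eta> (s k))" for k by (rule \<eta>f)
    show "gagliardo_norm \<sigma> (\<eta> (s k)) \<le> sqrt (enn2real B)" for k by (rule \<eta>n)
  qed
qed

section \<open>The weak formulation\<close>

lemma borel_measurable_lebesgue_limit:
  fixes e :: "'a::euclidean_space \<Rightarrow> real"
  assumes "\<And>k::nat. ek k \<in> borel_measurable lebesgue" "AE t in lebesgue. (\<lambda>k. ek k t) \<longlonglongrightarrow> e t"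
  shows "e \<in> borel_measurable lebesgue"
proof (rule borel_measurable_AE)
  show "(\<lambda>t. lim (\<lambda>k. ek k t)) \<in> borel_measurable lebesgue"
    using assms(1) by (rule borel_measurable_lim_metric)
  show "AE t in lebesgue. lim (\<lambda>k. ek k t) = e t" using assms(2) by eventually_elim (rule limI)
qed

lemma simple_valued_measurable:
  fixes F :: "'b \<Rightarrow> real \<Rightarrow> real"
  assumes fin: "finite (s ` {0<..})" and lev: "\<And>w. {t \<in> {0<..}. s t = w} \<in> sets lebesgue"
    and F: "\<And>w. w \<in> s ` {0<..} \<Longrightarrow> F w \<in> borel_measurable lebesgue"
  shows "(\<lambda>t. if t > 0 then F (s t) t else 0) \<in> borel_measurable lebesgue"
proof -
  have "(\<lambda>t. if t > 0 then F (s t) t else 0) = (\<lambda>t. \<Sum>w\<in>s ` {0<..}. F w t * indicator {t \<in> {0<..}. s t = w} t)"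
  proof (rule ext)
    fix t :: real
    show "(if t > 0 then F (s t) t else 0) = (\<Sum>w\<in>s ` {0<..}. F w t * indicator {t \<in> {0<..}. s t = w} t)"
    proof (cases "t > 0")
      case True
      then have "(\<Sum>w\<in>s ` {0<..}. F w t * indicator {t \<in> {0<..}. s t = w} t) = (\<Sum>w\<in>s ` {0<..}. if w = s t then F w t else 0)"
        by (intro sum.cong) (auto simp: indicator_def)
      then show ?thesis using True fin by simp
    qed (simp add: indicator_def)
  qed
  then show ?thesis using F lev by (auto intro!: borel_measurable_sum borel_measurable_times borel_measurable_indicator)
qed

lemma smooth_real_deriv:
  fixes s :: "real \<Rightarrow> real"
  assumes "\<And>k. C_k k s"
  shows "(s has_real_derivative deriv s t) (at t)" "C_k k (deriv s)"
proof -
  have d: "s differentiable (at t)" for t using assms[of "Suc 0"] by simp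
  then show *: "(s has_real_derivative deriv s t) (at t)" for t
    by (simp add: DERIV_deriv_iff_real_differentiable)
  have "frechet_derivative s (at t) 1 = deriv s t" for t
    using frechet_derivative_at[OF *[of t, unfolded has_field_derivative_def]] by (metis mult.right_neutral)
  then show "C_k k (deriv s)" using assms[of "Suc k"] by simp
qed

lemma C_k_compose_smooth:
  fixes s :: "real \<Rightarrow> real"
  assumes s: "\<And>k. C_k k s" and g: "C_k k g"
  shows "C_k k (\<lambda>x. s (g x))"
proof -
  have ck: "C_k k ((deriv ^^ j) s)" for j k
    by (induction j arbitrary: k) (use s smooth_real_deriv(2) in auto)
  have "((deriv ^^ j) s has_real_derivative (deriv ^^ Suc j) s t) (at t)" for j t
    using smooth_real_deriv(1)[OF ck] by simp
  from C_k_compose_real[where F="\<lambda>j. (deriv ^^ j) s" and j=0, OF this g] show ?thesis by simp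
qed

text \<open>After rescaling, an approximate identity of mass \<open>s 1 - s 0 = 1\<close>. Its
  support lies in \<open>[a, a + 1 / (n + 1)]\<close>, so no value of \<open>V\<close> before
  \<open>a\<close> enters.\<close>

lemma integral_shrinking_kernel:
  fixes V :: "real \<Rightarrow> real"
  assumes s: "\<And>k. C_k k s" "\<And>t. t \<le> 0 \<Longrightarrow> s t = 0" "\<And>t. t \<ge> 1 \<Longrightarrow> s t = 1"
    and V: "continuous_on UNIV V"
  shows "integrable lborel (\<lambda>t. (real n + 1) * deriv s ((real n + 1) * (t - a)) * V t)"
    and "(\<lambda>n. LINT t|lborel. (real n + 1) * deriv s ((real n + 1) * (t - a)) * V t) \<longlonglongrightarrow> V a"
proof -
  have sd: "(s has_real_derivative deriv s t) (at t)" for t by (rule smooth_real_deriv[OF s(1)])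
  have sc: "continuous_on UNIV (deriv s)" using C_k_continuous[OF smooth_real_deriv(2)[OF s(1)]] .
  have s0: "deriv s t = 0" if "t \<notin> {0..1}" for t
  proof (cases "t < 0")
    case True
    have "(s has_real_derivative 0) (at t)"
      by (rule has_field_derivative_transform_within_open[of "\<lambda>_. 0" _ _ "{..<0}"]) (use True s in auto)
    then show ?thesis using sd DERIV_unique by blast
  next
    case False
    have "(s has_real_derivative 0) (at t)"
      by (rule has_field_derivative_transform_within_open[of "\<lambda>_. 1" _ _ "{1<..}"]) (use False that s in auto)
    then show ?thesis using sd DERIV_unique by blast
  qed
  define N where "N n = real n + 1" for n
  have N: "N n \<ge> 1" "N n > 0" "N n \<noteq> 0" for n by (auto simp: N_def)
  have [measurable]: "deriv s \<in> borel_measurable borel" "V \<in> borel_measurable borel"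
    using sc V by (auto intro: borel_measurable_continuous_onI)
  have "compact (deriv s ` {0..1})" using sc by (intro compact_continuous_image) (auto intro: continuous_on_subset)
  then obtain C where C: "C > 0" "\<forall>y\<in>deriv s ` {0..1}. norm y \<le> C" using compact_imp_bounded bounded_pos by blast
  have Cb: "\<bar>deriv s t\<bar> \<le> C" for t using C s0[of t] by (cases "t \<in> {0..1}") auto
  have "compact (V ` {a..a+1})" using V by (intro compact_continuous_image) (auto intro: continuous_on_subset)
  then obtain D where D: "D > 0" "\<forall>y\<in>V ` {a..a+1}. norm y \<le> D" using compact_imp_bounded bounded_pos by blast
  have ind: "integrable lborel (\<lambda>t::real. (C * D) * indicator {0..1} t)" by simp
  have dom: "\<bar>deriv s \<tau> * V (a + \<tau> / N n)\<bar> \<le> C * D * indicator {0..1} \<tau>" for \<tau> n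
  proof (cases "\<tau> \<in> {0..1}")
    case True
    then have "0 \<le> \<tau> / N n" "\<tau> / N n \<le> 1" using N[of n] by (auto simp: field_simps)
    then have "\<bar>V (a + \<tau> / N n)\<bar> \<le> D" using D by auto
    then show ?thesis using True Cb[of \<tau>] C(1) unfolding abs_mult by (auto intro!: mult_mono)
  qed (simp add: s0)
  have int1: "integrable lborel (\<lambda>\<tau>. deriv s \<tau> * V (a + \<tau> / N n))" for n
    by (rule Bochner_Integration.integrable_bound[OF ind])
      (use dom[of _ n] in \<open>auto intro!: AE_I2 order_trans[OF _ abs_ge_self]\<close>)
  have trans: "N n * deriv s (N n * (a + (1 / N n) * \<tau> - a)) * V (a + (1 / N n) * \<tau>) =
      N n * (deriv s \<tau> * V (a + \<tau> / N n))" for n \<tau>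
    using N(3)[of n] by simp
  have "integrable lborel (\<lambda>t. N n * deriv s (N n * (t - a)) * V t)" for n
    using N(3)[of n] int1[of n]
      lborel_integrable_real_affine_iff[of "1 / N n" "\<lambda>t. N n * deriv s (N n * (t - a)) * V t" a]
    unfolding trans by simp
  then show "integrable lborel (\<lambda>t. (real n + 1) * deriv s ((real n + 1) * (t - a)) * V t)"
    by (simp add: N_def)
  have eq: "(LINT t|lborel. N n * deriv s (N n * (t - a)) * V t) = (LINT \<tau>|lborel. deriv s \<tau> * V (a + \<tau> / N n))" for n
    using N[of n] lborel_integral_real_affine[of "1 / N n" "\<lambda>t. N n * deriv s (N n * (t - a)) * V t" a]
    unfolding trans by (simp add: field_simps)
  have "(\<lambda>n. LINT \<tau>|lborel. deriv s \<tau> * V (a + \<tau> / N n)) \<longlonglongrightarrow> (LINT \<tau>|lborel. deriv s \<tau> * V a)"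
  proof (rule integral_dominated_convergence[OF _ _ ind])
    show "AE \<tau> in lborel. (\<lambda>n. deriv s \<tau> * V (a + \<tau> / N n)) \<longlonglongrightarrow> deriv s \<tau> * V a"
    proof (rule AE_I2)
      fix \<tau> :: real
      have "(\<lambda>n. \<tau> * inverse (real (Suc n))) \<longlonglongrightarrow> \<tau> * 0"
        by (intro tendsto_mult tendsto_const LIMSEQ_inverse_real_of_nat)
      then have "(\<lambda>n. a + \<tau> / N n) \<longlonglongrightarrow> a + 0"
        by (intro tendsto_add tendsto_const) (simp add: N_def divide_inverse add.commute)
      then have "(\<lambda>n. V (a + \<tau> / N n)) \<longlonglongrightarrow> V a"
        using V by (intro isCont_tendsto_compose[of a V]) (auto simp: continuous_on_eq_continuous_at)
      then show "(\<lambda>n. deriv s \<tau> * V (a + \<tau> / N n)) \<longlonglongrightarrow> deriv s \<tau> * V a" by (intro tendsto_intros)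
    qed
  qed (use dom in auto)
  moreover have "(LINT \<tau>|lborel. deriv s \<tau> * V a) = V a"
  proof -
    have "(LINT \<tau>|lborel. deriv s \<tau> * indicator {0..1} \<tau>) = s 1 - s 0"
    proof (rule integral_FTC_Icc_real)
      show "isCont (deriv s) x" for x using sc by (auto simp: continuous_on_eq_continuous_at)
    qed (use sd in auto)
    moreover have "(\<lambda>\<tau>. deriv s \<tau> * indicator {0..1} \<tau>) = deriv s"
      using s0 by (auto simp: fun_eq_iff indicator_def)
    ultimately show ?thesis using s by simp
  qed
  ultimately show "(\<lambda>n. LINT t|lborel. (real n + 1) * deriv s ((real n + 1) * (t - a)) * V t) \<longlonglongrightarrow> V a"
    unfolding N_def[symmetric] eq by (simp only:)
qed

lemma test_function_product:
  fixes \<eta> :: "real^'n \<Rightarrow> real" and h :: "real \<Rightarrow> real"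
  assumes \<eta>: "smooth_supported r \<eta>" and h: "\<And>k. C_k k h" "\<And>t. t \<notin> {a..b} \<Longrightarrow> h t = 0" and a: "a > 0"
  shows "test_function (\<lambda>p. \<eta> (fst p) * h (snd p))"
  unfolding test_function_def
proof (intro conjI allI)
  show "C_k k (\<lambda>p. \<eta> (fst p) * h (snd p))" for k
  proof (rule C_k_mult)
    show "C_k k (\<lambda>p :: (real^'n) \<times> real. \<eta> (fst p))" using \<eta> by (intro C_k_fst) (simp add: smooth_supported_def)
    show "C_k k (\<lambda>p :: (real^'n) \<times> real. h (snd p))"
      by (rule C_k_compose_smooth[where s=h and g=snd, OF h(1) C_k_linear[OF bounded_linear_snd]])
  qed
  have sub: "{p :: (real^'n) \<times> real. \<eta> (fst p) * h (snd p) \<noteq> 0} \<subseteq> cball 0 r \<times> {a..b}"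
    using \<eta> h(2) by (force simp: smooth_supported_def)
  have cmp: "compact (cball (0 :: real^'n) r \<times> {a..b})" by (intro compact_Times) auto
  then have cl: "closure {p :: (real^'n) \<times> real. \<eta> (fst p) * h (snd p) \<noteq> 0} \<subseteq> cball 0 r \<times> {a..b}"
    using sub by (intro closure_minimal compact_imp_closed)
  show "compact (closure {p :: (real^'n) \<times> real. \<eta> (fst p) * h (snd p) \<noteq> 0})"
    unfolding compact_closure by (rule bounded_subset[OF compact_imp_bounded[OF cmp] sub])
  show "closure {p :: (real^'n) \<times> real. \<eta> (fst p) * h (snd p) \<noteq> 0} \<subseteq> UNIV \<times> {0<..}"
    using cl a by auto
qed

lemma tendsto_sqrt_zero:
  assumes "(\<lambda>k. ennreal ((x k)\<^sup>2)) \<longlonglongrightarrow> 0" "\<And>k. x k \<ge> 0"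
  shows "x \<longlonglongrightarrow> 0"
proof -
  have "(\<lambda>k. ennreal ((x k)\<^sup>2)) \<longlonglongrightarrow> ennreal 0" using assms(1) by simp
  then have "(\<lambda>k. (x k)\<^sup>2) \<longlonglongrightarrow> 0" by (subst (asm) tendsto_ennreal_iff) auto
  then have "(\<lambda>k. sqrt ((x k)\<^sup>2)) \<longlonglongrightarrow> sqrt 0" by (rule tendsto_real_sqrt)
  then show ?thesis using assms(2) by simp
qed

section \<open>Measurability in time of norms and energies\<close>

lemma Hdot_gagliardo_finite: "f \<in> Hdot \<sigma> \<Longrightarrow> gagliardo_finite \<sigma> f"
  by (auto simp: Hdot_def gagliardo_finite_def)

text \<open>The simple functions of Bochner measurability, with values of finite seminorm in place
  of \<open>Hdot\<close>. Nothing is prescribed about their values at times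
  \<open>t \<le> 0\<close>.\<close>

definition time_step_function :: "real \<Rightarrow> (real \<Rightarrow> real^'n \<Rightarrow> real) \<Rightarrow> bool" where
  "time_step_function \<sigma> s \<longleftrightarrow> finite (s ` {0<..}) \<and> (\<forall>f\<in>s ` {0<..}. gagliardo_finite \<sigma> f) \<and>
     (\<forall>f. {t \<in> {0<..}. s t = f} \<in> sets lebesgue)"

lemma time_step_functionD:
  "time_step_function \<sigma> s \<Longrightarrow> t > 0 \<Longrightarrow> gagliardo_finite \<sigma> (s t)"
  by (auto simp: time_step_function_def)

lemma time_step_function_measurable:
  assumes "time_step_function \<sigma> s" "\<And>f. gagliardo_finite \<sigma> f \<Longrightarrow> F f \<in> borel_measurable lebesgue"
  shows "(\<lambda>t. if t > 0 then F (s t) t else (0::real)) \<in> borel_measurable lebesgue"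
  using assms by (intro simple_valued_measurable[where F=F and s=s]) (auto simp: time_step_function_def)

locale fractional_solution =
  fixes \<sigma> \<Lambda> :: real and J :: "real^'n \<Rightarrow> real^'n \<Rightarrow> real" and \<phi> :: "real \<Rightarrow> real"
    and u0 :: "real^'n \<Rightarrow> real" and u :: "real \<Rightarrow> real^'n \<Rightarrow> real"
  assumes \<sigma>: "0 < \<sigma>" "\<sigma> < 2" and \<Lambda>: "\<Lambda> > 0" and adm: "admissible_kernel \<sigma> \<Lambda> J"
    and sol: "weak_solution \<sigma> J \<phi> u0 u"
begin

abbreviation w :: "real \<Rightarrow> real^'n \<Rightarrow> real" where "w t \<equiv> \<lambda>x. \<phi> (u t x)"

lemma u_integrable: "t \<ge> 0 \<Longrightarrow> integrable lebesgue (u t)"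
  using sol by (auto simp: weak_solution_def C_L1_def)

lemma continuous_on_L1_lipschitz:
  assumes "\<And>s t. s \<ge> 0 \<Longrightarrow> t \<ge> 0 \<Longrightarrow> \<bar>F s - F t\<bar> \<le> C * (LINT x|lebesgue. \<bar>u s x - u t x\<bar>)"
  shows "continuous_on {0..} (F :: real \<Rightarrow> real)"
  unfolding continuous_on_def
proof
  fix t :: real assume t: "t \<in> {0..}"
  have lim: "((\<lambda>s. LINT x|lebesgue. \<bar>u s x - u t x\<bar>) \<longlongrightarrow> 0) (at t within {0..})"
    using sol t by (auto simp: weak_solution_def C_L1_def)
  have "((\<lambda>s. F s - F t) \<longlongrightarrow> 0) (at t within {0..})"
  proof (rule Lim_null_comparison)
    show "((\<lambda>s. C * (LINT x|lebesgue. \<bar>u s x - u t x\<bar>)) \<longlongrightarrow> 0) (at t within {0..})"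
      using tendsto_mult[OF tendsto_const[of C] lim] by simp
    show "\<forall>\<^sub>F s in at t within {0..}. norm (F s - F t) \<le> C * (LINT x|lebesgue. \<bar>u s x - u t x\<bar>)"
      using assms t by (auto simp: eventually_at_filter)
  qed
  then show "(F \<longlongrightarrow> F t) (at t within {0..})" by (simp add: LIM_zero_iff)
qed

lemma step_approximation:
  obtains s where "\<And>k::nat. time_step_function \<sigma> (s k)"
    "AE t in lebesgue. t > 0 \<longrightarrow> gagliardo_finite \<sigma> (w t) \<and> (\<lambda>k. gagliardo_norm \<sigma> (\<lambda>x. s k t x - w t x)) \<longlonglongrightarrow> 0"
proof -
  have "L2_loc_Hdot \<sigma> w" using sol by (simp add: weak_solution_def)
  then obtain s where s: "\<And>k::nat. finite (s k ` {0<..}) \<and> s k ` {0<..} \<subseteq> Hdot \<sigma> \<and>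
             (\<forall>w. {t \<in> {0<..}. s k t = w} \<in> sets lebesgue)"
    "AE t in lebesgue. t > 0 \<longrightarrow> (\<lambda>k. gagliardo_sq \<sigma> (\<lambda>x. s k t x - w t x)) \<longlonglongrightarrow> 0"
    and H: "AE t in lebesgue. t > 0 \<longrightarrow> w t \<in> Hdot \<sigma>"
    unfolding L2_loc_Hdot_def by blast
  have st: "time_step_function \<sigma> (s k)" for k
    using s(1)[of k] by (auto simp: time_step_function_def intro!: Hdot_gagliardo_finite)
  show ?thesis
  proof (rule that[OF st])
    show "AE t in lebesgue. t > 0 \<longrightarrow> gagliardo_finite \<sigma> (w t) \<and> (\<lambda>k. gagliardo_norm \<sigma> (\<lambda>x. s k t x - w t x)) \<longlonglongrightarrow> 0"
      using s(2) H
    proof eventually_elim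
      case (elim t)
      show ?case
      proof
        assume t: "t > 0"
        then have wf: "gagliardo_finite \<sigma> (w t)" using elim Hdot_gagliardo_finite by blast
        have "gagliardo_finite \<sigma> (\<lambda>x. s k t x - w t x)" for k
          by (intro gagliardo_finite_diff wf time_step_functionD[OF st t])
        then have "gagliardo_sq \<sigma> (\<lambda>x. s k t x - w t x) = ennreal ((gagliardo_norm \<sigma> (\<lambda>x. s k t x - w t x))\<^sup>2)" for k
          by (rule gagliardo_sq_norm)
        then have "(\<lambda>k. gagliardo_norm \<sigma> (\<lambda>x. s k t x - w t x)) \<longlonglongrightarrow> 0"
          using elim(1) t by (intro tendsto_sqrt_zero) auto
        then show "gagliardo_finite \<sigma> (w t) \<and> (\<lambda>k. gagliardo_norm \<sigma> (\<lambda>x. s k t x - w t x)) \<longlonglongrightarrow> 0"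
          using wf by blast
      qed
    qed
  qed
qed

lemma w_finite: "AE t in lebesgue. t > 0 \<longrightarrow> gagliardo_finite \<sigma> (w t)"
proof -
  obtain s where "AE t in lebesgue. t > 0 \<longrightarrow> gagliardo_finite \<sigma> (w t) \<and> (\<lambda>k::nat. gagliardo_norm \<sigma> (\<lambda>x. s k t x - w t x)) \<longlonglongrightarrow> 0"
    using step_approximation by blast
  then show ?thesis by eventually_elim blast
qed

text \<open>The distance between two step functions takes finitely many values on measurable sets,
  and by the reverse triangle inequality these distances converge at almost every time.\<close>

lemma distance_measurable:
  assumes s': "time_step_function \<sigma> s'"
  shows "(\<lambda>t. if t > 0 then gagliardo_norm \<sigma> (\<lambda>x. w t x - s' t x) else 0) \<in> borel_measurable lebesgue"
proof -
  obtain s where s: "\<And>k::nat. time_step_function \<sigma> (s k)"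
    "AE t in lebesgue. t > 0 \<longrightarrow> gagliardo_finite \<sigma> (w t) \<and> (\<lambda>k. gagliardo_norm \<sigma> (\<lambda>x. s k t x - w t x)) \<longlonglongrightarrow> 0"
    using step_approximation by blast
  show ?thesis
  proof (rule borel_measurable_lebesgue_limit)
    fix k
    \<comment> \<open>The repeated conditional is the shape produced by applying
      \<open>time_step_function_measurable\<close> once for each of the two step functions.\<close>
    show "(\<lambda>t. if t > 0 then (if t > 0 then gagliardo_norm \<sigma> (\<lambda>x. s k t x - s' t x) else 0) else 0) \<in> borel_measurable lebesgue"
      by (intro time_step_function_measurable[OF s(1)[of k]] time_step_function_measurable[OF s'])
        simp
    show "AE t in lebesgue. (\<lambda>k. if t > 0 then (if t > 0 then gagliardo_norm \<sigma> (\<lambda>x. s k t x - s' t x) else 0) else 0)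
        \<longlonglongrightarrow> (if t > 0 then gagliardo_norm \<sigma> (\<lambda>x. w t x - s' t x) else 0)"
      using s(2)
    proof eventually_elim
      case (elim t)
      show ?case
      proof (cases "t > 0")
        case True
        then have wf: "gagliardo_finite \<sigma> (w t)" and lim: "(\<lambda>k. gagliardo_norm \<sigma> (\<lambda>x. s k t x - w t x)) \<longlonglongrightarrow> 0"
          using elim by auto
        have sf: "gagliardo_finite \<sigma> (s k t)" "gagliardo_finite \<sigma> (s' t)" for k
          using time_step_functionD[OF s(1) True] time_step_functionD[OF s' True] by auto
        have "\<bar>gagliardo_norm \<sigma> (\<lambda>x. s k t x - s' t x) - gagliardo_norm \<sigma> (\<lambda>x. w t x - s' t x)\<bar>
            \<le> gagliardo_norm \<sigma> (\<lambda>x. s k t x - w t x)" for k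
          using gagliardo_norm_triangle3[OF sf(1)[of k] wf sf(2)] gagliardo_norm_triangle3[OF wf sf(1)[of k] sf(2)]
            gagliardo_norm_commute[of \<sigma> "s k t" "w t"] by linarith
        then have "(\<lambda>k. gagliardo_norm \<sigma> (\<lambda>x. s k t x - s' t x) - gagliardo_norm \<sigma> (\<lambda>x. w t x - s' t x)) \<longlonglongrightarrow> 0"
          by (intro Lim_null_comparison[OF always_eventually lim]) auto
        then show ?thesis using True by (simp add: LIM_zero_iff)
      qed simp
    qed
  qed
qed

lemma zero_step: "time_step_function \<sigma> (\<lambda>t (x :: real^'n). 0)"
proof -
  have "gagliardo_finite \<sigma> (\<lambda>x::real^'n. 0)"
    by (simp add: gagliardo_finite_iff gagliardo_quotient_def[abs_def])
  moreover have "{t \<in> {0<..}. (\<lambda>x::real^'n. 0) = f} = (if f = (\<lambda>x. 0) then {0<..} else {} :: real set)" for f :: "real^'n \<Rightarrow> real"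
    by auto
  ultimately show ?thesis by (auto simp: time_step_function_def image_constant_conv)
qed

lemma w_norm_measurable: "(\<lambda>t. if t > 0 then gagliardo_norm \<sigma> (w t) else 0) \<in> borel_measurable lebesgue"
  using distance_measurable[OF zero_step] by (simp only: diff_0_right)

lemma w_norm_L2:
  assumes "0 < a" "a < b"
  shows "L2f lebesgue (\<lambda>t. indicator {a..b} t * gagliardo_norm \<sigma> (w t))"
proof -
  have eq: "(\<lambda>t. indicator {a..b} t * gagliardo_norm \<sigma> (w t)) =
    (\<lambda>t. indicator {a..b} t * (if t > 0 then gagliardo_norm \<sigma> (w t) else 0))"
    using assms by (auto simp: fun_eq_iff indicator_def)
  have m: "(\<lambda>t. indicator {a..b} t * gagliardo_norm \<sigma> (w t)) \<in> borel_measurable lebesgue"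
    unfolding eq by (intro borel_measurable_times w_norm_measurable borel_measurable_indicator) simp
  have "L2_loc_Hdot \<sigma> w" using sol by (simp add: weak_solution_def)
  then have "(\<integral>\<^sup>+ t. gagliardo_sq \<sigma> (w t) * indicator {a..b} t \<partial>lebesgue) < \<infinity>"
    using assms unfolding L2_loc_Hdot_def by blast
  also have "(\<integral>\<^sup>+ t. gagliardo_sq \<sigma> (w t) * indicator {a..b} t \<partial>lebesgue) =
    (\<integral>\<^sup>+ t. ennreal (norm ((indicator {a..b} t * gagliardo_norm \<sigma> (w t))\<^sup>2)) \<partial>lebesgue)"
  proof (rule nn_integral_cong_AE)
    show "AE t in lebesgue. gagliardo_sq \<sigma> (w t) * indicator {a..b} t = ennreal (norm ((indicator {a..b} t * gagliardo_norm \<sigma> (w t))\<^sup>2))"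
      using w_finite
      by eventually_elim (use assms in \<open>auto simp: indicator_def gagliardo_sq_norm\<close>)
  qed
  finally show ?thesis unfolding L2f_def using m by (auto simp: integrable_iff_bounded)
qed

text \<open>The energy against a fixed \<open>g\<close> is continuous in the seminorm, so it is an
  almost everywhere limit of energies of step functions.\<close>

lemma energy_measurable:
  assumes g: "gagliardo_finite \<sigma> g"
  shows "(\<lambda>t. if t > 0 then energy_form J (w t) g else 0) \<in> borel_measurable lebesgue"
proof -
  obtain s where s: "\<And>k::nat. time_step_function \<sigma> (s k)"
    "AE t in lebesgue. t > 0 \<longrightarrow> gagliardo_finite \<sigma> (w t) \<and> (\<lambda>k. gagliardo_norm \<sigma> (\<lambda>x. s k t x - w t x)) \<longlonglongrightarrow> 0"
    using step_approximation by blast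
  show ?thesis
  proof (rule borel_measurable_lebesgue_limit)
    fix k
    show "(\<lambda>t. if t > 0 then energy_form J (s k t) g else 0) \<in> borel_measurable lebesgue"
      by (rule time_step_function_measurable[OF s(1)[of k], where F="\<lambda>f t. energy_form J f g"]) simp
    show "AE t in lebesgue. (\<lambda>k. if t > 0 then energy_form J (s k t) g else 0)
        \<longlonglongrightarrow> (if t > 0 then energy_form J (w t) g else 0)"
      using s(2)
    proof eventually_elim
      case (elim t)
      show ?case
      proof (cases "t > 0")
        case True
        then have wf: "gagliardo_finite \<sigma> (w t)" and lim: "(\<lambda>k. gagliardo_norm \<sigma> (\<lambda>x. s k t x - w t x)) \<longlonglongrightarrow> 0"
          using elim by auto
        have sf: "gagliardo_finite \<sigma> (s k t)" for k using time_step_functionD[OF s(1) True] .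
        have bd: "norm (energy_form J (s k t) g - energy_form J (w t) g)
            \<le> \<Lambda> * gagliardo_norm \<sigma> (\<lambda>x. s k t x - w t x) * gagliardo_norm \<sigma> g" for k
          unfolding energy_form_diff_left[OF adm \<Lambda> sf wf g, symmetric] real_norm_def
          by (intro energy_form_bound[OF adm \<Lambda>] gagliardo_finite_diff sf wf g)
        have "(\<lambda>k. \<Lambda> * gagliardo_norm \<sigma> (\<lambda>x. s k t x - w t x) * gagliardo_norm \<sigma> g) \<longlonglongrightarrow> \<Lambda> * 0 * gagliardo_norm \<sigma> g"
          by (intro tendsto_intros lim)
        then have lim': "(\<lambda>k. \<Lambda> * gagliardo_norm \<sigma> (\<lambda>x. s k t x - w t x) * gagliardo_norm \<sigma> g) \<longlonglongrightarrow> 0"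
          by simp
        have "(\<lambda>k. energy_form J (s k t) g - energy_form J (w t) g) \<longlonglongrightarrow> 0"
          by (rule Lim_null_comparison[OF always_eventually lim']) (use bd in blast)
        then show ?thesis using True by (simp add: LIM_zero_iff)
      qed simp
    qed
  qed
qed

lemma indicator_norm_integrable:
  assumes "0 < a" "a < b"
  shows "integrable lebesgue (\<lambda>t. indicator {a..b} t * gagliardo_norm \<sigma> (w t))"
proof -
  have i: "(\<lambda>t. (indicator {a..b} t)\<^sup>2) = (indicator {a..b} :: real \<Rightarrow> real)"
    by (auto simp: fun_eq_iff indicator_def)
  have "integrable lborel (indicator {a..b} :: real \<Rightarrow> real)"
    by (intro integrable_real_indicator) (auto simp: emeasure_lborel_Icc_eq)
  then have "integrable lebesgue (indicator {a..b} :: real \<Rightarrow> real)"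
    by (subst integrable_completion) auto
  then have "L2f lebesgue (indicator {a..b} :: real \<Rightarrow> real)"
    unfolding L2f_def i by auto
  from L2f_mult_integrable[OF this w_norm_L2[OF assms]]
  show ?thesis by (simp add: mult.assoc[symmetric] flip: indicator_inter_arith)
qed

end

lemma deriv_step_zero:
  fixes s :: "real \<Rightarrow> real"
  assumes s: "\<And>k. C_k k s" "\<And>t. t \<le> 0 \<Longrightarrow> s t = 0" and t: "t < 0"
  shows "deriv s t = 0"
proof -
  have "(s has_real_derivative 0) (at t)"
    by (rule has_field_derivative_transform_within_open[of "\<lambda>_. 0" _ _ "{..<0}"]) (use t s in auto)
  then show ?thesis by (rule DERIV_imp_deriv)
qed

section \<open>The weak formulation between two times\<close>

context fractional_solution
begin

lemma energy_integrable:
  assumes g: "gagliardo_finite \<sigma> g" and ab: "0 < a" "a < b"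
  shows "integrable lebesgue (\<lambda>t. indicator {a..b} t * energy_form J (w t) g)"
proof (rule Bochner_Integration.integrable_bound)
  show "integrable lebesgue (\<lambda>t. (\<Lambda> * gagliardo_norm \<sigma> g) * (indicator {a..b} t * gagliardo_norm \<sigma> (w t)))"
    by (intro integrable_mult_right indicator_norm_integrable ab)
  have eq: "(\<lambda>t. indicator {a..b} t * energy_form J (w t) g) =
    (\<lambda>t. indicator {a..b} t * (if t > 0 then energy_form J (w t) g else 0))"
    using ab by (auto simp: fun_eq_iff indicator_def)
  show "(\<lambda>t. indicator {a..b} t * energy_form J (w t) g) \<in> borel_measurable lebesgue"
    unfolding eq by (intro borel_measurable_times energy_measurable g borel_measurable_indicator) simp
  show "AE t in lebesgue. norm (indicator {a..b} t * energy_form J (w t) g) \<le>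
     norm ((\<Lambda> * gagliardo_norm \<sigma> g) * (indicator {a..b} t * gagliardo_norm \<sigma> (w t)))"
    using w_finite
  proof eventually_elim
    case (elim t)
    show ?case
    proof (cases "t \<in> {a..b}")
      case True
      then have "gagliardo_finite \<sigma> (w t)" using elim ab by auto
      from energy_form_bound[OF adm \<Lambda> this g] show ?thesis
        using True \<Lambda> by (simp add: abs_mult mult_ac)
    qed simp
  qed
qed

text \<open>The test function is \<open>\<eta> x * h n t\<close>, where \<open>h n\<close> is a
  smooth approximation of the indicator of \<open>{a<..b}\<close>. Its derivative concentrates at
  \<open>a\<close> with mass 1 and at \<open>b\<close> with mass -1, which recovers the two time
  slices by the continuity of \<open>u\<close> in \<open>L^1\<close>.\<close>

lemma weak_identity_smooth:
  assumes \<eta>: "smooth_supported r \<eta>" and \<eta>f: "gagliardo_finite \<sigma> \<eta>" and ab: "0 < a" "a < b"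
  shows "(LINT x|lebesgue. (u b x - u a x) * \<eta> x) =
    - (LINT t|lebesgue. indicator {a<..b} t * energy_form J (w t) \<eta>)"
proof -
  obtain C where C: "C > 0" "\<And>x. \<bar>\<eta> x\<bar> \<le> C" using smooth_supported_bounded[OF \<eta>] by blast
  have \<eta>m: "\<eta> \<in> borel_measurable lebesgue"
    using smooth_supported_measurable[OF \<eta>] by (simp add: measurable_completion)
  have ui: "integrable lebesgue (\<lambda>x. f x * \<eta> x)" if "integrable lebesgue f" for f
  proof (rule Bochner_Integration.integrable_bound)
    show "integrable lebesgue (\<lambda>x. C * f x)" using that by simp
    show "(\<lambda>x. f x * \<eta> x) \<in> borel_measurable lebesgue" using that \<eta>m by auto
    show "AE x in lebesgue. norm (f x * \<eta> x) \<le> norm (C * f x)"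
      using C by (auto simp: abs_mult mult.commute[of C] intro!: AE_I2 mult_left_mono)
  qed
  define U where "U t = (LINT x|lebesgue. u t x * \<eta> x)" for t
  have Udiff: "U s - U t = (LINT x|lebesgue. (u s x - u t x) * \<eta> x)" if "s \<ge> 0" "t \<ge> 0" for s t
    using ui[OF u_integrable[OF that(1)]] ui[OF u_integrable[OF that(2)]] by (simp add: U_def left_diff_distrib)
  have Uc: "continuous_on {0..} U"
  proof (rule continuous_on_L1_lipschitz)
    fix s t :: real assume st: "s \<ge> 0" "t \<ge> 0"
    have d: "integrable lebesgue (\<lambda>x. u s x - u t x)" using u_integrable st by auto
    have "\<bar>U s - U t\<bar> \<le> (LINT x|lebesgue. \<bar>(u s x - u t x) * \<eta> x\<bar>)"
      unfolding Udiff[OF st] by (rule integral_abs_bound)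
    also have "\<dots> \<le> (LINT x|lebesgue. C * \<bar>u s x - u t x\<bar>)"
    proof (rule integral_mono)
      show "integrable lebesgue (\<lambda>x. \<bar>(u s x - u t x) * \<eta> x\<bar>)" using ui[OF d] by simp
      show "integrable lebesgue (\<lambda>x. C * \<bar>u s x - u t x\<bar>)" using d by simp
      show "\<bar>(u s x - u t x) * \<eta> x\<bar> \<le> C * \<bar>u s x - u t x\<bar>" for x
        using C by (simp add: abs_mult mult.commute[of C] mult_left_mono)
    qed
    finally show "\<bar>U s - U t\<bar> \<le> C * (LINT x|lebesgue. \<bar>u s x - u t x\<bar>)" by simp
  qed
  \<comment> \<open>\<open>U\<close> is controlled for nonnegative times only; freezing it before
    \<open>a\<close> gives a function continuous on the whole line, unchanged where
    \<open>h n\<close> varies.\<close>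
  define V where "V t = U (max a t)" for t
  have Vc: "continuous_on UNIV V" unfolding V_def
    by (rule continuous_on_compose2[OF Uc]) (use ab in \<open>auto intro!: continuous_intros\<close>)
  obtain s :: "real \<Rightarrow> real" where s: "\<And>k. C_k k s" "\<And>t. t \<le> 0 \<Longrightarrow> s t = 0" "\<And>t. t \<ge> 1 \<Longrightarrow> s t = 1"
    "\<And>t. 0 \<le> s t" "\<And>t. s t \<le> 1"
    using smooth_step_exists by blast
  \<comment> \<open>The two steps take place on \<open>[a, a + 1 / (n + 1)]\<close> and
    \<open>[b, b + 1 / (n + 1)]\<close>. Both intervals lie to the right of the endpoints, so the
    support stays in positive times and the limit is the indicator of the half-open
    \<open>{a<..b}\<close>.\<close>
  define h where "h n t = s ((real n + 1) * (t - a)) + (-1) * s ((real n + 1) * (t - b))" for n t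
  have hC: "C_k k (h n)" for k n
  proof -
    have "C_k k (\<lambda>t. s ((real n + 1) * (t - c)))" for c
    proof (rule C_k_compose_smooth[OF s(1)])
      have "C_k k (\<lambda>t. (real n + 1) * (t + (- c)))"
        by (intro C_k_mult C_k_add C_k_const C_k_linear bounded_linear_ident)
      then show "C_k k (\<lambda>t. (real n + 1) * (t - c))" by simp
    qed
    then show ?thesis unfolding h_def[abs_def] by (intro C_k_add C_k_mult C_k_const)
  qed
  have h0: "h n t = 0" if "t \<notin> {a..b + 1}" for n t
  proof (cases "t < a")
    case True
    then have "(real n + 1) * (t - a) \<le> 0" "(real n + 1) * (t - b) \<le> 0"
      using ab by (auto intro!: mult_nonneg_nonpos)
    then show ?thesis using s(2) by (simp add: h_def)
  next
    case False
    then have "1 \<le> t - a" "1 \<le> t - b" using that ab by auto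
    then have "1 * 1 \<le> (real n + 1) * (t - a)" "1 * 1 \<le> (real n + 1) * (t - b)"
      by (intro mult_mono; simp)+
    then show ?thesis using s(3) by (simp add: h_def)
  qed
  have h1: "\<bar>h n t\<bar> \<le> 1" for n t using s(4,5) unfolding h_def by (smt (verit, best))
  have hlim: "(\<lambda>n. h n t) \<longlonglongrightarrow> indicator {a<..b} t" for t
  proof -
    have sl: "(\<lambda>n. s ((real n + 1) * (t - c))) \<longlonglongrightarrow> (if c < t then 1 else 0)" for c
    proof (cases "c < t")
      case True
      obtain n0 :: nat where n0: "1 / (t - c) \<le> real n0" using real_arch_simple by blast
      have "\<forall>\<^sub>F n in sequentially. s ((real n + 1) * (t - c)) = 1"
        using eventually_ge_at_top[of n0]
      proof eventually_elim
        case (elim n)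
        then have "1 / (t - c) \<le> real n + 1" using n0 by linarith
        then show ?case using True by (intro s(3)) (simp add: field_simps)
      qed
      then show ?thesis using True by (simp add: tendsto_eventually)
    next
      case False
      then have "s ((real n + 1) * (t - c)) = 0" for n by (intro s(2) mult_nonneg_nonpos) auto
      then show ?thesis using False by simp
    qed
    have "(\<lambda>n. h n t) \<longlonglongrightarrow> (if a < t then 1 else 0) + (-1) * (if b < t then 1 else 0)"
      unfolding h_def by (intro tendsto_intros sl)
    moreover have "(if a < t then 1 else 0) + (-1) * (if b < t then 1 else 0) = (indicator {a<..b} t :: real)"
      using ab by (auto simp: indicator_def)
    ultimately show ?thesis by simp
  qed
  have hd: "(h n has_real_derivative
      (real n + 1) * deriv s ((real n + 1) * (t - a)) - (real n + 1) * deriv s ((real n + 1) * (t - b))) (at t)" for n t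
  proof -
    have "((\<lambda>t. s ((real n + 1) * (t - c))) has_real_derivative deriv s ((real n + 1) * (t - c)) * (real n + 1)) (at t)" for c
    proof (rule DERIV_chain2[of s])
      show "((\<lambda>t. (real n + 1) * (t - c)) has_real_derivative real n + 1) (at t)"
        by (auto intro!: derivative_eq_intros)
    qed (rule smooth_real_deriv[OF s(1)])
    from DERIV_add[OF this[of a] DERIV_cmult[OF this[of b], of "-1"]]
    show ?thesis unfolding h_def[abs_def] by (simp add: mult.commute)
  qed
  let ?A = "\<lambda>n t. (real n + 1) * deriv s ((real n + 1) * (t - a)) * V t - (real n + 1) * deriv s ((real n + 1) * (t - b)) * V t"
  let ?e = "\<lambda>t. energy_form J (w t) \<eta>"
  have weak: "(LINT t|lborel. ?A n t) = (LINT t|lebesgue. h n t * (indicator {a..b+1} t * ?e t))" for n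
  proof -
    have "test_function (\<lambda>p. \<eta> (fst p) * h n (snd p))"
      by (rule test_function_product[OF \<eta> hC h0 ab(1)])
    then have "(LINT t:{0<..}|lebesgue. LINT x|lebesgue. u t x * deriv (\<lambda>s. \<eta> x * h n s) t)
        = (LINT t:{0<..}|lebesgue. energy_form J (w t) (\<lambda>x. \<eta> x * h n t))"
      using sol unfolding weak_solution_def by fastforce
    moreover have "indicator {0<..} t *\<^sub>R (LINT x|lebesgue. u t x * deriv (\<lambda>s. \<eta> x * h n s) t) = ?A n t" for t
    proof -
      have "deriv (\<lambda>s. \<eta> x * h n s) t = \<eta> x * deriv (h n) t" for x
        using DERIV_imp_deriv[OF DERIV_cmult[OF hd]] DERIV_imp_deriv[OF hd] by simp
      then have "(LINT x|lebesgue. u t x * deriv (\<lambda>s. \<eta> x * h n s) t) = (LINT x|lebesgue. deriv (h n) t * (u t x * \<eta> x))"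
        by (simp add: mult_ac)
      also have "\<dots> = deriv (h n) t * U t" by (simp add: U_def)
      finally have 1: "(LINT x|lebesgue. u t x * deriv (\<lambda>s. \<eta> x * h n s) t) = deriv (h n) t * U t" .
      show ?thesis
      proof (cases "t < a")
        case True
        then have "(real n + 1) * (t - a) < 0" "(real n + 1) * (t - b) < 0"
          using ab by (auto intro!: mult_pos_neg)
        then have "deriv s ((real n + 1) * (t - a)) = 0" "deriv s ((real n + 1) * (t - b)) = 0"
          using deriv_step_zero[OF s(1,2)] by auto
        then show ?thesis unfolding 1 DERIV_imp_deriv[OF hd] by simp
      next
        case False
        then have "V t = U t" "t > 0" using ab by (auto simp: V_def)
        then show ?thesis unfolding 1 DERIV_imp_deriv[OF hd] by (simp add: left_diff_distrib)
      qed
    qed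
    moreover have "indicator {0<..} t *\<^sub>R energy_form J (w t) (\<lambda>x. \<eta> x * h n t) = h n t * (indicator {a..b+1} t * ?e t)" for t
    proof -
      have "energy_form J (w t) (\<lambda>x. \<eta> x * h n t) = h n t * ?e t"
        using energy_form_cmult_right[OF adm \<Lambda>, where f="w t" and c="h n t" and g=\<eta>] by (simp add: mult.commute)
      then show ?thesis using h0[of t n] ab by (cases "t \<in> {a..b+1}") auto
    qed
    moreover have "(LINT t|lebesgue. ?A n t) = (LINT t|lborel. ?A n t)"
      using integral_shrinking_kernel(1)[OF s(1,2,3) Vc, of n a] integral_shrinking_kernel(1)[OF s(1,2,3) Vc, of n b]
      by (intro integral_completion borel_measurable_diff) auto
    ultimately show ?thesis unfolding set_lebesgue_integral_def by simp
  qed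
  have "(\<lambda>n. LINT t|lborel. ?A n t) \<longlonglongrightarrow> V a - V b"
    using integral_shrinking_kernel[OF s(1,2,3) Vc]
    by (subst Bochner_Integration.integral_diff) (auto intro!: tendsto_diff)
  moreover have "V a - V b = U a - U b" using ab by (simp add: V_def)
  ultimately have L1: "(\<lambda>n. LINT t|lborel. ?A n t) \<longlonglongrightarrow> U a - U b" by simp
  have ei: "integrable lebesgue (\<lambda>t. indicator {a..b+1} t * ?e t)"
    by (rule energy_integrable[OF \<eta>f]) (use ab in auto)
  have "(\<lambda>n. LINT t|lebesgue. h n t * (indicator {a..b+1} t * ?e t)) \<longlonglongrightarrow>
      (LINT t|lebesgue. indicator {a<..b} t * (indicator {a..b+1} t * ?e t))"
  proof (rule integral_dominated_convergence[where w="\<lambda>t. norm (indicator {a..b+1} t * ?e t)"])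
    have hm: "h n \<in> borel_measurable lebesgue" for n
      using C_k_continuous[OF hC] by (intro measurable_completion) (simp add: borel_measurable_continuous_onI)
    show "(\<lambda>t. indicator {a<..b} t * (indicator {a..b+1} t * ?e t)) \<in> borel_measurable lebesgue"
      by (rule borel_measurable_times[OF borel_measurable_indicator borel_measurable_integrable[OF ei]]) simp
    show "(\<lambda>t. h n t * (indicator {a..b+1} t * ?e t)) \<in> borel_measurable lebesgue" for n
      by (rule borel_measurable_times[OF hm borel_measurable_integrable[OF ei]])
    show "AE t in lebesgue. (\<lambda>n. h n t * (indicator {a..b+1} t * ?e t)) \<longlonglongrightarrow> indicator {a<..b} t * (indicator {a..b+1} t * ?e t)"
      by (intro AE_I2 tendsto_intros hlim)
    have "norm (h n t * c) \<le> norm c" for n t c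
      using h1[of n t] by (simp add: abs_mult mult_left_le_one_le)
    then show "AE t in lebesgue. norm (h n t * (indicator {a..b+1} t * ?e t)) \<le> norm (indicator {a..b+1} t * ?e t)" for n
      by (intro AE_I2)
  qed (use ei in auto)
  moreover have "indicator {a<..b} t * (indicator {a..b+1} t * ?e t) = indicator {a<..b} t * ?e t" for t
    by (auto simp: indicator_def)
  ultimately have "(\<lambda>n. LINT t|lebesgue. h n t * (indicator {a..b+1} t * ?e t)) \<longlonglongrightarrow> (LINT t|lebesgue. indicator {a<..b} t * ?e t)"
    by simp
  with L1 have "U a - U b = (LINT t|lebesgue. indicator {a<..b} t * ?e t)"
    unfolding weak by (rule LIMSEQ_unique)
  then show ?thesis using Udiff[of b a] ab by simp
qed

text \<open>The left side passes to the limit by the common bound \<open>K\<close>. On the right the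
  energies converge at almost every time and are dominated by a multiple of the norm of
  \<open>w t\<close>, which is integrable over \<open>[a, b]\<close>.\<close>

lemma weak_identity_borel:
  assumes g: "g \<in> borel_measurable borel" "\<And>x. \<bar>g x\<bar> \<le> K" "integrable lborel g" "gagliardo_finite \<sigma> g"
    and ab: "0 < a" "a < b"
  shows "(LINT x|lebesgue. (u b x - u a x) * g x) =
    - (LINT t|lebesgue. indicator {a<..b} t * energy_form J (w t) g)"
proof -
  obtain \<eta> C where \<eta>: "\<And>k::nat. \<exists>r. smooth_supported r (\<eta> k)" "\<And>k x. \<bar>\<eta> k x\<bar> \<le> K"
    "\<And>k. gagliardo_finite \<sigma> (\<eta> k)" "\<And>k. gagliardo_norm \<sigma> (\<eta> k) \<le> C"
    "AE x in lborel. (\<lambda>k. \<eta> k x) \<longlonglongrightarrow> g x"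
    using smooth_approximation[OF \<sigma> g] by blast
  let ?d = "\<lambda>x. u b x - u a x"
  have d: "integrable lebesgue ?d" using u_integrable ab by auto
  have id: "(LINT x|lebesgue. ?d x * \<eta> k x) = - (LINT t|lebesgue. indicator {a<..b} t * energy_form J (w t) (\<eta> k))" for k
    using \<eta>(1)[of k] weak_identity_smooth[OF _ \<eta>(3) ab] by blast
  have L1: "(\<lambda>k. LINT x|lebesgue. ?d x * \<eta> k x) \<longlonglongrightarrow> (LINT x|lebesgue. ?d x * g x)"
  proof (rule integral_dominated_convergence[where w="\<lambda>x. K * \<bar>?d x\<bar>"])
    show "integrable lebesgue (\<lambda>x. K * \<bar>?d x\<bar>)" using d by simp
    show "(\<lambda>x. ?d x * g x) \<in> borel_measurable lebesgue"
      using d g(1) by (intro borel_measurable_times) (auto simp: measurable_completion)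
    show "(\<lambda>x. ?d x * \<eta> k x) \<in> borel_measurable lebesgue" for k
      using d \<eta>(3)[of k] by (intro borel_measurable_times) (auto simp: gagliardo_finite_def)
    show "AE x in lebesgue. (\<lambda>k. ?d x * \<eta> k x) \<longlonglongrightarrow> ?d x * g x"
      using AE_completion[OF \<eta>(5)] by eventually_elim (intro tendsto_intros)
    show "AE x in lebesgue. norm (?d x * \<eta> k x) \<le> K * \<bar>?d x\<bar>" for k
      using \<eta>(2) by (auto simp: abs_mult mult.commute[of K] intro!: AE_I2 mult_left_mono)
  qed
  have L2: "(\<lambda>k. LINT t|lebesgue. indicator {a<..b} t * energy_form J (w t) (\<eta> k)) \<longlonglongrightarrow>
     (LINT t|lebesgue. indicator {a<..b} t * energy_form J (w t) g)"
  proof (rule integral_dominated_convergence[where w="\<lambda>t. (\<Lambda> * C) * (indicator {a..b} t * gagliardo_norm \<sigma> (w t))"])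
    show "integrable lebesgue (\<lambda>t. (\<Lambda> * C) * (indicator {a..b} t * gagliardo_norm \<sigma> (w t)))"
      by (intro integrable_mult_right indicator_norm_integrable ab)
    have m: "(\<lambda>t. indicator {a<..b} t * energy_form J (w t) f) \<in> borel_measurable lebesgue"
      if "gagliardo_finite \<sigma> f" for f
    proof -
      have "(\<lambda>t. indicator {a<..b} t * energy_form J (w t) f) = (\<lambda>t. indicator {a<..b} t * (indicator {a..b} t * energy_form J (w t) f))"
        by (auto simp: fun_eq_iff indicator_def)
      then show ?thesis
        using borel_measurable_times[OF borel_measurable_indicator borel_measurable_integrable[OF energy_integrable[OF that ab]], of "{a<..b}"]
        by (simp only:) simp
    qed
    show "(\<lambda>t. indicator {a<..b} t * energy_form J (w t) g) \<in> borel_measurable lebesgue" by (rule m[OF g(4)])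
    show "(\<lambda>t. indicator {a<..b} t * energy_form J (w t) (\<eta> k)) \<in> borel_measurable lebesgue" for k by (rule m[OF \<eta>(3)])
    show "AE t in lebesgue. (\<lambda>k. indicator {a<..b} t * energy_form J (w t) (\<eta> k)) \<longlonglongrightarrow> indicator {a<..b} t * energy_form J (w t) g"
      using w_finite
    proof eventually_elim
      case (elim t)
      show ?case
      proof (cases "t \<in> {a<..b}")
        case True
        then have "gagliardo_finite \<sigma> (w t)" using elim ab by auto
        from energy_form_weak_convergence[OF adm \<Lambda> this g(4) \<eta>(3) \<eta>(4) \<eta>(5)]
        show ?thesis by (intro tendsto_mult tendsto_const)
      qed simp
    qed
    show "AE t in lebesgue. norm (indicator {a<..b} t * energy_form J (w t) (\<eta> k)) \<le> (\<Lambda> * C) * (indicator {a..b} t * gagliardo_norm \<sigma> (w t))" for k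
      using w_finite
    proof eventually_elim
      case (elim t)
      show ?case
      proof (cases "t \<in> {a<..b}")
        case True
        then have "gagliardo_finite \<sigma> (w t)" using elim ab by auto
        from energy_form_bound[OF adm \<Lambda> this \<eta>(3)]
        have "\<bar>energy_form J (w t) (\<eta> k)\<bar> \<le> \<Lambda> * gagliardo_norm \<sigma> (w t) * gagliardo_norm \<sigma> (\<eta> k)" .
        also have "\<dots> \<le> \<Lambda> * gagliardo_norm \<sigma> (w t) * C"
          using \<Lambda> by (intro mult_left_mono \<eta>(4)) auto
        finally show ?thesis using True by (simp add: mult_ac)
      next
        case False
        have "0 \<le> C" using \<eta>(4)[of 0] gagliardo_norm_nonneg[of \<sigma> "\<eta> 0"] by linarith
        then show ?thesis using False \<Lambda> by simp
      qed
    qed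
  qed
  show ?thesis using L1 tendsto_minus[OF L2] unfolding id by (rule LIMSEQ_unique)
qed

lemma weak_identity:
  assumes g: "g \<in> borel_measurable lebesgue" "\<And>x. \<bar>g x\<bar> \<le> K" "integrable lebesgue g" "gagliardo_finite \<sigma> g"
    and ab: "0 < a" "a < b"
  shows "(LINT x|lebesgue. (u b x - u a x) * g x) =
    - (LINT t|lebesgue. indicator {a<..b} t * energy_form J (w t) g)"
proof -
  obtain g0 where g0: "g0 \<in> borel_measurable borel" "AE x in lborel. g x = g0 x"
    using borel_representative[OF g(1)] by blast
  \<comment> \<open>The representative is clamped so that the bound by \<open>K\<close> holds
    everywhere and not just almost everywhere.\<close>
  define g' where "g' x = max (-K) (min K (g0 x))" for x
  have K0: "K \<ge> 0" using g(2)[of 0] by linarith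
  have m: "g' \<in> borel_measurable borel" unfolding g'_def[abs_def] using g0(1) by measurable
  have ae: "AE x in lborel. g x = g' x" using g0(2)
  proof eventually_elim
    case (elim x)
    then show ?case using g(2)[of x] by (auto simp: g'_def)
  qed
  have b: "\<bar>g' x\<bar> \<le> K" for x using K0 by (auto simp: g'_def)
  have "integrable lebesgue g'"
    using g(3) by (rule integrable_cong_AE_imp) (use m AE_completion[OF ae] in \<open>auto simp: measurable_completion\<close>)
  then have i: "integrable lborel g'" using m by (simp add: integrable_completion)
  have f: "gagliardo_finite \<sigma> g'"
  proof -
    have "gagliardo_sq \<sigma> g' = gagliardo_sq \<sigma> g" unfolding gagliardo_sq_eq
    proof (rule nn_integral_cong_AE)
      show "AE p in lebesgue. ennreal ((gagliardo_quotient \<sigma> g' p)\<^sup>2) = ennreal ((gagliardo_quotient \<sigma> g p)\<^sup>2)"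
        using gagliardo_quotient_cong_AE[OF ae, of \<sigma>] by eventually_elim simp
    qed
    then show ?thesis using g(4) m by (simp add: gagliardo_finite_def measurable_completion)
  qed
  have e: "energy_form J (w t) g' = energy_form J (w t) g" if wt: "gagliardo_finite \<sigma> (w t)" for t
    unfolding energy_form_eq[of J "w t" _ \<sigma>]
  proof (intro arg_cong[where f="\<lambda>x. 1 / 2 * x"] integral_cong_AE)
    show "AE p in lebesgue. rescaled_kernel \<sigma> J p * gagliardo_quotient \<sigma> (w t) p * gagliardo_quotient \<sigma> g' p =
       rescaled_kernel \<sigma> J p * gagliardo_quotient \<sigma> (w t) p * gagliardo_quotient \<sigma> g p"
      using gagliardo_quotient_cong_AE[OF ae, of \<sigma>] by eventually_elim simp
  qed (use energy_form_integrable[OF adm \<Lambda> wt f] energy_form_integrable[OF adm \<Lambda> wt g(4)] in auto)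
  have "(LINT x|lebesgue. (u b x - u a x) * g x) = (LINT x|lebesgue. (u b x - u a x) * g' x)"
  proof (rule integral_cong_AE)
    show "AE x in lebesgue. (u b x - u a x) * g x = (u b x - u a x) * g' x"
      using AE_completion[OF ae] by eventually_elim simp
    have "(\<lambda>x. u b x - u a x) \<in> borel_measurable lebesgue" using u_integrable[of a] u_integrable[of b] ab by auto
    then show "(\<lambda>x. (u b x - u a x) * g x) \<in> borel_measurable lebesgue" "(\<lambda>x. (u b x - u a x) * g' x) \<in> borel_measurable lebesgue"
      using g(1) m by (auto intro!: borel_measurable_times simp: measurable_completion)
  qed
  also have "\<dots> = - (LINT t|lebesgue. indicator {a<..b} t * energy_form J (w t) g')"
    by (rule weak_identity_borel[OF m b i f ab])
  also have "(LINT t|lebesgue. indicator {a<..b} t * energy_form J (w t) g') = (LINT t|lebesgue. indicator {a<..b} t * energy_form J (w t) g)"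
  proof (rule integral_cong_AE)
    have mm: "(\<lambda>t. indicator {a<..b} t * energy_form J (w t) f) \<in> borel_measurable lebesgue"
      if "gagliardo_finite \<sigma> f" for f
    proof -
      have "(\<lambda>t. indicator {a<..b} t * energy_form J (w t) f) = (\<lambda>t. indicator {a<..b} t * (indicator {a..b} t * energy_form J (w t) f))"
        by (auto simp: fun_eq_iff indicator_def)
      then show ?thesis
        using borel_measurable_times[OF borel_measurable_indicator borel_measurable_integrable[OF energy_integrable[OF that ab]], of "{a<..b}"]
        by (simp only:) simp
    qed
    show "(\<lambda>t. indicator {a<..b} t * energy_form J (w t) g') \<in> borel_measurable lebesgue"
      "(\<lambda>t. indicator {a<..b} t * energy_form J (w t) g) \<in> borel_measurable lebesgue"
      by (rule mm[OF f], rule mm[OF g(4)])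
    show "AE t in lebesgue. indicator {a<..b} t * energy_form J (w t) g' = indicator {a<..b} t * energy_form J (w t) g"
      using w_finite by eventually_elim (use e ab in \<open>auto simp: indicator_def\<close>)
  qed
  finally show ?thesis .
qed

end

section \<open>Continuity of translations in time\<close>

lemma indicator_continuous_approximation:
  fixes A :: "real set" and e :: real
  assumes A: "A \<in> sets lebesgue" "A \<subseteq> {a..b}" and e: "e > 0"
  obtains c :: "real \<Rightarrow> real" where "continuous_on UNIV c" "\<And>t. \<bar>c t\<bar> \<le> 1" "(LINT t|lebesgue. \<bar>indicator A t - c t\<bar>) < e"
    "integrable lebesgue (\<lambda>t. indicator A t - c t)"
proof -
  define R where "R = \<bar>a\<bar> + \<bar>b\<bar> + 1"
  have R: "R > 0" "{a..b} \<subseteq> cball 0 R" by (auto simp: R_def)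
  have Am: "(indicator A :: real \<Rightarrow> real) \<in> borel_measurable lebesgue" using A by simp
  obtain f0 where f0: "f0 \<in> borel_measurable borel" "AE t in lborel. (indicator A t :: real) = f0 t"
    using borel_representative[OF Am] by blast
  define f where "f t = max 0 (min 1 (f0 t)) * indicator (cball 0 R) t" for t :: real
  have fm: "f \<in> borel_measurable borel"
  proof -
    have [measurable]: "cball (0::real) R \<in> sets borel" by (intro borel_closed closed_cball)
    show ?thesis unfolding f_def using f0(1) by measurable
  qed
  have ae: "AE t in lborel. indicator A t = f t" using f0(2)
  proof eventually_elim
    case (elim t)
    then show ?case using A(2) R(2) by (cases "t \<in> A") (auto simp: f_def indicator_def split: if_splits)
  qed
  have fK: "\<bar>f t\<bar> \<le> 1" for t by (auto simp: f_def indicator_def)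
  have fs: "f t = 0" if "t \<notin> cball 0 R" for t using that by (simp add: f_def)
  obtain c where c: "continuous_on UNIV c" "\<And>t. \<bar>c t\<bar> \<le> 1" "\<And>t. t \<notin> cball 0 (2 * R) \<Longrightarrow> c t = 0"
    "(LINT t|lborel. \<bar>f t - c t\<bar>) < e"
    using continuous_L1_approximation[OF fm fK fs R(1) e] by blast
  have cm: "c \<in> borel_measurable borel" by (rule borel_measurable_continuous_onI[OF c(1)])
  have "integrable lborel f" "integrable lborel c"
    using bounded_support_integrable[OF fm fK fs] bounded_support_integrable[OF cm c(2,3)] by auto
  then have "integrable lborel (\<lambda>t. f t - c t)" by simp
  then have fc: "integrable lebesgue (\<lambda>t. f t - c t)" using fm cm by (subst integrable_completion) auto
  have ae': "AE t in lebesgue. f t - c t = indicator A t - c t"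
    using AE_completion[OF ae] by eventually_elim simp
  have m: "(\<lambda>t. indicator A t - c t) \<in> borel_measurable lebesgue"
    using A cm by (intro borel_measurable_diff) (auto simp: measurable_completion)
  have i: "integrable lebesgue (\<lambda>t. indicator A t - c t)"
    by (rule integrable_cong_AE_imp[OF fc m ae'])
  have "(LINT t|lebesgue. \<bar>indicator A t - c t\<bar>) = (LINT t|lebesgue. \<bar>f t - c t\<bar>)"
  proof (rule integral_cong_AE)
    show "AE t in lebesgue. \<bar>indicator A t - c t\<bar> = \<bar>f t - c t\<bar>" using ae' by eventually_elim simp
  qed (use i fc in auto)
  also have "\<dots> = (LINT t|lborel. \<bar>f t - c t\<bar>)"
    using fm cm by (subst integral_completion) auto
  finally show ?thesis using that[OF c(1,2) _ i] c(4) by simp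
qed

text \<open>Fubini: a fixed \<open>s\<close> lies in the window \<open>{t - h<..t}\<close> exactly
  for \<open>t\<close> in \<open>{s..<s + h}\<close>, an interval of length
  \<open>h\<close>.\<close>

lemma window_integral:
  fixes f :: "real \<Rightarrow> real"
  assumes f[measurable]: "f \<in> borel_measurable borel" and f0: "\<And>s. 0 \<le> f s" and fi: "integrable lborel f" and h: "h > 0"
  shows "integrable lborel (\<lambda>t. LINT s|lborel. indicator {t - h<..t} s * f s)"
    and "(LINT t|lborel. LINT s|lborel. indicator {t - h<..t} s * f s) = h * (LINT s|lborel. f s)"
proof -
  have m[measurable]: "(\<lambda>(t, s). (indicator {t - h<..t} s :: real) * f s) \<in> borel_measurable (lborel \<Otimes>\<^sub>M lborel)"
  proof -
    have "(\<lambda>(t, s). (indicator {t - h<..t} s :: real) * f s) = (\<lambda>p. if fst p - h < snd p \<and> snd p \<le> fst p then f (snd p) else 0)"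
      by (auto simp: fun_eq_iff indicator_def)
    also have "\<dots> \<in> borel_measurable (lborel \<Otimes>\<^sub>M lborel)" by measurable
    finally show ?thesis .
  qed
  have ii: "integrable lborel (\<lambda>s. indicator {t - h<..t} s * f s)" for t
    by (rule Bochner_Integration.integrable_bound[OF fi]) (auto simp: indicator_def)
  let ?F = "\<lambda>t. LINT s|lborel. indicator {t - h<..t} s * f s"
  have Fm: "?F \<in> borel_measurable lborel"
    using m by (intro lborel.borel_measurable_lebesgue_integral) auto
  have F0: "0 \<le> ?F t" for t by (intro integral_nonneg_AE AE_I2) (simp add: f0)
  have "(\<integral>\<^sup>+ t. ennreal (?F t) \<partial>lborel) = (\<integral>\<^sup>+ t. \<integral>\<^sup>+ s. ennreal (indicator {t - h<..t} s * f s) \<partial>lborel \<partial>lborel)"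
    using ii f0 by (intro nn_integral_cong nn_integral_eq_integral[symmetric]) auto
  also have "\<dots> = (\<integral>\<^sup>+ s. \<integral>\<^sup>+ t. ennreal (indicator {t - h<..t} s * f s) \<partial>lborel \<partial>lborel)"
    using m by (intro lborel_pair.Fubini'[symmetric]) (simp add: split_beta')
  also have "\<dots> = (\<integral>\<^sup>+ s. ennreal (h * f s) \<partial>lborel)"
  proof (rule nn_integral_cong)
    fix s :: real
    have "(\<integral>\<^sup>+ t. ennreal (indicator {t - h<..t} s * f s) \<partial>lborel) = (\<integral>\<^sup>+ t. ennreal (f s) * indicator {s..<s + h} t \<partial>lborel)"
      by (intro nn_integral_cong) (auto simp: indicator_def)
    also have "\<dots> = ennreal (f s) * emeasure lborel {s..<s+h}" by (rule nn_integral_cmult_indicator) simp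
    also have "\<dots> = ennreal (h * f s)" using h f0 by (simp add: ennreal_mult mult.commute)
    finally show "(\<integral>\<^sup>+ t. ennreal (indicator {t - h<..t} s * f s) \<partial>lborel) = ennreal (h * f s)" .
  qed
  also have "\<dots> = ennreal (h * (LINT s|lborel. f s))"
    using fi h f0 by (subst nn_integral_eq_integral) auto
  finally have eq: "(\<integral>\<^sup>+ t. ennreal (?F t) \<partial>lborel) = ennreal (h * (LINT s|lborel. f s))" .
  show "integrable lborel ?F"
    using Fm F0 eq by (simp add: integrable_iff_bounded)
  show "(LINT t|lborel. ?F t) = h * (LINT s|lborel. f s)"
    using Fm F0 eq h f0 by (intro integral_eq_nn_integral[THEN trans]) (auto intro!: mult_nonneg_nonneg integral_nonneg_AE)
qed

context fractional_solution
begin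

text \<open>A step function is set to \<open>0\<close> at the times where \<open>0\<close> is closer to \<open>w\<close> than its value; its
  distance to \<open>w\<close> is then dominated by the norm of \<open>w\<close>.\<close>

lemma truncated_step_approximation:
  assumes ab: "0 < a" "a < b" and e: "e > 0"
  obtains s where "time_step_function \<sigma> s"
    "L2f lebesgue (\<lambda>t. indicator {a..b} t * gagliardo_norm \<sigma> (\<lambda>x. w t x - s t x))"
    "l2norm lebesgue (\<lambda>t. indicator {a..b} t * gagliardo_norm \<sigma> (\<lambda>x. w t x - s t x)) < e"
proof -
  obtain s where s: "\<And>k::nat. time_step_function \<sigma> (s k)"
    "AE t in lebesgue. t > 0 \<longrightarrow> gagliardo_finite \<sigma> (w t) \<and> (\<lambda>k. gagliardo_norm \<sigma> (\<lambda>x. s k t x - w t x)) \<longlonglongrightarrow> 0"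
    using step_approximation by blast
  define d where "d k t = (if t > 0 then gagliardo_norm \<sigma> (\<lambda>x. w t x - s k t x) else 0)" for k t
  define n where "n t = (if t > 0 then gagliardo_norm \<sigma> (w t) else 0)" for t
  have dm: "d k \<in> borel_measurable lebesgue" for k unfolding d_def[abs_def] by (rule distance_measurable[OF s(1)])
  have nm: "n \<in> borel_measurable lebesgue" unfolding n_def[abs_def] by (rule w_norm_measurable)
  define r where "r k t = (if d k t \<le> n t then s k t else (\<lambda>x. 0))" for k t
  have rs: "time_step_function \<sigma> (r k)" for k
    unfolding time_step_function_def
  proof (intro conjI ballI allI)
    have "r k ` {0<..} \<subseteq> insert (\<lambda>x. 0) (s k ` {0<..})" by (auto simp: r_def)
    then show "finite (r k ` {0<..})" using s(1)[of k] by (auto simp: time_step_function_def intro: finite_subset)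
    fix f
    show "gagliardo_finite \<sigma> f" if "f \<in> r k ` {0<..}"
      using that time_step_functionD[OF s(1)] time_step_functionD[OF zero_step, of 1] by (auto simp: r_def)
    have c: "{t. d k t \<le> n t} \<in> sets lebesgue"
      using borel_measurable_le[OF dm nm, of k] by simp
    have l: "{t \<in> {0<..}. s k t = f} \<in> sets lebesgue" for f
      using s(1)[of k] by (auto simp: time_step_function_def)
    have "{t \<in> {0<..}. r k t = f} = ({t \<in> {0<..}. s k t = f} \<inter> {t. d k t \<le> n t}) \<union>
      (if f = (\<lambda>x. 0) then {0<..} - {t. d k t \<le> n t} else {})"
      by (auto simp: r_def)
    also have "\<dots> \<in> sets lebesgue"
    proof -
      have o: "{0<..} \<in> sets (lebesgue :: real measure)" by simp
      show ?thesis
      proof (cases "f = (\<lambda>x. 0)")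
        case True
        show ?thesis unfolding if_P[OF True] by (intro sets.Un sets.Int sets.Diff l c o)
      next
        case False
        show ?thesis unfolding if_not_P[OF False] Un_empty_right by (intro sets.Int l c)
      qed
    qed
    finally show "{t \<in> {0<..}. r k t = f} \<in> sets lebesgue" .
  qed
  define B where "B k t = indicator {a..b} t * gagliardo_norm \<sigma> (\<lambda>x. w t x - r k t x)" for k t
  \<comment> \<open>The choice made in \<open>r\<close> turns the distance into the smaller of the
    two, which gives both the domination and the convergence to 0.\<close>
  have Bmin: "B k t = indicator {a..b} t * min (d k t) (n t)" for k t
    using ab by (auto simp: B_def r_def d_def n_def indicator_def)
  have Bm: "B k \<in> borel_measurable lebesgue" for k
    unfolding Bmin[abs_def] by (intro borel_measurable_times borel_measurable_min dm nm borel_measurable_indicator) simp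
  have n0: "0 \<le> n t" "0 \<le> d k t" for t k by (auto simp: n_def d_def)
  have n2: "integrable lebesgue (\<lambda>t. (indicator {a..b} t * gagliardo_norm \<sigma> (w t))\<^sup>2)"
    using w_norm_L2[OF ab] by (simp add: L2f_def)
  have Bn: "(B k t)\<^sup>2 \<le> (indicator {a..b} t * gagliardo_norm \<sigma> (w t))\<^sup>2" for k t
    using ab n0 unfolding Bmin
    by (intro power_mono) (auto simp: indicator_def n_def[of t])
  have BL: "L2f lebesgue (B k)" for k
    unfolding L2f_def
    by (intro conjI Bm Bochner_Integration.integrable_bound[OF n2]) (use Bm Bn in auto)
  have "(\<lambda>k. LINT t|lebesgue. (B k t)\<^sup>2) \<longlonglongrightarrow> (LINT t|(lebesgue :: real measure). 0)"
  proof (rule integral_dominated_convergence[OF _ _ n2])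
    show "AE t in lebesgue. (\<lambda>k. (B k t)\<^sup>2) \<longlonglongrightarrow> 0"
      using s(2)
    proof eventually_elim
      case (elim t)
      show ?case
      proof (cases "t \<in> {a..b}")
        case True
        then have t: "t > 0" using ab by auto
        then have "(\<lambda>k. d k t) \<longlonglongrightarrow> 0"
          using elim by (simp add: d_def gagliardo_norm_commute[of \<sigma> "w t"])
        then have "(\<lambda>k. B k t) \<longlonglongrightarrow> indicator {a..b} t * min 0 (n t)"
          unfolding Bmin by (intro tendsto_intros)
        then have "(\<lambda>k. (B k t)\<^sup>2) \<longlonglongrightarrow> (indicator {a..b} t * min 0 (n t))\<^sup>2" by (rule tendsto_power)
        then show ?thesis using n0(1) by (simp add: min_def)
      qed (simp add: B_def)
    qed
  qed (use Bm Bn in auto)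
  then have "(\<lambda>k. (l2norm lebesgue (B k))\<^sup>2) \<longlonglongrightarrow> 0" by (simp add: l2norm_power2)
  moreover have "0 < e\<^sup>2" using e by simp
  ultimately have "\<forall>\<^sub>F k in sequentially. (l2norm lebesgue (B k))\<^sup>2 < e\<^sup>2" by (rule order_tendstoD(2))
  then have "\<exists>k. (l2norm lebesgue (B k))\<^sup>2 < e\<^sup>2" by (rule eventually_happens'[OF sequentially_bot])
  then obtain k where k: "(l2norm lebesgue (B k))\<^sup>2 < e\<^sup>2" by blast
  have "l2norm lebesgue (B k) < e" by (rule power_less_imp_less_base[OF k]) (use e in simp)
  then show ?thesis using that[OF rs[of k]] BL[of k] unfolding B_def[abs_def] by blast
qed

text \<open>A pointwise form of the continuity of translations in \<open>L^2\<close>: the error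
  splits into a contribution of each of the two times, small in mean square, and a uniform one.
  \<open>w\<close> is approximated by a step function, and the indicators of its level sets by
  continuous functions; \<open>\<alpha>\<close> collects these approximation errors,
  \<open>e\<close> absorbs the moduli of continuity, and \<open>P\<close> confines the exceptional
  times to one null set.\<close>

lemma time_regularity:
  assumes ab: "0 < a" "a < b" and e: "e > 0"
  obtains \<alpha> h0 P where "\<alpha> \<in> borel_measurable borel" "integrable lborel (\<lambda>t. (\<alpha> t)\<^sup>2)" "(LINT t|lborel. (\<alpha> t)\<^sup>2) \<le> e\<^sup>2"
    "\<And>t. 0 \<le> \<alpha> t" "h0 > 0"
    "AE t in lebesgue. t \<in> {a..b} \<longrightarrow> P t" "\<And>t. P t \<Longrightarrow> gagliardo_finite \<sigma> (w t)"
    "\<And>s t. P s \<Longrightarrow> P t \<Longrightarrow> s \<in> {a..b} \<Longrightarrow> t \<in> {a..b} \<Longrightarrow> \<bar>s - t\<bar> < h0 \<Longrightarrow>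
       gagliardo_norm \<sigma> (\<lambda>x. w s x - w t x) \<le> \<alpha> s + \<alpha> t + e"
proof -
  obtain r where r: "time_step_function \<sigma> r"
    "L2f lebesgue (\<lambda>t. indicator {a..b} t * gagliardo_norm \<sigma> (\<lambda>x. w t x - r t x))"
    "l2norm lebesgue (\<lambda>t. indicator {a..b} t * gagliardo_norm \<sigma> (\<lambda>x. w t x - r t x)) < e / 2"
    using truncated_step_approximation[OF ab, of "e/2"] e by auto
  define \<beta> where "\<beta> t = indicator {a..b} t * gagliardo_norm \<sigma> (\<lambda>x. w t x - r t x)" for t
  define Rg where "Rg = r ` {0<..}"
  have Rf: "finite Rg" using r(1) by (simp add: Rg_def time_step_function_def)
  define S where "S = (\<Sum>f\<in>Rg. gagliardo_norm \<sigma> f) + 1"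
  have S: "S > 0" "S \<ge> (\<Sum>f\<in>Rg. gagliardo_norm \<sigma> f)" by (auto simp: S_def intro!: add_nonneg_pos sum_nonneg)
  \<comment> \<open>Makes the sum of the norms of the finitely many values, multiplied by
    \<open>q\<close>, at most \<open>e / 2\<close>.\<close>
  define q where "q = e / (2 * S)"
  have q: "q > 0" using e S by (simp add: q_def)
  have Sq: "(\<Sum>f\<in>Rg. gagliardo_norm \<sigma> f * q) \<le> e / 2"
  proof -
    have "(\<Sum>f\<in>Rg. gagliardo_norm \<sigma> f * q) \<le> S * q"
      unfolding sum_distrib_right[symmetric] using S q by (intro mult_right_mono) auto
    then show ?thesis using S by (simp add: q_def)
  qed
  define A where "A f = {t \<in> {0<..}. r t = f} \<inter> {a..b}" for f
  have Am: "A f \<in> sets lebesgue" for f using r(1) by (auto simp: A_def time_step_function_def)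
  \<comment> \<open>The error is at most 2 in absolute value, so its square is at most twice its
    absolute value; an \<open>L^1\<close> error of \<open>q^2 / 2\<close> thus gives an
    \<open>L^2\<close> error of \<open>q\<close>.\<close>
  have "\<exists>c. continuous_on UNIV c \<and> (\<forall>t. \<bar>c t\<bar> \<le> 1) \<and> (LINT t|lebesgue. \<bar>indicator (A f) t - c t\<bar>) < q\<^sup>2 / 2 \<and>
    integrable lebesgue (\<lambda>t. indicator (A f) t - c t)" for f
    by (rule indicator_continuous_approximation[OF Am[of f], of a b "q\<^sup>2/2"]) (use q in \<open>auto simp: A_def\<close>)
  then obtain c where c: "\<And>f. continuous_on UNIV (c f)" "\<And>f t. \<bar>c f t\<bar> \<le> 1"
    "\<And>f. (LINT t|lebesgue. \<bar>indicator (A f) t - c f t\<bar>) < q\<^sup>2 / 2"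
    "\<And>f. integrable lebesgue (\<lambda>t. indicator (A f) t - c f t)"
    by metis
  have "\<exists>d>0. \<forall>s\<in>{a..b}. \<forall>t\<in>{a..b}. \<bar>s - t\<bar> < d \<longrightarrow> \<bar>c f s - c f t\<bar> < q" for f
  proof -
    have "uniformly_continuous_on {a..b} (c f)"
      using c(1) by (intro compact_uniformly_continuous) (auto intro: continuous_on_subset)
    then show ?thesis using q unfolding uniformly_continuous_on_def dist_real_def by (metis abs_minus_commute)
  qed
  then obtain D where D: "\<And>f. D f > 0" "\<And>f s t. s \<in> {a..b} \<Longrightarrow> t \<in> {a..b} \<Longrightarrow> \<bar>s - t\<bar> < D f \<Longrightarrow> \<bar>c f s - c f t\<bar> < q"
    by metis
  define h0 where "h0 = Min (insert 1 (D ` Rg))"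
  have h0: "h0 > 0" "\<And>f. f \<in> Rg \<Longrightarrow> h0 \<le> D f" using D Rf by (auto simp: h0_def)
  define \<gamma> where "\<gamma> f t = indicator (A f) t - c f t" for f t
  have \<gamma>1: "(\<gamma> f t)\<^sup>2 \<le> 2 * \<bar>\<gamma> f t\<bar>" for f t
  proof -
    have "\<bar>\<gamma> f t\<bar> \<le> 2" using c(2)[of f t] by (auto simp: \<gamma>_def indicator_def)
    then have "\<bar>\<gamma> f t\<bar> * \<bar>\<gamma> f t\<bar> \<le> 2 * \<bar>\<gamma> f t\<bar>" by (intro mult_right_mono) auto
    then show ?thesis by (simp add: power2_eq_square)
  qed
  have \<gamma>i: "integrable lebesgue (\<gamma> f)" for f using c(4)[of f] unfolding \<gamma>_def[abs_def] .
  have \<gamma>i2: "integrable lebesgue (\<lambda>t. 2 * \<bar>\<gamma> f t\<bar>)" for f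
    by (intro integrable_mult_right integrable_abs \<gamma>i)
  have \<gamma>m: "\<gamma> f \<in> borel_measurable lebesgue" for f by (rule borel_measurable_integrable[OF \<gamma>i])
  have \<gamma>L: "L2f lebesgue (\<gamma> f)" for f
    unfolding L2f_def
  proof (intro conjI \<gamma>m Bochner_Integration.integrable_bound[OF \<gamma>i2[of f]])
    show "(\<lambda>t. (\<gamma> f t)\<^sup>2) \<in> borel_measurable lebesgue" by (intro borel_measurable_power \<gamma>m)
    show "AE t in lebesgue. norm ((\<gamma> f t)\<^sup>2) \<le> norm (2 * \<bar>\<gamma> f t\<bar>)"
      by (rule AE_I2) (use \<gamma>1 in simp)
  qed
  have \<gamma>n: "l2norm lebesgue (\<gamma> f) \<le> q" for f
  proof (rule power2_le_imp_le)
    have "(l2norm lebesgue (\<gamma> f))\<^sup>2 \<le> (LINT t|lebesgue. 2 * \<bar>\<gamma> f t\<bar>)"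
      unfolding l2norm_power2 by (rule integral_mono[OF L2f_integrable[OF \<gamma>L] \<gamma>i2 \<gamma>1])
    also have "\<dots> = 2 * (LINT t|lebesgue. \<bar>\<gamma> f t\<bar>)" by simp
    also have "\<dots> \<le> q\<^sup>2" using c(3)[of f] unfolding \<gamma>_def by linarith
    finally show "(l2norm lebesgue (\<gamma> f))\<^sup>2 \<le> q\<^sup>2" .
  qed (use q in simp)
  define \<alpha>0 where "\<alpha>0 t = \<beta> t + (\<Sum>f\<in>Rg. gagliardo_norm \<sigma> f * \<bar>\<gamma> f t\<bar>)" for t
  have \<beta>L: "L2f lebesgue \<beta>" using r(2) by (simp add: \<beta>_def[abs_def])
  have \<alpha>L: "L2f lebesgue \<alpha>0"
    unfolding \<alpha>0_def[abs_def] by (intro L2f_add L2f_sum L2f_cmult L2f_abs \<beta>L \<gamma>L Rf)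
  have "l2norm lebesgue \<alpha>0 \<le> l2norm lebesgue \<beta> + l2norm lebesgue (\<lambda>t. \<Sum>f\<in>Rg. gagliardo_norm \<sigma> f * \<bar>\<gamma> f t\<bar>)"
    unfolding \<alpha>0_def[abs_def] by (intro l2norm_triangle L2f_sum L2f_cmult L2f_abs \<beta>L \<gamma>L Rf)
  also have "\<dots> \<le> e / 2 + (\<Sum>f\<in>Rg. l2norm lebesgue (\<lambda>t. gagliardo_norm \<sigma> f * \<bar>\<gamma> f t\<bar>))"
    using r(3) by (intro add_mono l2norm_sum L2f_cmult L2f_abs \<gamma>L Rf) (simp add: \<beta>_def[abs_def])
  also have "\<dots> \<le> e / 2 + (\<Sum>f\<in>Rg. gagliardo_norm \<sigma> f * q)"
    unfolding l2norm_cmult l2norm_abs using \<gamma>n by (intro add_left_mono sum_mono) (simp add: mult_left_mono)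
  also have "\<dots> \<le> e" using Sq by simp
  finally have \<alpha>n: "l2norm lebesgue \<alpha>0 \<le> e" .
  have \<alpha>00: "0 \<le> \<alpha>0 t" for t unfolding \<alpha>0_def \<beta>_def by (intro add_nonneg_nonneg sum_nonneg) auto
  obtain \<alpha>1 where \<alpha>1: "\<alpha>1 \<in> borel_measurable borel" "AE t in lborel. \<alpha>0 t = \<alpha>1 t"
    using borel_representative[OF L2f_measurable[OF \<alpha>L]] by blast
  define \<alpha> where "\<alpha> t = max 0 (\<alpha>1 t)" for t
  have \<alpha>m: "\<alpha> \<in> borel_measurable borel" unfolding \<alpha>_def[abs_def] using \<alpha>1(1) by measurable
  have \<alpha>eq: "AE t in lebesgue. \<alpha>0 t = \<alpha> t" using AE_completion[OF \<alpha>1(2)]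
  proof eventually_elim
    case (elim t)
    then show ?case using \<alpha>00[of t] by (simp add: \<alpha>_def)
  qed
  have \<alpha>sq: "AE t in lebesgue. (\<alpha>0 t)\<^sup>2 = (\<alpha> t)\<^sup>2" using \<alpha>eq by eventually_elim simp
  have \<alpha>m2: "(\<lambda>t. (\<alpha> t)\<^sup>2) \<in> borel_measurable borel" using \<alpha>m by measurable
  have i1: "integrable lebesgue (\<lambda>t. (\<alpha> t)\<^sup>2)"
    by (rule integrable_cong_AE_imp[OF L2f_integrable[OF \<alpha>L] _ \<alpha>sq]) (use \<alpha>m2 in \<open>simp add: measurable_completion\<close>)
  have i2: "(LINT t|lebesgue. (\<alpha> t)\<^sup>2) = (l2norm lebesgue \<alpha>0)\<^sup>2"
    unfolding l2norm_power2 by (rule integral_cong_AE[symmetric]) (use \<alpha>sq i1 L2f_integrable[OF \<alpha>L] in auto)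
  define P where "P t \<longleftrightarrow> gagliardo_finite \<sigma> (w t) \<and> \<alpha>0 t = \<alpha> t" for t
  show ?thesis
  proof (rule that[of \<alpha> h0 P])
    show "\<alpha> \<in> borel_measurable borel" by (rule \<alpha>m)
    show "integrable lborel (\<lambda>t. (\<alpha> t)\<^sup>2)" using i1 \<alpha>m2 by (subst (asm) integrable_completion) auto
    have "(LINT t|lborel. (\<alpha> t)\<^sup>2) = (LINT t|lebesgue. (\<alpha> t)\<^sup>2)" using \<alpha>m2 by (subst integral_completion) auto
    also have "\<dots> \<le> e\<^sup>2" unfolding i2 by (rule power_mono[OF \<alpha>n]) simp
    finally show "(LINT t|lborel. (\<alpha> t)\<^sup>2) \<le> e\<^sup>2" .
    show "AE t in lebesgue. t \<in> {a..b} \<longrightarrow> P t" using w_finite \<alpha>eq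
      by eventually_elim (use ab in \<open>auto simp: P_def\<close>)
    fix s t assume P: "P s" "P t" and st: "s \<in> {a..b}" "t \<in> {a..b}" "\<bar>s - t\<bar> < h0"
    have pos: "s > 0" "t > 0" using st ab by auto
    have fin: "gagliardo_finite \<sigma> (w s)" "gagliardo_finite \<sigma> (w t)" "gagliardo_finite \<sigma> (r s)" "gagliardo_finite \<sigma> (r t)"
      using P time_step_functionD[OF r(1) pos(1)] time_step_functionD[OF r(1) pos(2)] by (auto simp: P_def)
    have Rst: "r s \<in> Rg" "r t \<in> Rg" using pos by (auto simp: Rg_def)
    have "gagliardo_norm \<sigma> (\<lambda>x. r s x - r t x) \<le> (\<Sum>f\<in>Rg. gagliardo_norm \<sigma> f * \<bar>indicator (A f) s - indicator (A f) t\<bar>)"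
    proof (cases "r s = r t")
      case True
      then have "gagliardo_norm \<sigma> (\<lambda>x. r s x - r t x) = 0"
        by (simp add: gagliardo_norm_def gagliardo_quotient_def[abs_def] l2norm_def)
      then show ?thesis by (simp add: sum_nonneg)
    next
      case False
      have "gagliardo_norm \<sigma> (\<lambda>x. r s x - r t x) \<le> gagliardo_norm \<sigma> (r s) + gagliardo_norm \<sigma> (r t)"
        by (rule gagliardo_norm_triangle_diff[OF fin(3,4)])
      \<comment> \<open>As \<open>r s\<close> and \<open>r t\<close> differ, each of their two level
        sets contains exactly one of the times \<open>s\<close> and \<open>t\<close>.\<close>
      also have "\<dots> = (\<Sum>f\<in>{r s, r t}. gagliardo_norm \<sigma> f * \<bar>indicator (A f) s - indicator (A f) t\<bar>)"
        using False st pos by (simp add: A_def indicator_def)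
      also have "\<dots> \<le> (\<Sum>f\<in>Rg. gagliardo_norm \<sigma> f * \<bar>indicator (A f) s - indicator (A f) t\<bar>)"
        using Rst Rf by (intro sum_mono2) auto
      finally show ?thesis .
    qed
    also have "\<dots> \<le> (\<Sum>f\<in>Rg. gagliardo_norm \<sigma> f * (\<bar>\<gamma> f s\<bar> + \<bar>\<gamma> f t\<bar> + q))"
    proof (intro sum_mono mult_left_mono)
      fix f assume "f \<in> Rg"
      then have "\<bar>c f s - c f t\<bar> < q" using h0(2)[of f] st by (intro D) auto
      then show "\<bar>indicator (A f) s - indicator (A f) t\<bar> \<le> \<bar>\<gamma> f s\<bar> + \<bar>\<gamma> f t\<bar> + q" by (simp add: \<gamma>_def)
    qed simp
    also have "\<dots> = (\<Sum>f\<in>Rg. gagliardo_norm \<sigma> f * \<bar>\<gamma> f s\<bar>) + (\<Sum>f\<in>Rg. gagliardo_norm \<sigma> f * \<bar>\<gamma> f t\<bar>) + (\<Sum>f\<in>Rg. gagliardo_norm \<sigma> f * q)"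
      by (simp add: distrib_left sum.distrib)
    finally have rr: "gagliardo_norm \<sigma> (\<lambda>x. r s x - r t x) \<le>
       (\<Sum>f\<in>Rg. gagliardo_norm \<sigma> f * \<bar>\<gamma> f s\<bar>) + (\<Sum>f\<in>Rg. gagliardo_norm \<sigma> f * \<bar>\<gamma> f t\<bar>) + e / 2"
      using Sq by linarith
    have "gagliardo_norm \<sigma> (\<lambda>x. w s x - w t x) \<le> gagliardo_norm \<sigma> (\<lambda>x. w s x - r s x) +
        (gagliardo_norm \<sigma> (\<lambda>x. r s x - r t x) + gagliardo_norm \<sigma> (\<lambda>x. r t x - w t x))"
      using gagliardo_norm_triangle3[OF fin(1,3,2)] gagliardo_norm_triangle3[OF fin(3,4,2)] by linarith
    also have "gagliardo_norm \<sigma> (\<lambda>x. w s x - r s x) = \<beta> s" using st by (simp add: \<beta>_def)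
    also have "gagliardo_norm \<sigma> (\<lambda>x. r t x - w t x) = \<beta> t"
      using st gagliardo_norm_commute[of \<sigma> "r t" "w t"] by (simp add: \<beta>_def)
    finally have "gagliardo_norm \<sigma> (\<lambda>x. w s x - w t x) \<le> \<alpha>0 s + \<alpha>0 t + e / 2"
      using rr by (simp add: \<alpha>0_def)
    then show "gagliardo_norm \<sigma> (\<lambda>x. w s x - w t x) \<le> \<alpha> s + \<alpha> t + e" using P e by (simp add: P_def)
  qed (use h0 in \<open>auto simp: \<alpha>_def P_def\<close>)
qed

end

section \<open>The energy inequality\<close>

lemma l2norm_mono_AE:
  assumes G: "L2f M G" and F: "F \<in> borel_measurable M" and le: "AE x in M. \<bar>F x\<bar> \<le> c * \<bar>G x\<bar>" and c: "c \<ge> 0"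
  shows "L2f M F" "l2norm M F \<le> c * l2norm M G"
proof -
  have i: "integrable M (\<lambda>x. c\<^sup>2 * (G x)\<^sup>2)" using L2f_integrable[OF G] by simp
  have sq: "AE x in M. (F x)\<^sup>2 \<le> c\<^sup>2 * (G x)\<^sup>2" using le
  proof eventually_elim
    case (elim x)
    then have "\<bar>F x\<bar>\<^sup>2 \<le> (c * \<bar>G x\<bar>)\<^sup>2" by (rule power_mono) simp
    then show ?case by (simp add: power_mult_distrib)
  qed
  have F2: "(\<lambda>x. (F x)\<^sup>2) \<in> borel_measurable M" using F by (intro borel_measurable_power)
  have iF: "integrable M (\<lambda>x. (F x)\<^sup>2)"
  proof (rule Bochner_Integration.integrable_bound[OF i F2])
    show "AE x in M. norm ((F x)\<^sup>2) \<le> norm (c\<^sup>2 * (G x)\<^sup>2)" using sq by eventually_elim simp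
  qed
  then show "L2f M F" using F by (simp add: L2f_def)
  have "(l2norm M F)\<^sup>2 \<le> (LINT x|M. c\<^sup>2 * (G x)\<^sup>2)"
    unfolding l2norm_power2 by (rule integral_mono_AE[OF iF i sq])
  also have "\<dots> = (c * l2norm M G)\<^sup>2" by (simp add: power_mult_distrib l2norm_power2)
  finally show "l2norm M F \<le> c * l2norm M G" by (rule power2_le_imp_le) (use c in simp)
qed

lemma backward_quotient_tendsto:
  assumes "(Z has_real_derivative v) (at b)"
  shows "((\<lambda>h. (Z b - Z (b - h)) / h) \<longlongrightarrow> v) (at_right (0::real))"
proof -
  have "((\<lambda>h. Z (b - h)) has_real_derivative - v) (at 0)"
  proof -
    have "((\<lambda>h. b - h) has_real_derivative -1) (at 0)" by (auto intro!: derivative_eq_intros)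
    from DERIV_chain2[of Z v "\<lambda>h. b - h" 0, OF _ this] assms show ?thesis by simp
  qed
  then have "((\<lambda>h. (Z (b - (0 + h)) - Z (b - 0)) / h) \<longlongrightarrow> - v) (at 0)" unfolding DERIV_def .
  then have "((\<lambda>h. - ((Z (b - (0 + h)) - Z (b - 0)) / h)) \<longlongrightarrow> - (- v)) (at 0)" by (rule tendsto_minus)
  moreover have "- ((Z (b - (0 + h)) - Z (b - 0)) / h) = (Z b - Z (b - h)) / h" for h
    by (simp add: minus_divide_left)
  ultimately have "((\<lambda>h. (Z b - Z (b - h)) / h) \<longlongrightarrow> v) (at 0)" by simp
  then show ?thesis by (simp add: filterlim_at_split)
qed

context fractional_solution
begin

definition entropy :: "(real \<Rightarrow> real) \<Rightarrow> real \<Rightarrow> real" where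
  "entropy \<Psi> t = (LINT x|lebesgue. \<Psi> (u t x))"

text \<open>The conditions on a test function \<open>\<psi>\<close> and its entropy
  \<open>\<Psi>\<close>. The two bounds by \<open>K\<close> make \<open>\<psi>(u)\<close> integrable
  and bounded, the bound by \<open>L\<close> transfers the finite seminorm from \<open>w\<close>,
  and the last line is the subgradient inequality, used in place of differentiability of
  \<open>\<Psi>\<close>. The set \<open>I\<close> contains the values of \<open>u\<close>: the
  half-line before \<open>u\<close> is known to be bounded, an interval \<open>{0..M}\<close>
  afterwards.\<close>

context
  fixes I :: "real set" and \<psi> \<Psi> :: "real \<Rightarrow> real" and K L :: real
  assumes I: "I \<subseteq> {0..}" "0 \<in> I" and uI: "\<And>t. t \<ge> 0 \<Longrightarrow> AE x in lebesgue. u t x \<in> I"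
    and \<psi>m: "\<psi> \<in> borel_measurable borel" and \<psi>K: "\<And>r. \<bar>\<psi> r\<bar> \<le> K" and \<psi>lin: "\<And>r. r \<in> I \<Longrightarrow> \<bar>\<psi> r\<bar> \<le> K * r"
    and \<psi>L: "\<And>r r'. r \<in> I \<Longrightarrow> r' \<in> I \<Longrightarrow> \<bar>\<psi> r - \<psi> r'\<bar> \<le> L * \<bar>\<phi> r - \<phi> r'\<bar>" and L: "L \<ge> 0"
    and \<Psi>m: "\<Psi> \<in> borel_measurable borel" and \<Psi>0: "\<Psi> 0 = 0"
    and \<Psi>sub: "\<And>r r'. r \<in> I \<Longrightarrow> r' \<in> I \<Longrightarrow> \<Psi> r - \<Psi> r' \<le> \<psi> r * (r - r')"
begin

lemma u_measurable: "t \<ge> 0 \<Longrightarrow> u t \<in> borel_measurable lebesgue"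
  using u_integrable by blast

lemma \<psi>u_measurable: "t \<ge> 0 \<Longrightarrow> (\<lambda>x. \<psi> (u t x)) \<in> borel_measurable lebesgue"
  by (rule measurable_compose[OF u_measurable \<psi>m])

lemma \<psi>u_integrable:
  assumes "t \<ge> 0" shows "integrable lebesgue (\<lambda>x. \<psi> (u t x))"
proof (rule Bochner_Integration.integrable_bound[OF _ \<psi>u_measurable[OF assms]])
  show "integrable lebesgue (\<lambda>x. K * u t x)" using u_integrable[OF assms] by simp
  show "AE x in lebesgue. norm (\<psi> (u t x)) \<le> norm (K * u t x)"
    using uI[OF assms] by eventually_elim (use \<psi>lin in \<open>auto intro: order_trans[OF _ abs_ge_self]\<close>)
qed

lemma \<psi>u_finite:
  assumes t: "t \<ge> 0" and wt: "gagliardo_finite \<sigma> (w t)"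
  shows "gagliardo_finite \<sigma> (\<lambda>x. \<psi> (u t x))"
    and "gagliardo_norm \<sigma> (\<lambda>x. \<psi> (u t x)) \<le> L * gagliardo_norm \<sigma> (w t)"
proof -
  have u: "AE x in lborel. u t x \<in> I" using uI[OF t] by (simp add: AE_completion_iff)
  have le: "AE p in lebesgue. \<bar>gagliardo_quotient \<sigma> (\<lambda>x. \<psi> (u t x)) p\<bar> \<le> L * \<bar>gagliardo_quotient \<sigma> (w t) p\<bar>"
    using AE_completion[OF AE_lborel_fst[OF u]] AE_completion[OF AE_lborel_snd[OF u]]
  proof eventually_elim
    case (elim p)
    from divide_right_mono[OF \<psi>L[OF elim], of "norm (fst p - snd p) powr ((real CARD('n) + \<sigma>) / 2)"]
    show ?case by (simp add: gagliardo_quotient_def abs_divide)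
  qed
  have "L2f lebesgue (gagliardo_quotient \<sigma> (\<lambda>x. \<psi> (u t x)))"
    by (rule l2norm_mono_AE[OF gagliardo_finite_L2f[OF wt] gagliardo_quotient_measurable[OF \<psi>u_measurable[OF t]] le L])
  then show "gagliardo_finite \<sigma> (\<lambda>x. \<psi> (u t x))" using \<psi>u_measurable[OF t] by (simp add: gagliardo_finite_iff)
  show "gagliardo_norm \<sigma> (\<lambda>x. \<psi> (u t x)) \<le> L * gagliardo_norm \<sigma> (w t)"
    unfolding gagliardo_norm_def
    by (rule l2norm_mono_AE[OF gagliardo_finite_L2f[OF wt] gagliardo_quotient_measurable[OF \<psi>u_measurable[OF t]] le L])
qed

abbreviation Y :: "real \<Rightarrow> real" where "Y \<equiv> entropy \<Psi>"

text \<open>The subgradient inequality in both directions, with subgradients bounded by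
  \<open>K\<close>.\<close>

lemma \<Psi>_lipschitz:
  assumes "r \<in> I" "r' \<in> I" shows "\<bar>\<Psi> r - \<Psi> r'\<bar> \<le> K * \<bar>r - r'\<bar>"
proof -
  have "\<psi> r * (r - r') \<le> K * \<bar>r - r'\<bar>" "\<psi> r' * (r' - r) \<le> K * \<bar>r - r'\<bar>"
  proof -
    have "x * y \<le> K * \<bar>y\<bar>" if "\<bar>x\<bar> \<le> K" for x y :: real
    proof -
      have "x * y \<le> \<bar>x\<bar> * \<bar>y\<bar>" by (metis abs_ge_self abs_mult)
      also have "\<dots> \<le> K * \<bar>y\<bar>" using that by (intro mult_right_mono) auto
      finally show ?thesis .
    qed
    from this[OF \<psi>K[of r], of "r - r'"] this[OF \<psi>K[of r'], of "r' - r"]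
    show "\<psi> r * (r - r') \<le> K * \<bar>r - r'\<bar>" "\<psi> r' * (r' - r) \<le> K * \<bar>r - r'\<bar>"
      by (simp_all add: abs_minus_commute)
  qed
  then show ?thesis using \<Psi>sub[OF assms] \<Psi>sub[OF assms(2,1)] by linarith
qed

lemma \<Psi>u_integrable:
  assumes "t \<ge> 0" shows "integrable lebesgue (\<lambda>x. \<Psi> (u t x))"
proof (rule Bochner_Integration.integrable_bound)
  show "integrable lebesgue (\<lambda>x. K * u t x)" using u_integrable[OF assms] by simp
  show "(\<lambda>x. \<Psi> (u t x)) \<in> borel_measurable lebesgue" by (rule measurable_compose[OF u_measurable[OF assms] \<Psi>m])
  show "AE x in lebesgue. norm (\<Psi> (u t x)) \<le> norm (K * u t x)"
    using uI[OF assms]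
  proof eventually_elim
    case (elim x)
    have "K \<ge> 0" using \<psi>K[of 0] by linarith
    then show ?case using \<Psi>_lipschitz[OF elim I(2)] \<Psi>0 by (simp add: abs_mult)
  qed
qed

lemma Y_continuous: "continuous_on {0..} Y"
proof (rule continuous_on_L1_lipschitz)
  fix s t :: real assume st: "s \<ge> 0" "t \<ge> 0"
  have "\<bar>Y s - Y t\<bar> = \<bar>LINT x|lebesgue. \<Psi> (u s x) - \<Psi> (u t x)\<bar>"
    unfolding entropy_def using \<Psi>u_integrable st by simp
  also have "\<dots> \<le> (LINT x|lebesgue. \<bar>\<Psi> (u s x) - \<Psi> (u t x)\<bar>)" by (rule integral_abs_bound)
  also have "\<dots> \<le> (LINT x|lebesgue. K * \<bar>u s x - u t x\<bar>)"
  proof (rule integral_mono_AE)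
    show "integrable lebesgue (\<lambda>x. \<bar>\<Psi> (u s x) - \<Psi> (u t x)\<bar>)" using \<Psi>u_integrable st by simp
    show "integrable lebesgue (\<lambda>x. K * \<bar>u s x - u t x\<bar>)" using u_integrable st by simp
    show "AE x in lebesgue. \<bar>\<Psi> (u s x) - \<Psi> (u t x)\<bar> \<le> K * \<bar>u s x - u t x\<bar>"
      using uI[OF st(1)] uI[OF st(2)] by eventually_elim (rule \<Psi>_lipschitz)
  qed
  finally show "\<bar>Y s - Y t\<bar> \<le> K * (LINT x|lebesgue. \<bar>u s x - u t x\<bar>)" by simp
qed

text \<open>Convexity puts \<open>\<psi>(u t)\<close>, frozen at the later time, in front of the
  increment of \<open>u\<close>; \<open>weak_identity\<close> applies to it as a function of
  \<open>x\<close> alone.\<close>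

lemma Y_increment:
  assumes st: "0 < s" "s < t" and wt: "gagliardo_finite \<sigma> (w t)"
  shows "Y t - Y s \<le> - (LINT \<tau>|lebesgue. indicator {s<..t} \<tau> * energy_form J (w \<tau>) (\<lambda>x. \<psi> (u t x)))"
proof -
  have s0: "s \<ge> 0" and t0: "t \<ge> 0" using st by auto
  have d: "integrable lebesgue (\<lambda>x. u t x - u s x)" using u_integrable s0 t0 by simp
  have m: "(\<lambda>x. (u t x - u s x) * \<psi> (u t x)) \<in> borel_measurable lebesgue"
    by (rule borel_measurable_times[OF borel_measurable_integrable[OF d] \<psi>u_measurable[OF t0]])
  have K0: "K \<ge> 0" using \<psi>K[of 0] by linarith
  have i: "integrable lebesgue (\<lambda>x. (u t x - u s x) * \<psi> (u t x))"
  proof (rule Bochner_Integration.integrable_bound[OF _ m])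
    show "integrable lebesgue (\<lambda>x. K * (u t x - u s x))" using d by simp
    show "AE x in lebesgue. norm ((u t x - u s x) * \<psi> (u t x)) \<le> norm (K * (u t x - u s x))"
      using \<psi>K K0 by (intro AE_I2) (simp add: abs_mult mult.commute[of K] mult_left_mono)
  qed
  have "Y t - Y s = (LINT x|lebesgue. \<Psi> (u t x) - \<Psi> (u s x))"
    unfolding entropy_def using \<Psi>u_integrable s0 t0 by simp
  also have "\<dots> \<le> (LINT x|lebesgue. (u t x - u s x) * \<psi> (u t x))"
  proof (rule integral_mono_AE[OF _ i])
    show "integrable lebesgue (\<lambda>x. \<Psi> (u t x) - \<Psi> (u s x))" using \<Psi>u_integrable s0 t0 by simp
    show "AE x in lebesgue. \<Psi> (u t x) - \<Psi> (u s x) \<le> (u t x - u s x) * \<psi> (u t x)"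
      using uI[OF t0] uI[OF s0] by eventually_elim (use \<Psi>sub in \<open>simp add: mult.commute\<close>)
  qed
  also have "\<dots> = - (LINT \<tau>|lebesgue. indicator {s<..t} \<tau> * energy_form J (w \<tau>) (\<lambda>x. \<psi> (u t x)))"
    by (rule weak_identity[OF \<psi>u_measurable[OF t0] \<psi>K \<psi>u_integrable[OF t0] \<psi>u_finite(1)[OF t0 wt] st])
  finally show ?thesis .
qed

lemma energy_difference_bound:
  assumes "gagliardo_finite \<sigma> (w s)" "gagliardo_finite \<sigma> (w t)" "t \<ge> 0"
  shows "energy_form J (w t) (\<lambda>x. \<psi> (u t x)) - energy_form J (w s) (\<lambda>x. \<psi> (u t x))
    \<le> \<Lambda> * L * (gagliardo_norm \<sigma> (w t) * gagliardo_norm \<sigma> (\<lambda>x. w s x - w t x))"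
proof -
  note g = \<psi>u_finite[OF assms(3,2)]
  have "energy_form J (w t) (\<lambda>x. \<psi> (u t x)) - energy_form J (w s) (\<lambda>x. \<psi> (u t x)) =
    energy_form J (\<lambda>x. w t x - w s x) (\<lambda>x. \<psi> (u t x))"
    by (rule energy_form_diff_left[OF adm \<Lambda> assms(2,1) g(1), symmetric])
  also have "\<dots> \<le> \<Lambda> * gagliardo_norm \<sigma> (\<lambda>x. w t x - w s x) * gagliardo_norm \<sigma> (\<lambda>x. \<psi> (u t x))"
    using energy_form_bound[OF adm \<Lambda> gagliardo_finite_diff[OF assms(2,1)] g(1)] by linarith
  also have "\<dots> \<le> \<Lambda> * gagliardo_norm \<sigma> (\<lambda>x. w t x - w s x) * (L * gagliardo_norm \<sigma> (w t))"
    using \<Lambda> by (intro mult_left_mono g(2)) auto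
  finally show ?thesis using gagliardo_norm_commute[of \<sigma> "w t" "w s"] by (simp add: mult_ac)
qed

text \<open>Young's inequality with weight \<open>e\<close> bounds the product of the norm of
  \<open>w t\<close> with each of \<open>\<alpha> s\<close>, \<open>\<alpha> t\<close> and
  \<open>e\<close>. The factor \<open>1 / e\<close> falls on the squares of \<open>\<alpha>\<close>,
  whose integral is at most \<open>e^2\<close> in the application, so that every error term is of
  order \<open>e\<close> after integration over \<open>t\<close>.\<close>

lemma pointwise_increment_bound:
  assumes e: "e > 0" and h: "0 < h" "h < t"
    and \<alpha>[measurable]: "\<alpha> \<in> borel_measurable borel" "integrable lborel (\<lambda>s. (\<alpha> s)\<^sup>2)"
    and wt: "gagliardo_finite \<sigma> (w t)" and n: "n = gagliardo_norm \<sigma> (w t)"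
    and \<kappa>: "\<kappa> \<le> energy_form J (w t) (\<lambda>x. \<psi> (u t x))"
    and reg: "AE s in lebesgue. s \<in> {t - h<..t} \<longrightarrow> gagliardo_finite \<sigma> (w s) \<and>
       gagliardo_norm \<sigma> (\<lambda>x. w s x - w t x) \<le> \<alpha> s + \<alpha> t + e"
  shows "Y t - Y (t - h) \<le> - h * \<kappa> + \<Lambda> * L * h * (3/2 * e * n\<^sup>2 + e / 2 + (\<alpha> t)\<^sup>2 / (2 * e)) +
     \<Lambda> * L / (2 * e) * (LINT s|lborel. indicator {t - h<..t} s * (\<alpha> s)\<^sup>2)"
proof -
  define c1 where "c1 = \<Lambda> * L / (2 * e)"
  \<comment> \<open>The energy of \<open>w s\<close> against the test function of time
    \<open>t\<close> will be at least \<open>c0 - c1 * (\<alpha> s)^2\<close>; all dependence on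
    \<open>s\<close> sits in this square.\<close>
  define c0 where "c0 = \<kappa> - \<Lambda> * L * (3/2 * e * n\<^sup>2 + e / 2 + (\<alpha> t)\<^sup>2 / (2 * e))"
  let ?E = "\<lambda>s. energy_form J (w s) (\<lambda>x. \<psi> (u t x))"
  let ?i = "\<lambda>s. indicator {t - h<..t} s :: real"
  have t0: "t \<ge> 0" and th: "0 < t - h" "t - h < t" using h by auto
  have n0: "n \<ge> 0" by (simp add: n)
  have E: "c0 - c1 * (\<alpha> s)\<^sup>2 \<le> ?E s"
    if s: "gagliardo_finite \<sigma> (w s)" "gagliardo_norm \<sigma> (\<lambda>x. w s x - w t x) \<le> \<alpha> s + \<alpha> t + e" for s
  proof -
    have y: "n * y \<le> (e * n\<^sup>2 + y\<^sup>2 / e) / 2" for y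
    proof -
      have "0 \<le> (e * n - y)\<^sup>2" by simp
      then have "2 * e * (n * y) \<le> e * (e * n\<^sup>2) + y\<^sup>2" by (simp add: power2_diff power_mult_distrib power2_eq_square algebra_simps)
      then have "2 * (n * y) \<le> (e * (e * n\<^sup>2) + y\<^sup>2) / e" using e by (simp add: pos_le_divide_eq mult_ac)
      also have "\<dots> = e * n\<^sup>2 + y\<^sup>2 / e" using e by (simp add: add_divide_distrib)
      finally show ?thesis by simp
    qed
    have "n * gagliardo_norm \<sigma> (\<lambda>x. w s x - w t x) \<le> n * (\<alpha> s + \<alpha> t + e)"
      using s(2) n0 by (rule mult_left_mono)
    also have "\<dots> = n * \<alpha> s + n * \<alpha> t + n * e" by (simp add: algebra_simps)
    also have "\<dots> \<le> (e * n\<^sup>2 + (\<alpha> s)\<^sup>2 / e) / 2 + (e * n\<^sup>2 + (\<alpha> t)\<^sup>2 / e) / 2 + (e * n\<^sup>2 + e\<^sup>2 / e) / 2"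
      by (intro add_mono y)
    also have "\<dots> = 3/2 * e * n\<^sup>2 + e / 2 + (\<alpha> t)\<^sup>2 / (2 * e) + (\<alpha> s)\<^sup>2 / (2 * e)"
      using e by (simp add: field_simps power2_eq_square)
    finally have "\<Lambda> * L * (n * gagliardo_norm \<sigma> (\<lambda>x. w s x - w t x)) \<le>
       \<Lambda> * L * (3/2 * e * n\<^sup>2 + e / 2 + (\<alpha> t)\<^sup>2 / (2 * e) + (\<alpha> s)\<^sup>2 / (2 * e))"
      using \<Lambda> L by (intro mult_left_mono) auto
    moreover have "\<kappa> - ?E s \<le> \<Lambda> * L * (n * gagliardo_norm \<sigma> (\<lambda>x. w s x - w t x))"
      using energy_difference_bound[OF s(1) wt t0] \<kappa> by (simp add: n)
    moreover have "\<Lambda> * L * (3/2 * e * n\<^sup>2 + e / 2 + (\<alpha> t)\<^sup>2 / (2 * e) + (\<alpha> s)\<^sup>2 / (2 * e)) = \<kappa> - c0 + c1 * (\<alpha> s)\<^sup>2"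
      by (simp add: c0_def c1_def distrib_left)
    ultimately show ?thesis by linarith
  qed
  have i1: "integrable lborel ?i" using h by (intro integrable_real_indicator) auto
  have i2: "integrable lborel (\<lambda>s. ?i s * (\<alpha> s)\<^sup>2)"
    by (rule Bochner_Integration.integrable_bound[OF \<alpha>(2)]) (auto simp: indicator_def)
  have i3: "integrable lborel (\<lambda>s. c0 * ?i s - c1 * (?i s * (\<alpha> s)\<^sup>2))"
    by (intro Bochner_Integration.integrable_diff integrable_mult_right i1 i2)
  have m3: "(\<lambda>s. c0 * ?i s - c1 * (?i s * (\<alpha> s)\<^sup>2)) \<in> borel_measurable lborel" using i3 by auto
  have Eint: "integrable lebesgue (\<lambda>s. ?i s * ?E s)"
  proof (rule Bochner_Integration.integrable_bound)
    note ei = energy_integrable[OF \<psi>u_finite(1)[OF t0 wt] th]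
    show "integrable lebesgue (\<lambda>s. indicator {t - h..t} s * ?E s)" by (rule ei)
    have "(\<lambda>s. ?i s * ?E s) = (\<lambda>s. ?i s * (indicator {t - h..t} s * ?E s))"
      by (auto simp: fun_eq_iff indicator_def)
    also have "\<dots> \<in> borel_measurable lebesgue"
      by (rule borel_measurable_times[OF borel_measurable_indicator borel_measurable_integrable[OF ei]]) simp
    finally show "(\<lambda>s. ?i s * ?E s) \<in> borel_measurable lebesgue" .
    show "AE s in lebesgue. norm (?i s * ?E s) \<le> norm (indicator {t - h..t} s * ?E s)"
      by (rule AE_I2) (auto simp: indicator_def)
  qed
  have "(LINT s|lborel. c0 * ?i s - c1 * (?i s * (\<alpha> s)\<^sup>2)) = (LINT s|lebesgue. c0 * ?i s - c1 * (?i s * (\<alpha> s)\<^sup>2))"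
    by (rule integral_completion[symmetric, OF m3])
  also have "\<dots> \<le> (LINT s|lebesgue. ?i s * ?E s)"
  proof (rule integral_mono_AE[OF _ Eint])
    show "integrable lebesgue (\<lambda>s. c0 * ?i s - c1 * (?i s * (\<alpha> s)\<^sup>2))"
      using i3 m3 by (subst integrable_completion) auto
    show "AE s in lebesgue. c0 * ?i s - c1 * (?i s * (\<alpha> s)\<^sup>2) \<le> ?i s * ?E s"
      using reg
    proof eventually_elim
      case (elim s)
      then show ?case using E[of s] by (cases "s \<in> {t - h<..t}") auto
    qed
  qed
  also have "\<dots> \<le> Y (t - h) - Y t" using Y_increment[OF th wt] by linarith
  finally have "Y t - Y (t - h) \<le> - (LINT s|lborel. c0 * ?i s - c1 * (?i s * (\<alpha> s)\<^sup>2))" by linarith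
  also have "(LINT s|lborel. c0 * ?i s - c1 * (?i s * (\<alpha> s)\<^sup>2)) = c0 * h - c1 * (LINT s|lborel. ?i s * (\<alpha> s)\<^sup>2)"
    using i1 i2 h by simp
  finally show ?thesis by (simp add: c0_def c1_def algebra_simps)
qed

text \<open>The entropy, continued to negative times by its initial value so as to be continuous on
  the whole line.\<close>

definition V :: "real \<Rightarrow> real" where "V t = Y (max 0 t)"

lemma V_continuous: "continuous_on UNIV V"
  unfolding V_def by (rule continuous_on_compose2[OF Y_continuous]) (auto intro!: continuous_intros)

text \<open>When the pointwise bound is integrated over \<open>t\<close>,
  \<open>window_integral\<close> turns the window integral of \<open>(\<alpha> s)^2\<close> into
  \<open>h\<close> times the full one. The constant \<open>C\<close> depends on neither
  \<open>e\<close> nor \<open>h\<close>, which permits the limits \<open>h \<rightarrow> 0\<close>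
  and then \<open>e \<rightarrow> 0\<close>.\<close>

lemma averaged_increment_bound:
  assumes ab: "0 < a" "a < b"
    and \<kappa>: "AE t in lebesgue. t \<in> {a..b} \<longrightarrow> \<kappa> \<le> energy_form J (w t) (\<lambda>x. \<psi> (u t x))"
  obtains C where "\<And>e. e > 0 \<Longrightarrow> \<exists>h1>0. \<forall>h. 0 < h \<and> h < h1 \<longrightarrow>
     (LINT t|lborel. (V t - V (t - h)) * indicator {a..b} t) \<le> h * (- \<kappa> * (b - a) + e * C)"
proof -
  \<comment> \<open>The interval starts at \<open>a/2\<close> because the windows
    \<open>{t - h<..t}\<close> reach back beyond \<open>a\<close>.\<close>
  let ?n = "\<lambda>t. indicator {a/2..b} t * gagliardo_norm \<sigma> (w t)"
  have nL: "L2f lebesgue ?n" using w_norm_L2[of "a/2" b] ab by auto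
  obtain n where n[measurable]: "n \<in> borel_measurable borel" "AE t in lborel. ?n t = n t"
    using borel_representative[OF L2f_measurable[OF nL]] by blast
  have n2m: "(\<lambda>t. (n t)\<^sup>2) \<in> borel_measurable lborel" by measurable
  have "integrable lebesgue (\<lambda>t. (n t)\<^sup>2)"
  proof (rule integrable_cong_AE_imp[OF L2f_integrable[OF nL]])
    show "(\<lambda>t. (n t)\<^sup>2) \<in> borel_measurable lebesgue" using n2m by (rule measurable_completion)
    show "AE t in lebesgue. (?n t)\<^sup>2 = (n t)\<^sup>2" using AE_completion[OF n(2)] by eventually_elim simp
  qed
  then have n2i: "integrable lborel (\<lambda>t. (n t)\<^sup>2)" using n2m by (subst (asm) integrable_completion) auto
  define B where "B = (LINT t|lborel. (n t)\<^sup>2)"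
  \<comment> \<open>The terms stem from the weight of the squared norm of \<open>w\<close>, from
    \<open>e / 2\<close> over an interval of length \<open>b - a\<close>, and from the squares of
    \<open>\<alpha>\<close> at \<open>t\<close> and in the window, one half each.\<close>
  define C where "C = \<Lambda> * L * (3/2 * B + (b - a) / 2 + 1)"
  show ?thesis
  proof (rule that[of C])
    fix e :: real assume e: "e > 0"
    have a2: "0 < a/2" "a/2 < b" using ab by auto
    show "\<exists>h1>0. \<forall>h. 0 < h \<and> h < h1 \<longrightarrow>
     (LINT t|lborel. (V t - V (t - h)) * indicator {a..b} t) \<le> h * (- \<kappa> * (b - a) + e * C)"
    proof (rule time_regularity[OF a2 e])
      fix \<alpha> h0 P
      assume \<alpha>[measurable]: "\<alpha> \<in> borel_measurable borel" and \<alpha>i: "integrable lborel (\<lambda>t. (\<alpha> t)\<^sup>2)"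
        and \<alpha>e: "(LINT t|lborel. (\<alpha> t)\<^sup>2) \<le> e\<^sup>2" and h0: "h0 > 0"
        and P: "AE t in lebesgue. t \<in> {a/2..b} \<longrightarrow> P t" "\<And>t. P t \<Longrightarrow> gagliardo_finite \<sigma> (w t)"
        "\<And>s t. P s \<Longrightarrow> P t \<Longrightarrow> s \<in> {a/2..b} \<Longrightarrow> t \<in> {a/2..b} \<Longrightarrow> \<bar>s - t\<bar> < h0 \<Longrightarrow>
         gagliardo_norm \<sigma> (\<lambda>x. w s x - w t x) \<le> \<alpha> s + \<alpha> t + e"
      show "\<exists>h1>0. \<forall>h. 0 < h \<and> h < h1 \<longrightarrow>
       (LINT t|lborel. (V t - V (t - h)) * indicator {a..b} t) \<le> h * (- \<kappa> * (b - a) + e * C)"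
      proof (intro exI[of _ "min h0 (a/2)"] conjI allI impI)
        show "0 < min h0 (a/2)" using h0 ab by simp
        fix h assume h: "0 < h \<and> h < min h0 (a/2)"
        let ?F = "\<lambda>t. LINT s|lborel. indicator {t - h<..t} s * (\<alpha> s)\<^sup>2"
        define c1 where "c1 = \<Lambda> * L / (2 * e)"
        define c2 where "c2 = \<Lambda> * L * h"
        have c: "c1 \<ge> 0" "c2 \<ge> 0" using \<Lambda> L e h by (auto simp: c1_def c2_def)
        have Fi: "integrable lborel ?F" and FI: "(LINT t|lborel. ?F t) = h * (LINT s|lborel. (\<alpha> s)\<^sup>2)"
          using h by (intro window_integral; simp add: \<alpha>i)+
        define R where "R t = (- h * \<kappa> + c2 * e / 2) * indicator {a..b} t + c2 * (3/2 * e) * (n t)\<^sup>2 +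
           c2 / (2 * e) * (\<alpha> t)\<^sup>2 + c1 * ?F t" for t
        have ind: "integrable lborel (indicator {a..b} :: real \<Rightarrow> real)"
          by (intro integrable_real_indicator) (auto simp: emeasure_lborel_Icc_eq)
        have Ri: "integrable lborel R"
          unfolding R_def[abs_def] by (intro Bochner_Integration.integrable_add integrable_mult_right ind n2i \<alpha>i Fi)
        have "(LINT t|lborel. (V t - V (t - h)) * indicator {a..b} t) \<le> (LINT t|lborel. R t)"
        proof (rule integral_mono_AE[OF _ Ri])
          have "continuous_on {a..b} (\<lambda>t. V t - V (t - h))"
            by (intro continuous_intros continuous_on_compose2[OF V_continuous]) auto
          from borel_integrable_compact[OF compact_Icc this]
          show "integrable lborel (\<lambda>t. (V t - V (t - h)) * indicator {a..b} t)"
            by (simp add: indicator_def if_distrib mult.commute cong: if_cong)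
          have "AE t in lebesgue. (V t - V (t - h)) * indicator {a..b} t \<le> R t"
            using P(1) \<kappa> AE_completion[OF n(2)]
          proof eventually_elim
            case (elim t)
            have F0: "0 \<le> ?F t" by (intro integral_nonneg_AE AE_I2) simp
            show ?case
            proof (cases "t \<in> {a..b}")
              case True
              then have t: "P t" "t \<in> {a/2..b}" "t > 0" "h < t" "t - h > 0" using elim ab h by auto
              have nt: "n t = gagliardo_norm \<sigma> (w t)" using elim(3) t by simp
              have reg: "AE s in lebesgue. s \<in> {t - h<..t} \<longrightarrow> gagliardo_finite \<sigma> (w s) \<and>
                 gagliardo_norm \<sigma> (\<lambda>x. w s x - w t x) \<le> \<alpha> s + \<alpha> t + e"
                using P(1)
              proof eventually_elim
                case (elim s)
                show ?case
                proof
                  assume s: "s \<in> {t - h<..t}"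
                  then have "s \<in> {a/2..b}" "\<bar>s - t\<bar> < h0" using True h ab by auto
                  then show "gagliardo_finite \<sigma> (w s) \<and> gagliardo_norm \<sigma> (\<lambda>x. w s x - w t x) \<le> \<alpha> s + \<alpha> t + e"
                    using elim P(2,3) t by blast
                qed
              qed
              have "Y t - Y (t - h) \<le> - h * \<kappa> + \<Lambda> * L * h * (3/2 * e * (n t)\<^sup>2 + e / 2 + (\<alpha> t)\<^sup>2 / (2 * e)) + \<Lambda> * L / (2 * e) * ?F t"
                by (rule pointwise_increment_bound[OF e _ t(4) \<alpha> \<alpha>i P(2)[OF t(1)] nt _ reg])
                  (use elim(2) True h in auto)
              also have "\<dots> = R t" using True by (simp add: R_def c1_def c2_def algebra_simps)
              finally show ?thesis using True t by (simp add: V_def)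
            next
              case False
              then have z: "indicator {a..b} t = (0 :: real)" by simp
              have "0 \<le> R t" using c e F0 unfolding R_def z mult_zero_right add_0_left
                by (intro add_nonneg_nonneg mult_nonneg_nonneg) auto
              then show ?thesis using False by simp
            qed
          qed
          then show "AE t in lborel. (V t - V (t - h)) * indicator {a..b} t \<le> R t"
            by (simp add: AE_completion_iff)
        qed
        also have "(LINT t|lborel. R t) = (- h * \<kappa> + c2 * e / 2) * (b - a) + c2 * (3/2 * e) * B +
           c2 / (2 * e) * (LINT t|lborel. (\<alpha> t)\<^sup>2) + c1 * (h * (LINT s|lborel. (\<alpha> s)\<^sup>2))"
          unfolding R_def[abs_def] using ind n2i \<alpha>i Fi ab by (simp add: B_def FI)
        also have "\<dots> \<le> (- h * \<kappa> + c2 * e / 2) * (b - a) + c2 * (3/2 * e) * B + c2 / (2 * e) * e\<^sup>2 + c1 * (h * e\<^sup>2)"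
          using c e h \<alpha>e by (intro add_mono order_refl mult_left_mono) auto
        also have "\<dots> = h * (- \<kappa> * (b - a) + e * C)"
          using e by (simp add: c1_def c2_def C_def field_simps power2_eq_square)
        finally show "(LINT t|lborel. (V t - V (t - h)) * indicator {a..b} t) \<le> h * (- \<kappa> * (b - a) + e * C)" .
      qed
    qed
  qed
qed

text \<open>With an antiderivative \<open>Z\<close> of \<open>V\<close>, the integrated increments
  equal the integral of \<open>V\<close> over \<open>(b - h, b)\<close> minus that over
  \<open>(a - h, a)\<close>; divided by \<open>h\<close> they tend to \<open>V b - V a\<close>. The
  entropy itself is never differentiated.\<close>

lemma energy_inequality_pos:
  assumes ab: "0 < a" "a < b"
    and \<kappa>: "AE t in lebesgue. t \<in> {a..b} \<longrightarrow> \<kappa> \<le> energy_form J (w t) (\<lambda>x. \<psi> (u t x))"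
  shows "Y b + \<kappa> * (b - a) \<le> Y a"
proof -
  obtain C where C: "\<And>e. e > 0 \<Longrightarrow> \<exists>h1>0. \<forall>h. 0 < h \<and> h < h1 \<longrightarrow>
     (LINT t|lborel. (V t - V (t - h)) * indicator {a..b} t) \<le> h * (- \<kappa> * (b - a) + e * C)"
    using averaged_increment_bound[OF ab \<kappa>] by blast
  have Vc: "isCont V t" for t using V_continuous by (simp add: continuous_on_eq_continuous_at)
  obtain Z where Z0: "\<And>t. t \<in> {0..b+1} \<Longrightarrow> (Z has_vector_derivative V t) (at t within {0..b+1})"
    using antiderivative_continuous[of 0 "b+1" V] V_continuous continuous_on_subset by blast
  have Z: "(Z has_real_derivative V t) (at t)" if "0 < t" "t < b + 1" for t
    using Z0[of t] that by (simp add: at_within_Icc_at has_real_derivative_iff_has_vector_derivative)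
  have eq: "(LINT t|lborel. (V t - V (t - h)) * indicator {a..b} t) = (Z b - Z (b - h)) - (Z a - Z (a - h))"
    if h: "0 < h" "h < a" for h
  proof -
    have "(LINT t|lborel. (V t - V (t - h)) * indicator {a..b} t) = (Z b - Z (b - h)) - (Z a - Z (a - h))"
    proof (rule integral_FTC_Icc_real[where F="\<lambda>t. Z t - Z (t - h)"])
      show "a \<le> b" using ab by simp
      fix t assume t: "a \<le> t" "t \<le> b"
      have "((\<lambda>t. Z (t - h)) has_real_derivative V (t - h) * 1) (at t)"
      proof (rule DERIV_chain2[of Z])
        show "(Z has_real_derivative V (t - h)) (at (t - h))" using t h by (intro Z) auto
        show "((\<lambda>t. t - h) has_real_derivative 1) (at t)" by (auto intro!: derivative_eq_intros)
      qed
      moreover have "(Z has_real_derivative V t) (at t)" using t ab by (intro Z) auto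
      ultimately show "((\<lambda>t. Z t - Z (t - h)) has_real_derivative V t - V (t - h)) (at t)"
        using DERIV_diff by fastforce
      show "isCont (\<lambda>t. V t - V (t - h)) t"
        by (intro continuous_intros Vc isCont_o2[where g=V])
    qed
    then show ?thesis .
  qed
  have lim: "((\<lambda>h. (Z b - Z (b - h)) / h - (Z a - Z (a - h)) / h) \<longlongrightarrow> V b - V a) (at_right 0)"
    using ab by (intro tendsto_diff backward_quotient_tendsto Z) auto
  have bound: "V b - V a \<le> - \<kappa> * (b - a) + e * C" if e: "e > 0" for e
  proof (rule tendsto_upperbound[OF lim])
    obtain h1 where h1: "h1 > 0" "\<And>h. 0 < h \<Longrightarrow> h < h1 \<Longrightarrow>
       (LINT t|lborel. (V t - V (t - h)) * indicator {a..b} t) \<le> h * (- \<kappa> * (b - a) + e * C)"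
      using C[OF e] by blast
    have "\<forall>\<^sub>F h in at_right 0. h \<in> {0<..<min h1 a}"
      using h1(1) ab by (intro eventually_at_right_real) auto
    then show "\<forall>\<^sub>F h in at_right 0. (Z b - Z (b - h)) / h - (Z a - Z (a - h)) / h \<le> - \<kappa> * (b - a) + e * C"
    proof eventually_elim
      case (elim h)
      then have "(Z b - Z (b - h)) - (Z a - Z (a - h)) \<le> h * (- \<kappa> * (b - a) + e * C)"
        using h1(2)[of h] eq[of h] by auto
      then have "((Z b - Z (b - h)) - (Z a - Z (a - h))) / h \<le> - \<kappa> * (b - a) + e * C"
        using elim by (simp add: pos_divide_le_eq mult.commute)
      then show ?case by (simp add: diff_divide_distrib)
    qed
  qed simp
  have "V b - V a \<le> - \<kappa> * (b - a)"
  proof (rule field_le_epsilon)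
    fix d :: real assume d: "d > 0"
    have p: "\<bar>C\<bar> + 1 > 0" by simp
    have "V b - V a \<le> - \<kappa> * (b - a) + d / (\<bar>C\<bar> + 1) * C" using d p by (intro bound) simp
    moreover have "d / (\<bar>C\<bar> + 1) * C \<le> d"
    proof -
      have "d * C \<le> d * (\<bar>C\<bar> + 1)" using d by (intro mult_left_mono) auto
      then show ?thesis using p by (simp add: pos_divide_le_eq)
    qed
    ultimately show "V b - V a \<le> - \<kappa> * (b - a) + d" by linarith
  qed
  then show ?thesis using ab by (simp add: V_def)
qed

text \<open>Continuity of the entropy down to time 0 closes the gap left by the local integrability
  in time, which says nothing near 0.\<close>

lemma energy_inequality:
  assumes ab: "0 \<le> a" "a < b"
    and \<kappa>: "AE t in lebesgue. t \<in> {a..b} \<longrightarrow> \<kappa> \<le> energy_form J (w t) (\<lambda>x. \<psi> (u t x))"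
  shows "Y b + \<kappa> * (b - a) \<le> Y a"
proof (rule tendsto_le[OF trivial_limit_at_right_real])
  show "(V \<longlongrightarrow> Y a) (at_right a)"
  proof -
    have "(V \<longlongrightarrow> V a) (at a)" using V_continuous by (simp add: continuous_on_eq_continuous_at isCont_def)
    moreover have "V a = Y a" using ab by (simp add: V_def)
    ultimately show ?thesis by (simp add: filterlim_at_split)
  qed
  show "((\<lambda>t. Y b + \<kappa> * (b - t)) \<longlongrightarrow> Y b + \<kappa> * (b - a)) (at_right a)" by (intro tendsto_intros)
  have "\<forall>\<^sub>F t in at_right a. t \<in> {a<..<b}" using ab(2) by (rule eventually_at_right_real)
  then show "\<forall>\<^sub>F t in at_right a. Y b + \<kappa> * (b - t) \<le> V t"
  proof eventually_elim
    case (elim t)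
    have "AE s in lebesgue. s \<in> {t..b} \<longrightarrow> \<kappa> \<le> energy_form J (w s) (\<lambda>x. \<psi> (u s x))"
      using \<kappa> by eventually_elim (use elim in auto)
    from energy_inequality_pos[OF _ _ this] show ?case using elim ab by (simp add: V_def)
  qed
qed

end

end

section \<open>Boundedness\<close>

text \<open>\<open>q\<close> is Chebyshev's bound for the measure of the set where \<open>v\<close>
  exceeds \<open>s / 2\<close>, and \<open>r\<close> is the radius of a ball of measure
  \<open>2 * q\<close>.\<close>

lemma ball_superlevel_volume:
  fixes v :: "'a::euclidean_space \<Rightarrow> real"
  assumes v[measurable]: "v \<in> borel_measurable borel" and v0: "\<And>y. 0 \<le> v y"
    and Z: "(\<integral>\<^sup>+ y. ennreal (v y powr p) \<partial>lborel) \<le> ennreal Z" and Z0: "Z > 0" and s: "s > 0" and p: "p > 0"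
    and q: "q = (2 / s) powr p * Z"
    and r: "r = (2 * q / unit_ball_vol (real DIM('a))) powr (1 / real DIM('a))"
  shows "ennreal q \<le> emeasure lborel (ball x r \<inter> {y. v y \<le> s / 2})"
proof -
  let ?w = "unit_ball_vol (real DIM('a))"
  have w: "?w > 0" by simp
  have q0: "q > 0" using s Z0 by (simp add: q)
  have X: "2 * q / ?w > 0" by (intro divide_pos_pos mult_pos_pos q0 w) simp
  then have r0: "r > 0" unfolding r by (metis powr_gt_zero less_irrefl)
  have e: "1 / real DIM('a) * real DIM('a) = 1" by simp
  have "r ^ DIM('a) = r powr real DIM('a)" by (rule powr_realpow[OF r0, symmetric])
  also have "\<dots> = 2 * q / ?w" unfolding r powr_powr e by (rule powr_one[OF less_imp_le[OF X]])
  finally have "r ^ DIM('a) = 2 * q / ?w" .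
  then have ball: "emeasure lborel (ball x r) = ennreal (2 * q)"
    using w r0 by (subst emeasure_ball) (auto dest: less_imp_neq)
  have "ennreal ((s / 2) powr p) * emeasure lborel {y. v y > s / 2} = (\<integral>\<^sup>+ y. ennreal ((s / 2) powr p) * indicator {y. v y > s / 2} y \<partial>lborel)"
    by (rule nn_integral_cmult_indicator[symmetric]) measurable
  also have "\<dots> \<le> (\<integral>\<^sup>+ y. ennreal (v y powr p) \<partial>lborel)"
    using s p by (intro nn_integral_mono) (auto simp: indicator_def intro!: ennreal_leI powr_mono2)
  also have "\<dots> \<le> ennreal Z" by (rule Z)
  finally have "ennreal ((2 / s) powr p) * (ennreal ((s / 2) powr p) * emeasure lborel {y. v y > s / 2}) \<le> ennreal ((2 / s) powr p) * ennreal Z"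
    by (rule mult_left_mono) simp
  moreover have "ennreal ((2 / s) powr p) * ennreal ((s / 2) powr p) = 1"
    using s by (simp flip: ennreal_mult powr_mult)
  ultimately have sup: "emeasure lborel {y. v y > s / 2} \<le> ennreal q"
    using Z0 by (simp add: q ennreal_mult flip: mult.assoc)
  have "ennreal q + ennreal q = emeasure lborel (ball x r)" using q0 by (simp add: ball flip: ennreal_plus)
  also have "\<dots> \<le> emeasure lborel ((ball x r \<inter> {y. v y \<le> s / 2}) \<union> {y. v y > s / 2})"
    by (intro emeasure_mono) auto
  also have "\<dots> \<le> emeasure lborel (ball x r \<inter> {y. v y \<le> s / 2}) + emeasure lborel {y. v y > s / 2}"
    by (rule emeasure_subadditive) auto
  also have "\<dots> \<le> emeasure lborel (ball x r \<inter> {y. v y \<le> s / 2}) + ennreal q"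
    by (intro add_mono order_refl sup)
  finally show ?thesis by (simp add: ennreal_add_left_cancel_le add.commute)
qed

text \<open>The sign condition makes the energy an integral of a nonnegative function, so that a
  pointwise minorant \<open>H\<close> can be integrated without an integrability proof of its
  own.\<close>

lemma energy_form_lower_bound:
  fixes J :: "real^'n \<Rightarrow> real^'n \<Rightarrow> real"
  assumes adm: "admissible_kernel \<sigma> \<Lambda> J" and \<Lambda>: "\<Lambda> > 0"
    and f: "gagliardo_finite \<sigma> f" and g: "gagliardo_finite \<sigma> g"
    and nn: "AE p in lborel. 0 \<le> (f (fst p) - f (snd p)) * (g (fst p) - g (snd p)) * J (fst p) (snd p)"
    and H: "AE p in lborel. H p \<le> ennreal ((f (fst p) - f (snd p)) * (g (fst p) - g (snd p)) * J (fst p) (snd p))"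
  shows "(\<integral>\<^sup>+ p. H p \<partial>lborel) \<le> ennreal (2 * energy_form J f g)"
proof -
  let ?h = "\<lambda>p. (f (fst p) - f (snd p)) * (g (fst p) - g (snd p)) * J (fst p) (snd p)"
  have i: "integrable lebesgue ?h"
    using energy_form_integrable[OF adm \<Lambda> f g] unfolding energy_integrand_eq[where \<sigma>=\<sigma>] .
  have "(\<integral>\<^sup>+ p. H p \<partial>lborel) = (\<integral>\<^sup>+ p. H p \<partial>lebesgue)" by (simp add: nn_integral_completion)
  also have "\<dots> \<le> (\<integral>\<^sup>+ p. ennreal (?h p) \<partial>lebesgue)"
    by (rule nn_integral_mono_AE[OF AE_completion[OF H]])
  also have "\<dots> = ennreal (LINT p|lebesgue. ?h p)"
    by (rule nn_integral_eq_integral[OF i AE_completion[OF nn]])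
  finally show ?thesis by (simp add: energy_form_def)
qed

locale extinction_problem = fractional_solution \<sigma> \<Lambda> J \<phi> u0 u
  for \<sigma> \<Lambda> and J :: "real^'n \<Rightarrow> real^'n \<Rightarrow> real" and \<phi> u0 u +
  fixes m c :: real
  assumes nonlin: "nonlinearity \<phi>" and m: "0 < m" "m < max (real CARD('n) - \<sigma>) 0 / real CARD('n)"
    and u_nonneg: "\<And>t. t \<ge> 0 \<Longrightarrow> AE x in lebesgue. u t x \<ge> 0"
    and c: "c > 0" and \<phi>': "\<And>s. s > 0 \<Longrightarrow> deriv \<phi> s \<ge> c * s powr (m - 1)"
    and u0_bounded: "\<exists>M. AE x in lebesgue. \<bar>u0 x\<bar> \<le> M"
begin

text \<open>The solution of \<open>m + p - 1 + p \<sigma> / N = p\<close>, which makes the lower bound of the energy homogeneous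
  in \<open>\<integral>u\<^sup>p\<close>.\<close>

definition p :: real where "p = real CARD('n) * (1 - m) / \<sigma>"

text \<open>A positive \<open>m\<close> below the bound forces \<open>\<sigma> < N\<close>, and
  \<open>m < (N - \<sigma>) / N\<close> is the same as \<open>\<sigma> < N (1 - m)\<close>, that is,
  \<open>p > 1\<close>.\<close>

lemma m_less_1: "m < 1" and \<sigma>_less: "\<sigma> < real CARD('n)" and p_gt_1: "p > 1"
proof -
  let ?N = "real CARD('n)"
  have N: "?N > 0" by simp
  have "0 < max (?N - \<sigma>) 0 / ?N" using m by linarith
  then have "0 < max (?N - \<sigma>) 0" using N by (simp add: zero_less_divide_iff)
  then show *: "\<sigma> < ?N" by auto
  then have "m < (?N - \<sigma>) / ?N" using m by simp
  then have "m * ?N < ?N - \<sigma>" using N by (simp add: pos_less_divide_eq)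
  then have 1: "\<sigma> < ?N * (1 - m)" by (simp add: algebra_simps)
  then show "p > 1" using \<sigma> by (simp add: p_def)
  show "m < 1"
  proof (rule ccontr)
    assume "\<not> m < 1"
    then have "?N * (1 - m) \<le> 0" using N by (intro mult_nonneg_nonpos) auto
    then show False using 1 \<sigma> by linarith
  qed
qed

lemma p_eq: "p * (\<sigma> / real CARD('n)) = 1 - m"
  using \<sigma> by (simp add: p_def)

section \<open>Comparison of increments with those of \<phi>\<close>

lemma \<phi>_deriv: "s > 0 \<Longrightarrow> (\<phi> has_real_derivative deriv \<phi> s) (at s)"
  using nonlin by (simp add: nonlinearity_def DERIV_deriv_iff_real_differentiable)

lemma \<phi>_mono: "0 \<le> r \<Longrightarrow> r \<le> s \<Longrightarrow> \<phi> r \<le> \<phi> s"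
  using nonlin strict_mono_on_leD[of "{0..}" \<phi> r s] by (auto simp: nonlinearity_def)

text \<open>\<open>C \<phi> - f\<close> is nondecreasing on the interval. This serves two purposes:
  to bound increments of test functions by those of \<open>\<phi>\<close>, and to bound increments
  of \<open>\<phi>\<close> from below by those of a power.\<close>

lemma increment_le_\<phi>:
  assumes b: "0 < b" "b \<le> a"
    and f: "\<And>s. b \<le> s \<Longrightarrow> s \<le> a \<Longrightarrow> (f has_real_derivative f' s) (at s)"
    and le: "\<And>s. b \<le> s \<Longrightarrow> s \<le> a \<Longrightarrow> f' s \<le> C * deriv \<phi> s"
  shows "f a - f b \<le> C * (\<phi> a - \<phi> b)"
proof -
  have "C * \<phi> b - f b \<le> C * \<phi> a - f a"
  proof (rule DERIV_nonneg_imp_nondecreasing[OF b(2)])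
    fix s assume s: "b \<le> s" "s \<le> a"
    have "((\<lambda>s. C * \<phi> s - f s) has_real_derivative C * deriv \<phi> s - f' s) (at s)"
      by (intro DERIV_diff DERIV_cmult \<phi>_deriv f) (use s b in auto)
    then show "\<exists>y. ((\<lambda>s. C * \<phi> s - f s) has_real_derivative y) (at s) \<and> 0 \<le> y"
      using le[OF s] by fastforce
  qed
  then show ?thesis by (simp add: right_diff_distrib)
qed

text \<open>Clamping can only shrink the interval between the two arguments, while
  \<open>\<phi>\<close> keeps its full increment by monotonicity. Derivatives are compared on
  \<open>[lo, hi]\<close> only, hence away from 0, where \<open>\<phi>\<close> need not be
  differentiable.\<close>

lemma clamped_lipschitz_\<phi>:
  assumes lo: "0 < lo" "lo \<le> hi"
    and f: "\<And>s. lo \<le> s \<Longrightarrow> s \<le> hi \<Longrightarrow> (f has_real_derivative f' s) (at s)"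
    and le: "\<And>s. lo \<le> s \<Longrightarrow> s \<le> hi \<Longrightarrow> 0 \<le> f' s \<and> f' s \<le> L * deriv \<phi> s" and L: "L \<ge> 0"
    and r: "0 \<le> r" "0 \<le> r'"
  shows "\<bar>f (max lo (min hi r)) - f (max lo (min hi r'))\<bar> \<le> L * \<bar>\<phi> r - \<phi> r'\<bar>"
proof -
  have *: "\<bar>f (max lo (min hi r)) - f (max lo (min hi r'))\<bar> \<le> L * \<bar>\<phi> r - \<phi> r'\<bar>"
    if r: "0 \<le> r'" "r' \<le> r" for r r'
  proof (cases "max lo (min hi r) = max lo (min hi r')")
    case False
    define a b where "a = max lo (min hi r)" and "b = max lo (min hi r')"
    have ab: "b \<le> a" "lo \<le> b" "a \<le> hi" "0 < b" using r lo by (auto simp: a_def b_def)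
    have "a \<le> r" "r' \<le> b" using False r lo by (auto simp: a_def b_def max_def min_def split: if_splits)
    then have "\<phi> a \<le> \<phi> r" "\<phi> r' \<le> \<phi> b" "\<phi> r' \<le> \<phi> r" using ab r by (auto intro!: \<phi>_mono)
    then have 1: "L * (\<phi> a - \<phi> b) \<le> L * \<bar>\<phi> r - \<phi> r'\<bar>" using L by (intro mult_left_mono) auto
    have 2: "f a - f b \<le> L * (\<phi> a - \<phi> b)"
      using ab by (intro increment_le_\<phi>[where f'=f'] f) (use le ab in auto)
    have "f b \<le> f a"
    proof (rule DERIV_nonneg_imp_nondecreasing[OF ab(1)])
      fix s assume "b \<le> s" "s \<le> a"
      then show "\<exists>y. (f has_real_derivative y) (at s) \<and> 0 \<le> y" using f[of s] le[of s] ab by auto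
    qed
    then show ?thesis using 1 2 by (simp add: a_def[symmetric] b_def[symmetric])
  qed (use L in simp)
  show ?thesis
  proof (cases "r' \<le> r")
    case False
    then show ?thesis using *[of r r'] r by (simp add: abs_minus_commute)
  qed (use * r in auto)
qed

text \<open>\<open>\<phi>\<close> and \<open>\<psi>\<close> are both nondecreasing, so the two
  increments never have opposite signs at almost every pair of points.\<close>

lemma energy_form_nonneg:
  assumes wt: "gagliardo_finite \<sigma> (w t)" and g: "gagliardo_finite \<sigma> (\<lambda>x. \<psi> (u t x))" and t: "t \<ge> 0"
    and mono: "\<And>r s. 0 \<le> r \<Longrightarrow> r \<le> s \<Longrightarrow> \<psi> r \<le> \<psi> s"
  shows "AE p in lborel. 0 \<le> (w t (fst p) - w t (snd p)) * (\<psi> (u t (fst p)) - \<psi> (u t (snd p))) * J (fst p) (snd p)"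
    and "0 \<le> energy_form J (w t) (\<lambda>x. \<psi> (u t x))"
proof -
  have u: "AE x in lborel. u t x \<ge> 0" using u_nonneg[OF t] by (simp add: AE_completion_iff)
  show nn: "AE p in lborel. 0 \<le> (w t (fst p) - w t (snd p)) * (\<psi> (u t (fst p)) - \<psi> (u t (snd p))) * J (fst p) (snd p)"
    using AE_lborel_fst[OF u] AE_lborel_snd[OF u]
  proof eventually_elim
    case (elim p)
    show ?case
    proof (cases "fst p = snd p")
      case False
      have J: "0 \<le> J (fst p) (snd p)" using kernel_bounds(3)[OF adm \<Lambda> False] by simp
      have "0 \<le> (w t (fst p) - w t (snd p)) * (\<psi> (u t (fst p)) - \<psi> (u t (snd p)))"
      proof (cases "u t (fst p) \<le> u t (snd p)")
        case True
        then show ?thesis using \<phi>_mono[OF elim(1) True] mono[OF elim(1) True] by (intro mult_nonpos_nonpos) auto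
      next
        case False
        then have "u t (snd p) \<le> u t (fst p)" by simp
        then show ?thesis using \<phi>_mono[OF elim(2)] mono[OF elim(2)] by (intro mult_nonneg_nonneg) auto
      qed
      then show ?thesis using J by (rule mult_nonneg_nonneg)
    qed simp
  qed
  have "0 \<le> (LINT p|lebesgue. (w t (fst p) - w t (snd p)) * (\<psi> (u t (fst p)) - \<psi> (u t (snd p))) * J (fst p) (snd p))"
    by (rule integral_nonneg_AE[OF AE_completion[OF nn]])
  then show "0 \<le> energy_form J (w t) (\<lambda>x. \<psi> (u t x))" by (simp add: energy_form_def)
qed

text \<open>The entropy of the part of \<open>u\<close> above \<open>M\<close> is nonnegative,
  starts at 0 and cannot increase, so it vanishes at all times. The test function is
  \<open>r - M\<close> clamped to the unit interval, which keeps it bounded.\<close>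

lemma u_bounded:
  obtains M where "M > 0" "\<And>t. t \<ge> 0 \<Longrightarrow> AE x in lebesgue. u t x \<in> {0..M}"
proof -
  obtain M0 where M0: "AE x in lebesgue. \<bar>u0 x\<bar> \<le> M0" using u0_bounded by blast
  define M where "M = max M0 1"
  have M: "M > 0" by (simp add: M_def)
  define \<psi> where "\<psi> r = max M (min (M + 1) r) - M" for r
  \<comment> \<open>The maximum of \<open>a * (r - M) - a^2 / 2\<close> over \<open>a\<close> in the
    unit interval, attained at \<open>a = \<psi> r\<close>. As a supremum of affine functions it is
    convex with subgradient \<open>\<psi> r\<close>, which \<open>sub0\<close> and
    \<open>\<Psi>sub\<close> spell out.\<close>
  define \<Psi> where "\<Psi> r = \<psi> r * (r - M) - (\<psi> r)\<^sup>2 / 2" for r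
  \<comment> \<open>On \<open>[M, M + 1]\<close> the derivative of \<open>\<phi>\<close> is at least
    \<open>c * (M + 1) powr (m - 1)\<close>, since \<open>m < 1\<close>; \<open>L\<close> is the
    reciprocal of this bound.\<close>
  define L where "L = (M + 1) powr (1 - m) / c"
  have L: "L \<ge> 0" using c by (simp add: L_def)
  have \<psi>01: "0 \<le> \<psi> r" "\<psi> r \<le> 1" for r by (auto simp: \<psi>_def)
  have uI: "AE x in lebesgue. u t x \<in> {0..}" if "t \<ge> 0" for t
    using u_nonneg[OF that] by simp
  have \<psi>m: "\<psi> \<in> borel_measurable borel" unfolding \<psi>_def[abs_def] by measurable
  have \<Psi>m: "\<Psi> \<in> borel_measurable borel" unfolding \<Psi>_def[abs_def] using \<psi>m by measurable
  have \<psi>K: "\<bar>\<psi> r\<bar> \<le> max 1 (1 / M)" for r using \<psi>01[of r] by auto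
  \<comment> \<open>Where \<open>\<psi> r\<close> is nonzero, \<open>r\<close> exceeds
    \<open>M\<close>, so \<open>1 \<le> r / M\<close>; this is the origin of \<open>1 / M\<close> in
    the constant.\<close>
  have \<psi>lin: "\<bar>\<psi> r\<bar> \<le> max 1 (1 / M) * r" if "r \<in> {0..}" for r
  proof (cases "r \<le> M")
    case False
    then have "1 \<le> 1 / M * r" using M by (simp add: field_simps)
    also have "\<dots> \<le> max 1 (1 / M) * r" using that by (intro mult_right_mono) auto
    finally show ?thesis using \<psi>01[of r] by auto
  qed (use that in \<open>auto simp: \<psi>_def max_def\<close>)
  have \<psi>L: "\<bar>\<psi> r - \<psi> r'\<bar> \<le> L * \<bar>\<phi> r - \<phi> r'\<bar>" if "r \<in> {0..}" "r' \<in> {0..}" for r r'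
    unfolding \<psi>_def
  proof (rule clamped_lipschitz_\<phi>[where f="\<lambda>s. s - M" and f'="\<lambda>_. 1"])
    fix s assume s: "M \<le> s" "s \<le> M + 1"
    show "((\<lambda>s. s - M) has_real_derivative 1) (at s)" by (auto intro!: derivative_eq_intros)
    have "1 = (M + 1) powr (1 - m) * (M + 1) powr (m - 1)" using M by (simp flip: powr_add)
    also have "\<dots> \<le> (M + 1) powr (1 - m) * s powr (m - 1)"
      using s M m_less_1 by (intro mult_left_mono powr_mono2') auto
    also have "\<dots> = L * (c * s powr (m - 1))" using c by (simp add: L_def)
    also have "\<dots> \<le> L * deriv \<phi> s" using s M L by (intro mult_left_mono \<phi>') auto
    finally show "0 \<le> (1::real) \<and> 1 \<le> L * deriv \<phi> s" by simp
  qed (use M L that in auto)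
  have sub0: "a * (r - M) - a\<^sup>2 / 2 \<le> \<Psi> r" if "0 \<le> a" "a \<le> 1" for a r
  proof -
    consider "r \<le> M" | "M \<le> r" "r \<le> M + 1" | "r \<ge> M + 1" by linarith
    then show ?thesis
    proof cases
      case 1
      then have "\<Psi> r = 0" by (simp add: \<Psi>_def \<psi>_def)
      moreover have "a * (r - M) \<le> 0" using 1 that by (intro mult_nonneg_nonpos) auto
      ultimately show ?thesis using zero_le_power2[of a] by linarith
    next
      case 2
      then have "\<Psi> r = (r - M)\<^sup>2 / 2" by (simp add: \<Psi>_def \<psi>_def power2_eq_square)
      moreover have "0 \<le> (a - (r - M))\<^sup>2" by simp
      ultimately show ?thesis by (simp add: power2_diff)
    next
      case 3
      then have "\<Psi> r = r - M - 1 / 2" by (simp add: \<Psi>_def \<psi>_def)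
      moreover have "(1 - a) * 1 \<le> (1 - a) * (r - M)" using 3 that by (intro mult_left_mono) auto
      moreover have "0 \<le> (1 - a)\<^sup>2" by simp
      ultimately show ?thesis by (simp add: power2_diff algebra_simps)
    qed
  qed
  have \<Psi>sub: "\<Psi> r - \<Psi> r' \<le> \<psi> r * (r - r')" for r r'
    using sub0[OF \<psi>01, of r r'] by (simp add: \<Psi>_def[of r] algebra_simps)
  have \<Psi>0: "\<Psi> 0 = 0" using M by (simp add: \<Psi>_def \<psi>_def)
  have \<Psi>nn: "0 \<le> \<Psi> r" for r using sub0[of 0 r] by simp
  have mono: "\<psi> r \<le> \<psi> s" if "r \<le> s" for r s using that by (auto simp: \<psi>_def)
  have small: "\<Psi> r = 0" if "r \<le> M" for r using that by (simp add: \<Psi>_def \<psi>_def)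
  have large: "\<Psi> r > 0" if "r > M" for r
  proof -
    have "0 < min 1 (r - M)" using that by simp
    moreover have "min 1 (r - M) * (r - M) - (min 1 (r - M))\<^sup>2 / 2 \<le> \<Psi> r"
      using that by (intro sub0) auto
    moreover have "min 1 (r - M) * min 1 (r - M) \<le> min 1 (r - M) * (r - M)"
      using that by (intro mult_left_mono) auto
    ultimately show ?thesis by (smt (verit) power2_eq_square mult_pos_pos field_sum_of_halves)
  qed
  have "AE x in lebesgue. u t x \<in> {0..M}" if t: "t \<ge> 0" for t
  proof -
    have u00: "AE x in lebesgue. u 0 x \<le> M"
    proof -
      have "AE x in lebesgue. u 0 x = u0 x" using sol by (simp add: weak_solution_def)
      then show ?thesis using M0 by eventually_elim (auto simp: M_def)
    qed
    have Y0: "entropy \<Psi> 0 = 0" unfolding entropy_def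
    proof (rule integral_eq_zero_AE)
      show "AE x in lebesgue. \<Psi> (u 0 x) = 0" using u00 by eventually_elim (rule small)
    qed
    have "entropy \<Psi> t \<le> 0"
    proof (cases "t = 0")
      case False
      then have t0: "0 < t" using t by simp
      have \<kappa>: "AE s in lebesgue. s \<in> {0..t} \<longrightarrow> 0 \<le> energy_form J (w s) (\<lambda>x. \<psi> (u s x))"
      proof -
        \<comment> \<open>Time 0 is discarded as a null set, because the finiteness of the seminorm
          is known for positive times only.\<close>
        have "AE s in lebesgue. s \<notin> {0::real}" by (intro AE_not_in) (simp add: null_sets_completion_iff)
        then show ?thesis using w_finite
        proof eventually_elim
          case (elim s)
          show ?case
          proof
            assume "s \<in> {0..t}"
            then have s: "s > 0" using elim by auto
            then have ws: "gagliardo_finite \<sigma> (w s)" using elim by blast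
            have "gagliardo_finite \<sigma> (\<lambda>x. \<psi> (u s x))"
              by (rule \<psi>u_finite(1)[where I="{0..}" and L=L and \<Psi>=\<Psi> and K="max 1 (1/M)"]) (use uI \<psi>m \<psi>K \<psi>lin \<psi>L L \<Psi>m \<Psi>0 \<Psi>sub s ws in auto)
            from energy_form_nonneg(2)[OF ws this _ mono] s
            show "0 \<le> energy_form J (w s) (\<lambda>x. \<psi> (u s x))" by simp
          qed
        qed
      qed
      have "entropy \<Psi> t + 0 * (t - 0) \<le> entropy \<Psi> 0"
        by (rule energy_inequality[where I="{0..}" and L=L and \<psi>=\<psi> and K="max 1 (1/M)"])
          (use uI \<psi>m \<psi>K \<psi>lin \<psi>L L \<Psi>m \<Psi>0 \<Psi>sub t0 \<kappa> in auto)
      then show ?thesis using Y0 by simp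
    qed (simp add: Y0)
    moreover have i: "integrable lebesgue (\<lambda>x. \<Psi> (u t x))"
      by (rule \<Psi>u_integrable[where I="{0..}" and L=L and \<psi>=\<psi> and K="max 1 (1/M)"])
        (use uI \<psi>m \<psi>K \<psi>lin \<psi>L L \<Psi>m \<Psi>0 \<Psi>sub t in auto)
    moreover have "0 \<le> entropy \<Psi> t" unfolding entropy_def by (rule integral_nonneg_AE) (use \<Psi>nn in simp)
    ultimately have "(LINT x|lebesgue. \<Psi> (u t x)) = 0" by (simp add: entropy_def)
    then have "AE x in lebesgue. \<Psi> (u t x) = 0"
      using integral_nonneg_eq_0_iff_AE[OF i] \<Psi>nn by simp
    then show ?thesis using u_nonneg[OF t]
    proof eventually_elim
      case (elim x)
      then show ?case using large[of "u t x"] by (cases "u t x \<le> M") auto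
    qed
  qed
  then show ?thesis using that M by blast
qed

end

section \<open>Decay and extinction\<close>

lemma powr_tangent_line:
  fixes a b q :: real
  assumes "0 < a" "0 < b" "1 \<le> q"
  shows "a powr q + q * a powr (q - 1) * (b - a) \<le> b powr q"
proof -
  define h where "h x = x powr q - q * a powr (q - 1) * x" for x
  have d: "(h has_real_derivative q * (x powr (q - 1) - a powr (q - 1))) (at x)" if "x > 0" for x
    unfolding h_def using that by (auto intro!: derivative_eq_intros simp: algebra_simps)
  have "h a \<le> h b"
  proof (cases "a \<le> b")
    case True
    show ?thesis
    proof (rule DERIV_nonneg_imp_nondecreasing[OF True])
      fix x assume "a \<le> x" "x \<le> b"
      then have "x > 0" "a powr (q - 1) \<le> x powr (q - 1)" using assms by (auto intro!: powr_mono2)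
      then show "\<exists>y. (h has_real_derivative y) (at x) \<and> 0 \<le> y"
        using d assms by (intro exI[of _ "q * (x powr (q - 1) - a powr (q - 1))"]) auto
    qed
  next
    case False
    then have "b \<le> a" by simp
    then show ?thesis
    proof (rule DERIV_nonpos_imp_nonincreasing)
      fix x assume "b \<le> x" "x \<le> a"
      then have "x > 0" "x powr (q - 1) \<le> a powr (q - 1)" using assms by (auto intro!: powr_mono2)
      then show "\<exists>y. (h has_real_derivative y) (at x) \<and> y \<le> 0"
        using d assms by (intro exI[of _ "q * (x powr (q - 1) - a powr (q - 1))"]) (auto intro!: mult_nonneg_nonpos)
    qed
  qed
  then show ?thesis by (simp add: h_def algebra_simps)
qed

text \<open>The power is monotone, but the direction depends on the sign of \<open>e\<close>; the
  sum serves both cases. In the application the exponent \<open>p - 1 - m\<close> can have either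
  sign.\<close>

lemma powr_le_endpoints:
  fixes s a b e :: real
  assumes "0 < a" "a \<le> s" "s \<le> b"
  shows "s powr e \<le> a powr e + b powr e"
proof (cases "e \<ge> 0")
  case True
  then have "s powr e \<le> b powr e" using assms by (intro powr_mono2) auto
  then show ?thesis by (smt (verit) powr_ge_zero)
next
  case False
  then have "s powr e \<le> a powr e" using assms by (intro powr_mono2') auto
  then show ?thesis by (smt (verit) powr_ge_zero)
qed

context extinction_problem
begin

text \<open>The lower clamp with the subtracted constant makes the function vanish for
  \<open>r \<le> \<delta>\<close> and stay continuous; the upper clamp makes it bounded and is
  inactive at the values of \<open>u\<close>, which are at most \<open>M\<close>.\<close>

definition truncated_power :: "real \<Rightarrow> real \<Rightarrow> real \<Rightarrow> real" where
  "truncated_power M \<delta> r = max \<delta> (min M r) powr (p - 1) - \<delta> powr (p - 1)"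

text \<open>On \<open>{0..M}\<close> this is the primitive of \<open>truncated_power\<close> that
  vanishes at 0. It tends to \<open>r powr p / p\<close> as \<open>\<delta>\<close> tends to
  0.\<close>

definition truncated_primitive :: "real \<Rightarrow> real \<Rightarrow> real" where
  "truncated_primitive \<delta> r = (max \<delta> r powr p - \<delta> powr p) / p - \<delta> powr (p - 1) * (max \<delta> r - \<delta>)"

lemma truncated_power_mono: "0 < \<delta> \<Longrightarrow> r \<le> s \<Longrightarrow> truncated_power M \<delta> r \<le> truncated_power M \<delta> s"
  unfolding truncated_power_def using p_gt_1 by (intro diff_right_mono powr_mono2) auto

lemma truncated_primitive_bounds:
  assumes "0 < \<delta>" "0 \<le> r"
  shows "truncated_primitive \<delta> r \<le> r powr p / p" "0 \<le> truncated_primitive \<delta> r"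
    "r \<le> \<delta> \<Longrightarrow> truncated_primitive \<delta> r = 0"
proof -
  have p: "p > 1" by (rule p_gt_1)
  show z: "truncated_primitive \<delta> r = 0" if "r \<le> \<delta>" using that by (simp add: truncated_primitive_def max_def)
  show "0 \<le> truncated_primitive \<delta> r"
  proof (cases "r \<le> \<delta>")
    case False
    have "\<delta> powr p + p * \<delta> powr (p - 1) * (r - \<delta>) \<le> r powr p"
      using assms False p by (intro powr_tangent_line) auto
    then have "p * (\<delta> powr (p - 1) * (r - \<delta>)) \<le> r powr p - \<delta> powr p" by simp
    then have "\<delta> powr (p - 1) * (r - \<delta>) \<le> (r powr p - \<delta> powr p) / p" using p by (simp add: pos_le_divide_eq mult.commute)
    then show ?thesis using False by (simp add: truncated_primitive_def max_def)
  qed (simp add: z)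
  show "truncated_primitive \<delta> r \<le> r powr p / p"
  proof (cases "r \<le> \<delta>")
    case False
    have "0 \<le> \<delta> powr (p - 1) * (r - \<delta>)" using False by simp
    moreover have "(r powr p - \<delta> powr p) / p \<le> r powr p / p" using p by (intro divide_right_mono) auto
    moreover have "truncated_primitive \<delta> r = (r powr p - \<delta> powr p) / p - \<delta> powr (p - 1) * (r - \<delta>)"
      using False by (simp add: truncated_primitive_def max_def)
    ultimately show ?thesis by linarith
  qed (use z p in simp)
qed

text \<open>The hypotheses of the energy inequality on \<open>{0..M}\<close>. \<open>K\<close> and
  \<open>L\<close> depend on \<open>\<delta>\<close> and may blow up as it tends to 0; this is
  harmless because they do not occur in the resulting inequality.\<close>

lemma truncated_facts:
  assumes d: "0 < \<delta>" "\<delta> \<le> M"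
  obtains K L where
    "truncated_power M \<delta> \<in> borel_measurable borel" "\<And>r. \<bar>truncated_power M \<delta> r\<bar> \<le> K"
    "\<And>r. r \<in> {0..M} \<Longrightarrow> \<bar>truncated_power M \<delta> r\<bar> \<le> K * r"
    "\<And>r r'. r \<in> {0..M} \<Longrightarrow> r' \<in> {0..M} \<Longrightarrow>
       \<bar>truncated_power M \<delta> r - truncated_power M \<delta> r'\<bar> \<le> L * \<bar>\<phi> r - \<phi> r'\<bar>" "L \<ge> 0"
    "truncated_primitive \<delta> \<in> borel_measurable borel" "truncated_primitive \<delta> 0 = 0"
    "\<And>r r'. r \<in> {0..M} \<Longrightarrow> r' \<in> {0..M} \<Longrightarrow>
       truncated_primitive \<delta> r - truncated_primitive \<delta> r' \<le> truncated_power M \<delta> r * (r - r')"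
proof -
  have p: "p > 1" by (rule p_gt_1)
  \<comment> \<open>The factor \<open>1 / \<delta>\<close> yields the bound by \<open>K * r\<close>:
    where the truncated power is nonzero, \<open>r\<close> exceeds \<open>\<delta>\<close>.\<close>
  define K where "K = M powr (p - 1) * max 1 (1 / \<delta>)"
  \<comment> \<open>From \<open>(p - 1) * s powr (p - 2) = (p - 1) / c * s powr (p - 1 - m) * (c * s
    powr (m - 1))\<close>, the middle power being bounded by the sum of its values at the two
    ends.\<close>
  define L where "L = (p - 1) / c * (\<delta> powr (p - 1 - m) + M powr (p - 1 - m))"
  have L: "L \<ge> 0" using p c by (simp add: L_def)
  have nn: "0 \<le> truncated_power M \<delta> r" for r
    unfolding truncated_power_def using p d by (simp add: powr_mono2)
  have le: "truncated_power M \<delta> r \<le> M powr (p - 1)" for r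
  proof -
    have "max \<delta> (min M r) powr (p - 1) \<le> M powr (p - 1)" using p d by (intro powr_mono2) auto
    then show ?thesis unfolding truncated_power_def using powr_ge_zero[of \<delta> "p - 1"] by linarith
  qed
  have K1: "M powr (p - 1) \<le> K" unfolding K_def by (simp add: mult_le_cancel_left1)
  show ?thesis
  proof (rule that[of K L])
    show "truncated_power M \<delta> \<in> borel_measurable borel" unfolding truncated_power_def[abs_def] by measurable
    show "\<bar>truncated_power M \<delta> r\<bar> \<le> K" for r using nn[of r] le[of r] K1 by linarith
    show "\<bar>truncated_power M \<delta> r\<bar> \<le> K * r" if r: "r \<in> {0..M}" for r
    proof (cases "r \<le> \<delta>")
      case True
      then have "max \<delta> (min M r) = \<delta>" using d by auto
      then have "truncated_power M \<delta> r = 0" by (simp add: truncated_power_def)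
      then show ?thesis using r by (simp add: K_def)
    next
      case False
      then have "1 \<le> 1 / \<delta> * r" using d by (simp add: field_simps)
      also have "\<dots> \<le> max 1 (1 / \<delta>) * r" using r by (intro mult_right_mono) auto
      finally have "M powr (p - 1) * 1 \<le> M powr (p - 1) * (max 1 (1 / \<delta>) * r)" by (rule mult_left_mono) simp
      then show ?thesis using nn[of r] le[of r] by (simp add: K_def mult.assoc)
    qed
    show "\<bar>truncated_power M \<delta> r - truncated_power M \<delta> r'\<bar> \<le> L * \<bar>\<phi> r - \<phi> r'\<bar>"
      if "r \<in> {0..M}" "r' \<in> {0..M}" for r r'
      unfolding truncated_power_def
    proof (rule clamped_lipschitz_\<phi>[where f="\<lambda>s. s powr (p - 1) - \<delta> powr (p - 1)" and f'="\<lambda>s. (p - 1) * s powr (p - 2)"])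
      fix s assume s: "\<delta> \<le> s" "s \<le> M"
      then have s0: "s > 0" using d by simp
      show "((\<lambda>s. s powr (p - 1) - \<delta> powr (p - 1)) has_real_derivative (p - 1) * s powr (p - 2)) (at s)"
        using s0 by (auto intro!: derivative_eq_intros simp: diff_diff_eq)
      have "(p - 1) * s powr (p - 2) = (p - 1) / c * s powr (p - 1 - m) * (c * s powr (m - 1))"
        using c by (simp flip: powr_add)
      also have "\<dots> \<le> L * (c * s powr (m - 1))"
        unfolding L_def using p c s d by (intro mult_right_mono mult_left_mono powr_le_endpoints) auto
      also have "\<dots> \<le> L * deriv \<phi> s" using L s0 by (intro mult_left_mono \<phi>') auto
      finally show "0 \<le> (p - 1) * s powr (p - 2) \<and> (p - 1) * s powr (p - 2) \<le> L * deriv \<phi> s"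
        using p by simp
    qed (use d L that in auto)
    show "L \<ge> 0" by (rule L)
    show "truncated_primitive \<delta> \<in> borel_measurable borel" unfolding truncated_primitive_def[abs_def] by measurable
    show "truncated_primitive \<delta> 0 = 0" using d by (simp add: truncated_primitive_def max_def)
    fix r r' assume r: "r \<in> {0..M}" "r' \<in> {0..M}"
    define a b where "a = max \<delta> r" and "b = max \<delta> r'"
    have ab: "0 < a" "0 < b" "b \<ge> r'" using d by (auto simp: a_def b_def)
    have T: "truncated_power M \<delta> r = a powr (p - 1) - \<delta> powr (p - 1)" using r by (simp add: truncated_power_def a_def)
    have "a powr p + p * a powr (p - 1) * (b - a) \<le> b powr p"
      using ab p by (intro powr_tangent_line) auto
    then have "a powr p - b powr p \<le> p * (a powr (p - 1) * (a - b))" by (simp add: algebra_simps)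
    then have 1: "(a powr p - b powr p) / p \<le> a powr (p - 1) * (a - b)" using p by (simp add: pos_divide_le_eq mult.commute)
    have "truncated_primitive \<delta> r - truncated_primitive \<delta> r' = (a powr p - b powr p) / p - \<delta> powr (p - 1) * (a - b)"
      unfolding truncated_primitive_def a_def[symmetric] b_def[symmetric]
      by (simp add: diff_divide_distrib algebra_simps)
    also have "\<dots> \<le> truncated_power M \<delta> r * (a - b)" using 1 by (simp add: T left_diff_distrib)
    also have "\<dots> \<le> truncated_power M \<delta> r * (r - r')"
    proof (cases "r \<le> \<delta>")
      case True
      then have "max \<delta> (min M r) = \<delta>" using d by auto
      then have "truncated_power M \<delta> r = 0" by (simp add: truncated_power_def)
      then show ?thesis by simp
    next
      case False
      then show ?thesis using ab nn[of r] by (intro mult_left_mono) (auto simp: a_def)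
    qed
    finally show "truncated_primitive \<delta> r - truncated_primitive \<delta> r' \<le> truncated_power M \<delta> r * (r - r')" .
  qed
qed

text \<open>The factors in order: the increment of \<open>\<phi>\<close> between \<open>s/2\<close>
  and \<open>s\<close> relative to \<open>s powr m\<close>; that of the test function relative to
  \<open>s powr (p - 1)\<close>; the lower bound of the kernel; and the volume of half a ball times
  its radius to the power \<open>- (N + \<sigma>)\<close>, with the powers of \<open>s\<close> and
  \<open>Z\<close> removed. None of them involves \<open>\<delta>\<close> or
  \<open>M\<close>.\<close>

definition decay_constant :: real where
  "decay_constant = c * (1 - 2 powr (- m)) / m * (1 - 2 powr (1 - p)) / \<Lambda> *
     (unit_ball_vol (real CARD('n)) / 2 * (2 * 2 powr p / unit_ball_vol (real CARD('n))) powr (- (\<sigma> / real CARD('n))))"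

lemma decay_constant_pos: "decay_constant > 0"
proof -
  have "2 powr (- m) < (2::real) powr 0" "2 powr (1 - p) < (2::real) powr 0"
    using m p_gt_1 by (intro powr_less_mono; simp)+
  moreover have "unit_ball_vol (real CARD('n)) \<noteq> 0" using unit_ball_vol_pos[of "real CARD('n)"] by linarith
  ultimately show ?thesis unfolding decay_constant_def using c m \<Lambda>
    by (intro mult_pos_pos divide_pos_pos) auto
qed

text \<open>For a point \<open>x\<close> with \<open>s = u t x > 2 \<delta>\<close> the radius \<open>r\<close> is chosen such that, by Chebyshev's inequality,
  \<open>u t \<le> s / 2\<close> on at least half of the ball of radius \<open>r\<close> around \<open>x\<close>; there the integrand of the
  energy is at least a multiple of \<open>s\<^bsup>m + p - 1\<^esup> r\<^bsup>- N - \<sigma>\<^esup>\<close>. This argument replaces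
  the combination of the Stroock-Varopoulos and the fractional Sobolev inequalities.\<close>

lemma energy_lower_bound:
  assumes wt: "gagliardo_finite \<sigma> (w t)" and t: "t \<ge> 0" and uM: "AE x in lebesgue. u t x \<in> {0..M}"
    and d: "0 < \<delta>" "\<delta> \<le> M"
    and g: "gagliardo_finite \<sigma> (\<lambda>x. truncated_power M \<delta> (u t x))"
    and Z: "(\<integral>\<^sup>+ x. ennreal (u t x powr p) \<partial>lebesgue) \<le> ennreal Z" and Z0: "Z > 0"
  shows "ennreal (decay_constant * Z powr (- (\<sigma> / real CARD('n)))) *
     (\<integral>\<^sup>+ x. ennreal (u t x powr p) * indicator {x. u t x > 2 * \<delta>} x \<partial>lebesgue)
    \<le> ennreal (2 * energy_form J (w t) (\<lambda>x. truncated_power M \<delta> (u t x)))"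
proof -
  let ?N = "real CARD('n)"
  define \<omega> where "\<omega> = unit_ball_vol ?N"
  have \<omega>: "\<omega> > 0" by (simp add: \<omega>_def)
  have p: "p > 1" by (rule p_gt_1)
  have um: "u t \<in> borel_measurable lebesgue" using u_integrable[OF t] by blast
  obtain f0 where f0: "f0 \<in> borel_measurable borel" "AE x in lborel. u t x = f0 x"
    using borel_representative[OF um] by blast
  \<comment> \<open>A Borel representative with values in \<open>{0..M}\<close> everywhere, so that
    Fubini and the pointwise estimates run without exceptional sets.\<close>
  define v where "v x = max 0 (min M (f0 x))" for x
  have vm[measurable]: "v \<in> borel_measurable borel" unfolding v_def[abs_def] using f0(1) by measurable
  have v0: "0 \<le> v x" "v x \<le> M" for x using d by (auto simp: v_def)
  have uM': "AE x in lborel. u t x \<in> {0..M}" using uM by (simp add: AE_completion_iff)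
  have uv: "AE x in lborel. u t x = v x" using f0(2) uM'
    by eventually_elim (auto simp: v_def)
  have vZ: "(\<integral>\<^sup>+ x. ennreal (v x powr p) \<partial>lborel) \<le> ennreal Z"
  proof -
    have "(\<integral>\<^sup>+ x. ennreal (v x powr p) \<partial>lborel) = (\<integral>\<^sup>+ x. ennreal (u t x powr p) \<partial>lborel)"
      by (rule nn_integral_cong_AE) (use uv in eventually_elim, simp)
    then show ?thesis using Z by (simp add: nn_integral_completion)
  qed
  define q where "q s = (2 / s) powr p * Z" for s
  define R where "R s = (2 * q s / \<omega>) powr (1 / ?N)" for s
  define A1 where "A1 = c * (1 - 2 powr (- m)) / m"
  define A2 where "A2 = 1 - 2 powr (1 - p)"
  have A: "A1 \<ge> 0" "A2 \<ge> 0"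
  proof -
    have "2 powr (- m) < (2::real) powr 0" "2 powr (1 - p) < (2::real) powr 0"
      using m p by (intro powr_less_mono; simp)+
    then show "A1 \<ge> 0" "A2 \<ge> 0" using c m by (auto simp: A1_def A2_def)
  qed
  define h where "h s = A1 * A2 / \<Lambda> * (s powr m * s powr (p - 1)) * R s powr (- (?N + \<sigma>))" for s
  \<comment> \<open>Keeps only the pairs at which the second value is at most half of the first,
    within the radius that belongs to the first value; the minorant depends on the first point
    alone.\<close>
  define H where "H z = (if 2 * \<delta> < v (fst z) \<and> v (snd z) \<le> v (fst z) / 2 \<and> dist (fst z) (snd z) < R (v (fst z))
     then ennreal (h (v (fst z))) else 0)" for z :: "(real^'n) \<times> (real^'n)"
  have hm[measurable]: "h \<in> borel_measurable borel" and Rm[measurable]: "R \<in> borel_measurable borel"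
    unfolding h_def[abs_def] R_def[abs_def] q_def[abs_def] by measurable
  have Hm: "H \<in> borel_measurable (lborel \<Otimes>\<^sub>M lborel)" unfolding H_def[abs_def] by measurable
  have key: "h a \<le> (\<phi> a - \<phi> b) * (truncated_power M \<delta> a - truncated_power M \<delta> b) * J x y"
    if ab: "2 * \<delta> < a" "a \<le> M" "0 \<le> b" "b \<le> a / 2" and xy: "x \<noteq> y" "dist x y < R a" for a b x y
  proof -
    have a0: "a > 0" using ab d by simp
    have h2: "(a / 2) powr e = 2 powr (- e) * a powr e" for e
      using a0 by (simp add: powr_divide powr_minus_divide)
    have "a powr m - (a / 2) powr m \<le> m / c * (\<phi> a - \<phi> (a / 2))"
    proof (rule increment_le_\<phi>[where f'="\<lambda>s. m * s powr (m - 1)"])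
      fix s assume "a / 2 \<le> s" "s \<le> a"
      then have s: "s > 0" using a0 by simp
      show "((\<lambda>s. s powr m) has_real_derivative m * s powr (m - 1)) (at s)"
        using s by (auto intro!: derivative_eq_intros)
      have "m / c * (c * s powr (m - 1)) \<le> m / c * deriv \<phi> s"
        using m c s by (intro mult_left_mono \<phi>') auto
      then show "m * s powr (m - 1) \<le> m / c * deriv \<phi> s" using c by simp
    qed (use a0 in auto)
    also have "\<dots> \<le> m / c * (\<phi> a - \<phi> b)"
      using m c ab by (intro mult_left_mono diff_left_mono \<phi>_mono) auto
    finally have "(1 - 2 powr (- m)) * a powr m \<le> m / c * (\<phi> a - \<phi> b)" by (simp add: h2 left_diff_distrib)
    then have "c / m * ((1 - 2 powr (- m)) * a powr m) \<le> c / m * (m / c * (\<phi> a - \<phi> b))"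
      using m c by (intro mult_left_mono) auto
    then have 1: "A1 * a powr m \<le> \<phi> a - \<phi> b" using m c by (simp add: A1_def)
    have "truncated_power M \<delta> b \<le> truncated_power M \<delta> (a / 2)" using ab d by (intro truncated_power_mono) auto
    \<comment> \<open>The threshold \<open>2 * \<delta>\<close> keeps \<open>a / 2\<close> above
      \<open>\<delta>\<close>, so both values are genuine powers and the subtracted constants
      cancel.\<close>
    moreover have "truncated_power M \<delta> a - truncated_power M \<delta> (a / 2) = A2 * a powr (p - 1)"
      using ab d by (simp add: truncated_power_def max_def min_def A2_def h2 left_diff_distrib)
    ultimately have 2: "A2 * a powr (p - 1) \<le> truncated_power M \<delta> a - truncated_power M \<delta> b" by linarith
    have n0: "norm (x - y) > 0" "norm (x - y) < R a" using xy by (auto simp: dist_norm)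
    have "R a powr (- (?N + \<sigma>)) \<le> norm (x - y) powr (- (?N + \<sigma>))"
      using n0 \<sigma> by (intro powr_mono2') auto
    then have "R a powr (- (?N + \<sigma>)) / \<Lambda> \<le> norm (x - y) powr (- (?N + \<sigma>)) / \<Lambda>"
      using \<Lambda> by (intro divide_right_mono) auto
    also have "\<dots> = 1 / (\<Lambda> * norm (x - y) powr (?N + \<sigma>))"
      unfolding powr_minus_divide by simp
    also have "\<dots> \<le> J x y" by (rule kernel_bounds(1)[OF adm \<Lambda> xy(1)])
    finally have 3: "R a powr (- (?N + \<sigma>)) / \<Lambda> \<le> J x y" .
    have "h a = (A1 * a powr m) * (A2 * a powr (p - 1)) * (R a powr (- (?N + \<sigma>)) / \<Lambda>)"
      by (simp add: h_def)
    also have "\<dots> \<le> (\<phi> a - \<phi> b) * (truncated_power M \<delta> a - truncated_power M \<delta> b) * J x y"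
      using A \<Lambda> kernel_bounds(3)[OF adm \<Lambda> xy(1)]
      by (intro mult_mono 1 2 3 mult_nonneg_nonneg order_trans[OF _ 1] order_trans[OF _ 2]) auto
    finally show ?thesis .
  qed
  have HE: "(\<integral>\<^sup>+ z. H z \<partial>lborel) \<le> ennreal (2 * energy_form J (w t) (\<lambda>x. truncated_power M \<delta> (u t x)))"
  proof (rule energy_form_lower_bound[OF adm \<Lambda> wt g])
    show "AE z in lborel. 0 \<le> (w t (fst z) - w t (snd z)) * (truncated_power M \<delta> (u t (fst z)) - truncated_power M \<delta> (u t (snd z))) * J (fst z) (snd z)"
      by (rule energy_form_nonneg(1)[OF wt g t]) (use truncated_power_mono d in auto)
    show "AE z in lborel. H z \<le> ennreal ((w t (fst z) - w t (snd z)) * (truncated_power M \<delta> (u t (fst z)) - truncated_power M \<delta> (u t (snd z))) * J (fst z) (snd z))"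
      using AE_lborel_fst[OF uv] AE_lborel_snd[OF uv]
    proof eventually_elim
      case (elim z)
      show ?case
      proof (cases "2 * \<delta> < v (fst z) \<and> v (snd z) \<le> v (fst z) / 2 \<and> dist (fst z) (snd z) < R (v (fst z))")
        case True
        then have "fst z \<noteq> snd z" using d by auto
        then have "h (v (fst z)) \<le> (\<phi> (v (fst z)) - \<phi> (v (snd z))) * (truncated_power M \<delta> (v (fst z)) - truncated_power M \<delta> (v (snd z))) * J (fst z) (snd z)"
          using True v0 by (intro key) auto
        then show ?thesis using True elim by (simp add: H_def ennreal_leI)
      next
        case False
        then have "H z = 0" unfolding H_def by (rule if_not_P)
        then show ?thesis by simp
      qed
    qed
  qed
  have HF: "(\<integral>\<^sup>+ z. H z \<partial>lborel) = (\<integral>\<^sup>+ x. \<integral>\<^sup>+ y. H (x, y) \<partial>lborel \<partial>lborel)"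
    using lborel.nn_integral_fst[OF Hm] by (simp add: lborel_prod)
  have inner: "ennreal (decay_constant * Z powr (- (\<sigma> / ?N))) * (ennreal (v x powr p) * indicator {x. v x > 2 * \<delta>} x) \<le> (\<integral>\<^sup>+ y. H (x, y) \<partial>lborel)" for x
  proof (cases "v x > 2 * \<delta>")
    case True
    define a where "a = v x"
    have a0: "a > 0" using True d by (simp add: a_def)
    have q0: "q a > 0" using a0 Z0 by (simp add: q_def)
    have h0: "h a \<ge> 0" using A \<Lambda> by (simp add: h_def)
    have [measurable]: "ball x (R a) \<in> sets borel" by (intro borel_open open_ball)
    have "(\<integral>\<^sup>+ y. H (x, y) \<partial>lborel) = (\<integral>\<^sup>+ y. ennreal (h a) * indicator (ball x (R a) \<inter> {y. v y \<le> a / 2}) y \<partial>lborel)"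
      using True by (intro nn_integral_cong) (auto simp: H_def a_def indicator_def)
    also have "\<dots> = ennreal (h a) * emeasure lborel (ball x (R a) \<inter> {y. v y \<le> a / 2})"
      by (intro nn_integral_cmult_indicator) measurable
    also have "\<dots> \<ge> ennreal (h a) * ennreal (q a)"
    proof (rule mult_left_mono)
      show "ennreal (q a) \<le> emeasure lborel (ball x (R a) \<inter> {y. v y \<le> a / 2})"
        by (rule ball_superlevel_volume[OF vm v0(1) vZ Z0 a0]) (use p in \<open>auto simp: q_def R_def \<omega>_def\<close>)
    qed simp
    finally have "ennreal (h a * q a) \<le> (\<integral>\<^sup>+ y. H (x, y) \<partial>lborel)" using h0 q0 by (simp add: ennreal_mult)
    moreover have "h a * q a = decay_constant * Z powr (- (\<sigma> / ?N)) * a powr p"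
    proof -
      \<comment> \<open>\<open>R a\<close> is \<open>X powr (1 / N)\<close> and \<open>q a\<close>
        is a multiple of \<open>X\<close>, so their contribution is a multiple of
        \<open>X powr (- (\<sigma> / N))\<close>, which separates into powers of \<open>Z\<close>
        and of \<open>a\<close>.\<close>
      define X where "X = 2 * q a / \<omega>"
      have X: "X > 0" "q a = \<omega> / 2 * X" using q0 \<omega> by (auto simp: X_def)
      have "R a powr (- (?N + \<sigma>)) = X powr (1 / ?N * (- (?N + \<sigma>)))" by (simp add: R_def X_def powr_powr)
      also have "1 / ?N * (- (?N + \<sigma>)) = - (\<sigma> / ?N) - 1" by (simp add: field_simps)
      finally have "R a powr (- (?N + \<sigma>)) * q a = \<omega> / 2 * (X powr (- (\<sigma> / ?N) - 1) * X powr 1)"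
        using X(2) powr_one[OF less_imp_le[OF X(1)]] by simp
      also have "X powr (- (\<sigma> / ?N) - 1) * X powr 1 = X powr (- (\<sigma> / ?N))"
        unfolding powr_add[symmetric] by simp
      also have "X = (2 * 2 powr p / \<omega>) * Z * a powr (- p)"
        using a0 by (simp add: X_def q_def powr_divide powr_minus_divide mult_ac)
      also have "\<dots> powr (- (\<sigma> / ?N)) = (2 * 2 powr p / \<omega>) powr (- (\<sigma> / ?N)) * Z powr (- (\<sigma> / ?N)) * a powr (p * (\<sigma> / ?N))"
      proof -
        have pm: "(x * y * z) powr e = x powr e * y powr e * z powr e" if "x \<ge> 0" "y \<ge> 0" "z \<ge> 0" for x y z e :: real
          using that by (simp add: powr_mult)
        have "(a powr (- p)) powr (- (\<sigma> / ?N)) = a powr (p * (\<sigma> / ?N))" unfolding powr_powr by simp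
        then show ?thesis using a0 Z0 \<omega> by (subst pm) simp_all
      qed
      finally have 1: "R a powr (- (?N + \<sigma>)) * q a = \<omega> / 2 * ((2 * 2 powr p / \<omega>) powr (- (\<sigma> / ?N)) * Z powr (- (\<sigma> / ?N)) * a powr (1 - m))"
        unfolding p_eq .
      \<comment> \<open>The exponents add up to \<open>p\<close> because
        \<open>p * (\<sigma> / N) = 1 - m\<close>.\<close>
      have 2: "a powr m * a powr (p - 1) * a powr (1 - m) = a powr p" by (simp flip: powr_add)
      have "h a * q a = A1 * A2 / \<Lambda> * (a powr m * a powr (p - 1)) * (R a powr (- (?N + \<sigma>)) * q a)"
        by (simp add: h_def)
      also have "\<dots> = A1 * A2 / \<Lambda> * (\<omega> / 2 * (2 * 2 powr p / \<omega>) powr (- (\<sigma> / ?N))) * Z powr (- (\<sigma> / ?N)) * (a powr m * a powr (p - 1) * a powr (1 - m))"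
        unfolding 1 by (simp only: mult_ac)
      finally show ?thesis unfolding 2 by (simp add: decay_constant_def A1_def A2_def \<omega>_def)
    qed
    ultimately show ?thesis using True decay_constant_pos
      by (simp add: a_def ennreal_mult)
  qed simp
  have "ennreal (decay_constant * Z powr (- (\<sigma> / ?N))) *
     (\<integral>\<^sup>+ x. ennreal (u t x powr p) * indicator {x. u t x > 2 * \<delta>} x \<partial>lebesgue) =
     ennreal (decay_constant * Z powr (- (\<sigma> / ?N))) *
     (\<integral>\<^sup>+ x. ennreal (v x powr p) * indicator {x. v x > 2 * \<delta>} x \<partial>lborel)"
  proof (rule arg_cong[where f="\<lambda>x. _ * x"])
    show "(\<integral>\<^sup>+ x. ennreal (u t x powr p) * indicator {x. u t x > 2 * \<delta>} x \<partial>lebesgue) =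
      (\<integral>\<^sup>+ x. ennreal (v x powr p) * indicator {x. v x > 2 * \<delta>} x \<partial>lborel)"
      unfolding nn_integral_completion
    proof (rule nn_integral_cong_AE)
      show "AE x in lborel. ennreal (u t x powr p) * indicator {x. u t x > 2 * \<delta>} x = ennreal (v x powr p) * indicator {x. v x > 2 * \<delta>} x"
        using uv by eventually_elim (simp add: indicator_def)
    qed
  qed
  also have "\<dots> = (\<integral>\<^sup>+ x. ennreal (decay_constant * Z powr (- (\<sigma> / ?N))) * (ennreal (v x powr p) * indicator {x. v x > 2 * \<delta>} x) \<partial>lborel)"
    by (rule nn_integral_cmult[symmetric]) measurable
  also have "\<dots> \<le> (\<integral>\<^sup>+ x. \<integral>\<^sup>+ y. H (x, y) \<partial>lborel \<partial>lborel)"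
    by (intro nn_integral_mono inner)
  also have "\<dots> \<le> ennreal (2 * energy_form J (w t) (\<lambda>x. truncated_power M \<delta> (u t x)))"
    using HE unfolding HF .
  finally show ?thesis .
qed

section \<open>The energy inequality for truncated powers and its limit\<close>

lemma truncated_power_finite:
  assumes d: "0 < \<delta>" "\<delta> \<le> M" and uM: "\<And>t. t \<ge> 0 \<Longrightarrow> AE x in lebesgue. u t x \<in> {0..M}"
    and t: "t \<ge> 0" and wt: "gagliardo_finite \<sigma> (w t)"
  shows "gagliardo_finite \<sigma> (\<lambda>x. truncated_power M \<delta> (u t x))"
proof (rule truncated_facts[OF d])
  fix K L
  assume *: "truncated_power M \<delta> \<in> borel_measurable borel" "\<And>r. \<bar>truncated_power M \<delta> r\<bar> \<le> K"
    "\<And>r. r \<in> {0..M} \<Longrightarrow> \<bar>truncated_power M \<delta> r\<bar> \<le> K * r"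
    "\<And>r r'. r \<in> {0..M} \<Longrightarrow> r' \<in> {0..M} \<Longrightarrow>
       \<bar>truncated_power M \<delta> r - truncated_power M \<delta> r'\<bar> \<le> L * \<bar>\<phi> r - \<phi> r'\<bar>" "L \<ge> 0"
    "truncated_primitive \<delta> \<in> borel_measurable borel" "truncated_primitive \<delta> 0 = 0"
    "\<And>r r'. r \<in> {0..M} \<Longrightarrow> r' \<in> {0..M} \<Longrightarrow>
       truncated_primitive \<delta> r - truncated_primitive \<delta> r' \<le> truncated_power M \<delta> r * (r - r')"
  have I: "{0..M} \<subseteq> {0..}" "0 \<in> {0..M}" using d by auto
  show ?thesis by (rule \<psi>u_finite(1)[OF I uM * t wt])
qed

lemma truncated_primitive_integrable:
  assumes d: "0 < \<delta>" "\<delta> \<le> M" and uM: "\<And>t. t \<ge> 0 \<Longrightarrow> AE x in lebesgue. u t x \<in> {0..M}"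
    and t: "t \<ge> 0"
  shows "integrable lebesgue (\<lambda>x. truncated_primitive \<delta> (u t x))"
proof (rule truncated_facts[OF d])
  fix K L
  assume *: "truncated_power M \<delta> \<in> borel_measurable borel" "\<And>r. \<bar>truncated_power M \<delta> r\<bar> \<le> K"
    "\<And>r. r \<in> {0..M} \<Longrightarrow> \<bar>truncated_power M \<delta> r\<bar> \<le> K * r"
    "\<And>r r'. r \<in> {0..M} \<Longrightarrow> r' \<in> {0..M} \<Longrightarrow>
       \<bar>truncated_power M \<delta> r - truncated_power M \<delta> r'\<bar> \<le> L * \<bar>\<phi> r - \<phi> r'\<bar>" "L \<ge> 0"
    "truncated_primitive \<delta> \<in> borel_measurable borel" "truncated_primitive \<delta> 0 = 0"
    "\<And>r r'. r \<in> {0..M} \<Longrightarrow> r' \<in> {0..M} \<Longrightarrow>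
       truncated_primitive \<delta> r - truncated_primitive \<delta> r' \<le> truncated_power M \<delta> r * (r - r')"
  have I: "{0..M} \<subseteq> {0..}" "0 \<in> {0..M}" using d by auto
  show ?thesis by (rule \<Psi>u_integrable[OF I uM * t])
qed

lemma energy_inequality_truncated:
  assumes d: "0 < \<delta>" "\<delta> \<le> M" and uM: "\<And>t. t \<ge> 0 \<Longrightarrow> AE x in lebesgue. u t x \<in> {0..M}"
    and ab: "0 \<le> a" "a < b"
    and \<kappa>: "AE t in lebesgue. t \<in> {a..b} \<longrightarrow> \<kappa> \<le> energy_form J (w t) (\<lambda>x. truncated_power M \<delta> (u t x))"
  shows "entropy (truncated_primitive \<delta>) b + \<kappa> * (b - a) \<le> entropy (truncated_primitive \<delta>) a"
proof (rule truncated_facts[OF d])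
  fix K L
  assume *: "truncated_power M \<delta> \<in> borel_measurable borel" "\<And>r. \<bar>truncated_power M \<delta> r\<bar> \<le> K"
    "\<And>r. r \<in> {0..M} \<Longrightarrow> \<bar>truncated_power M \<delta> r\<bar> \<le> K * r"
    "\<And>r r'. r \<in> {0..M} \<Longrightarrow> r' \<in> {0..M} \<Longrightarrow>
       \<bar>truncated_power M \<delta> r - truncated_power M \<delta> r'\<bar> \<le> L * \<bar>\<phi> r - \<phi> r'\<bar>" "L \<ge> 0"
    "truncated_primitive \<delta> \<in> borel_measurable borel" "truncated_primitive \<delta> 0 = 0"
    "\<And>r r'. r \<in> {0..M} \<Longrightarrow> r' \<in> {0..M} \<Longrightarrow>
       truncated_primitive \<delta> r - truncated_primitive \<delta> r' \<le> truncated_power M \<delta> r * (r - r')"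
  have I: "{0..M} \<subseteq> {0..}" "0 \<in> {0..M}" using d by auto
  show ?thesis by (rule energy_inequality[OF I uM * ab \<kappa>])
qed

lemma positive_time_finite: "AE t in lebesgue. t \<ge> 0 \<longrightarrow> t > 0 \<and> gagliardo_finite \<sigma> (w t)"
proof -
  have "AE t in lebesgue. t \<notin> {0::real}" by (intro AE_not_in) (simp add: null_sets_completion_iff)
  then show ?thesis using w_finite by eventually_elim auto
qed

lemma entropy_truncated_antimono:
  assumes d: "0 < \<delta>" "\<delta> \<le> M" and uM: "\<And>t. t \<ge> 0 \<Longrightarrow> AE x in lebesgue. u t x \<in> {0..M}"
    and ab: "0 \<le> a" "a \<le> b"
  shows "entropy (truncated_primitive \<delta>) b \<le> entropy (truncated_primitive \<delta>) a"
proof (cases "a = b")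
  case False
  then have ab': "a < b" using ab by simp
  have "AE t in lebesgue. t \<in> {a..b} \<longrightarrow> 0 \<le> energy_form J (w t) (\<lambda>x. truncated_power M \<delta> (u t x))"
    using positive_time_finite
  proof eventually_elim
    case (elim t)
    show ?case
    proof
      assume "t \<in> {a..b}"
      then have t: "t \<ge> 0" "gagliardo_finite \<sigma> (w t)" using elim ab by auto
      show "0 \<le> energy_form J (w t) (\<lambda>x. truncated_power M \<delta> (u t x))"
        by (rule energy_form_nonneg(2)[OF t(2) truncated_power_finite[OF d uM t] t(1)])
          (use truncated_power_mono d in auto)
    qed
  qed
  from energy_inequality_truncated[OF d uM ab(1) ab' this] show ?thesis by simp
qed simp

lemma u_powr_integrable:
  assumes uM: "AE x in lebesgue. u t x \<in> {0..M}" and t: "t \<ge> 0"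
  shows "integrable lebesgue (\<lambda>x. u t x powr p)"
proof (rule Bochner_Integration.integrable_bound)
  show "integrable lebesgue (\<lambda>x. M powr (p - 1) * u t x)" using u_integrable[OF t] by simp
  show "(\<lambda>x. u t x powr p) \<in> borel_measurable lebesgue" using u_integrable[OF t] by auto
  show "AE x in lebesgue. norm (u t x powr p) \<le> norm (M powr (p - 1) * u t x)"
    using uM
  proof eventually_elim
    case (elim x)
    have "u t x powr p = u t x powr (p - 1) * u t x"
      using powr_mult_base[of "u t x" "p - 1"] elim by (simp add: mult.commute)
    also have "\<dots> \<le> M powr (p - 1) * u t x"
      using elim p_gt_1 by (intro mult_right_mono powr_mono2) auto
    finally show ?case using elim by (simp add: abs_mult)
  qed
qed

text \<open>Dominated convergence: \<open>u powr p / p\<close> is a majorant for all truncation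
  levels at once.\<close>

lemma entropy_truncated_limit:
  assumes uM: "AE x in lebesgue. u t x \<in> {0..M}" and t: "t \<ge> 0"
    and d: "\<And>n. 0 < d n" "d \<longlonglongrightarrow> 0"
  shows "(\<lambda>n. entropy (truncated_primitive (d n)) t) \<longlonglongrightarrow> entropy (\<lambda>r. r powr p) t / p"
proof -
  have p: "p > 1" by (rule p_gt_1)
  have um: "u t \<in> borel_measurable lebesgue" using u_integrable[OF t] by blast
  have i: "integrable lebesgue (\<lambda>x. u t x powr p / p)" using u_powr_integrable[OF uM t] by simp
  have "(\<lambda>n. LINT x|lebesgue. truncated_primitive (d n) (u t x)) \<longlonglongrightarrow> (LINT x|lebesgue. u t x powr p / p)"
  proof (rule integral_dominated_convergence[OF _ _ i])
    show "(\<lambda>x. u t x powr p / p) \<in> borel_measurable lebesgue" using i by auto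
    have "truncated_primitive \<delta> \<in> borel_measurable borel" for \<delta>
      unfolding truncated_primitive_def[abs_def] by measurable
    from measurable_compose[OF um this]
    show "(\<lambda>x. truncated_primitive (d n) (u t x)) \<in> borel_measurable lebesgue" for n .
    show "AE x in lebesgue. (\<lambda>n. truncated_primitive (d n) (u t x)) \<longlonglongrightarrow> u t x powr p / p"
      using uM
    proof eventually_elim
      case (elim x)
      let ?r = "u t x"
      have m: "(\<lambda>n. max (d n) ?r) \<longlonglongrightarrow> max 0 ?r" by (intro tendsto_intros d)
      have nn: "0 \<le> max (d n) ?r" "0 \<le> d n" for n using d(1)[of n] by auto
      have 1: "(\<lambda>n. max (d n) ?r powr p) \<longlonglongrightarrow> max 0 ?r powr p"
        using p nn by (intro tendsto_powr'[OF m tendsto_const]) auto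
      have 2: "(\<lambda>n. d n powr p) \<longlonglongrightarrow> 0 powr p"
        using p nn by (intro tendsto_powr'[OF d(2) tendsto_const]) auto
      have 3: "(\<lambda>n. d n powr (p - 1)) \<longlonglongrightarrow> 0 powr (p - 1)"
        using p nn by (intro tendsto_powr'[OF d(2) tendsto_const]) auto
      have "(\<lambda>n. truncated_primitive (d n) ?r) \<longlonglongrightarrow> (max 0 ?r powr p - 0 powr p) / p - 0 powr (p - 1) * (max 0 ?r - 0)"
        unfolding truncated_primitive_def using p by (intro tendsto_diff tendsto_divide tendsto_mult tendsto_const 1 2 3 m d) auto
      then show ?case using elim by simp
    qed
    show "AE x in lebesgue. norm (truncated_primitive (d n) (u t x)) \<le> u t x powr p / p" for n
      using uM
    proof eventually_elim
      case (elim x)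
      then show ?case using truncated_primitive_bounds[OF d(1)[of n], of "u t x"] by simp
    qed
  qed
  then show ?thesis by (simp add: entropy_def)
qed

text \<open>The offset 3 keeps twice the level below \<open>M\<close>, as the decay estimate works
  with the levels \<open>\<delta>\<close> and \<open>2 * \<delta>\<close> together.\<close>

definition cut_level :: "real \<Rightarrow> nat \<Rightarrow> real" where
  "cut_level M n = M / (real n + 3)"

lemma cut_level:
  assumes "M > 0"
  shows "0 < cut_level M n" "2 * cut_level M n \<le> M" "cut_level M \<longlonglongrightarrow> 0"
proof -
  show 1: "0 < cut_level M n" for n using assms by (simp add: cut_level_def)
  show "2 * cut_level M n \<le> M" using assms by (simp add: cut_level_def field_simps)
  have le: "cut_level M n \<le> M * inverse (real (Suc n))" for n
    using assms unfolding cut_level_def divide_inverse by (intro mult_left_mono le_imp_inverse_le) auto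
  have "(\<lambda>n. M * inverse (real (Suc n))) \<longlonglongrightarrow> M * 0"
    by (intro tendsto_mult tendsto_const LIMSEQ_inverse_real_of_nat)
  then have "(\<lambda>n. M * inverse (real (Suc n))) \<longlonglongrightarrow> 0" by simp
  from tendsto_sandwich[OF always_eventually always_eventually tendsto_const this]
  show "cut_level M \<longlonglongrightarrow> 0" using 1 le by (simp add: less_imp_le)
qed

lemma power_norm_antimono:
  assumes M: "M > 0" and uM: "\<And>t. t \<ge> 0 \<Longrightarrow> AE x in lebesgue. u t x \<in> {0..M}" and ab: "0 \<le> a" "a \<le> b"
  shows "entropy (\<lambda>r. r powr p) b \<le> entropy (\<lambda>r. r powr p) a"
proof -
  have b: "0 \<le> b" using ab by simp
  have "entropy (\<lambda>r. r powr p) b / p \<le> entropy (\<lambda>r. r powr p) a / p"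
  proof (rule LIMSEQ_le[OF entropy_truncated_limit[OF uM[OF b] b cut_level(1,3)[OF M]]
        entropy_truncated_limit[OF uM[OF ab(1)] ab(1) cut_level(1,3)[OF M]]])
    have "cut_level M n \<le> M" for n using cut_level(1,2)[OF M, of n] by linarith
    then show "\<exists>N. \<forall>n\<ge>N. entropy (truncated_primitive (cut_level M n)) b \<le> entropy (truncated_primitive (cut_level M n)) a"
      using entropy_truncated_antimono[OF cut_level(1)[OF M] _ uM ab] by blast
  qed
  then show ?thesis using p_gt_1 by (simp add: divide_le_cancel)
qed

text \<open>An implicit Euler step for the differential inequality. On \<open>[a, b]\<close> the
  factor \<open>Z powr (- (\<sigma> / N))\<close> is bounded below through \<open>Z \<le> z\<close>
  and the remaining integral through the truncated entropy at time \<open>b\<close>, both by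
  monotonicity; this gives the constant lower bound that the energy inequality requires.\<close>

lemma power_norm_decay:
  assumes M: "M > 0" and uM: "\<And>t. t \<ge> 0 \<Longrightarrow> AE x in lebesgue. u t x \<in> {0..M}" and ab: "0 \<le> a" "a < b"
    and z: "z > 0" "entropy (\<lambda>r. r powr p) a \<le> z"
  shows "entropy (\<lambda>r. r powr p) b * (1 + decay_constant / 2 * z powr (- (\<sigma> / real CARD('n))) * p * (b - a))
    \<le> entropy (\<lambda>r. r powr p) a"
proof -
  have b: "0 \<le> b" using ab by simp
  have p: "p > 1" by (rule p_gt_1)
  define k where "k = decay_constant * z powr (- (\<sigma> / real CARD('n)))"
  have k: "k > 0" using decay_constant_pos z by (simp add: k_def)
  let ?d = "cut_level M"
  let ?P = "entropy (\<lambda>r. r powr p)"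
  \<comment> \<open>The test function is truncated at \<open>\<delta>\<close>, but the lower bound
    of its energy sees only the set where \<open>u\<close> exceeds \<open>2 * \<delta>\<close>; the
    entropy truncated at \<open>2 * \<delta>\<close> lives on that set. Both levels disappear in the
    limit.\<close>
  have step: "entropy (truncated_primitive (?d n)) b + (k / 2 * (p * entropy (truncated_primitive (2 * ?d n)) b)) * (b - a)
     \<le> entropy (truncated_primitive (?d n)) a" for n
  proof -
    define \<delta> where "\<delta> = ?d n"
    have d: "0 < \<delta>" "2 * \<delta> \<le> M" "\<delta> \<le> M" "0 < 2 * \<delta>" using cut_level(1,2)[OF M, of n] by (auto simp: \<delta>_def)
    have "AE t in lebesgue. t \<in> {a..b} \<longrightarrow> k / 2 * (p * entropy (truncated_primitive (2 * \<delta>)) b)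
      \<le> energy_form J (w t) (\<lambda>x. truncated_power M \<delta> (u t x))"
      using positive_time_finite
    proof eventually_elim
      case (elim t)
      show ?case
      proof
        assume tab: "t \<in> {a..b}"
        then have t: "t \<ge> 0" "gagliardo_finite \<sigma> (w t)" using elim ab by auto
        note tf = truncated_power_finite[OF d(1,3) uM t]
        let ?E = "energy_form J (w t) (\<lambda>x. truncated_power M \<delta> (u t x))"
        have E0: "0 \<le> ?E"
          by (rule energy_form_nonneg(2)[OF t(2) tf t(1)]) (use truncated_power_mono d in auto)
        have "?P t \<le> z" using power_norm_antimono[OF M uM ab(1), of t] tab z by auto
        then have Z: "(\<integral>\<^sup>+ x. ennreal (u t x powr p) \<partial>lebesgue) \<le> ennreal z"
          using nn_integral_eq_integral[OF u_powr_integrable[OF uM[OF t(1)] t(1)]] by (simp add: entropy_def ennreal_leI)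
        have i: "integrable lebesgue (\<lambda>x. p * truncated_primitive (2 * \<delta>) (u t x))"
          using truncated_primitive_integrable[OF d(4,2) uM t(1)] by simp
        have "p * entropy (truncated_primitive (2 * \<delta>)) b \<le> p * entropy (truncated_primitive (2 * \<delta>)) t"
          using p tab by (intro mult_left_mono entropy_truncated_antimono[OF d(4,2) uM t(1)]) auto
        then have "ennreal (p * entropy (truncated_primitive (2 * \<delta>)) b) \<le> ennreal (LINT x|lebesgue. p * truncated_primitive (2 * \<delta>) (u t x))"
          by (intro ennreal_leI) (simp add: entropy_def)
        also have "\<dots> = (\<integral>\<^sup>+ x. ennreal (p * truncated_primitive (2 * \<delta>) (u t x)) \<partial>lebesgue)"
        proof (rule nn_integral_eq_integral[OF i, symmetric])
          show "AE x in lebesgue. 0 \<le> p * truncated_primitive (2 * \<delta>) (u t x)"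
            using uM[OF t(1)] by eventually_elim (use p truncated_primitive_bounds(2)[OF d(4)] in auto)
        qed
        also have "\<dots> \<le> (\<integral>\<^sup>+ x. ennreal (u t x powr p) * indicator {x. u t x > 2 * \<delta>} x \<partial>lebesgue)"
        proof (rule nn_integral_mono_AE)
          show "AE x in lebesgue. ennreal (p * truncated_primitive (2 * \<delta>) (u t x)) \<le> ennreal (u t x powr p) * indicator {x. u t x > 2 * \<delta>} x"
            using uM[OF t(1)]
          proof eventually_elim
            case (elim x)
            then have u0: "0 \<le> u t x" by simp
            note tb = truncated_primitive_bounds[OF d(4) u0]
            have "p * truncated_primitive (2 * \<delta>) (u t x) \<le> u t x powr p"
              using tb(1) p by (simp add: pos_le_divide_eq mult.commute)
            then show ?case using tb(3) by (cases "u t x > 2 * \<delta>") (auto intro: ennreal_leI)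
          qed
        qed
        finally have "ennreal k * ennreal (p * entropy (truncated_primitive (2 * \<delta>)) b) \<le>
          ennreal k * (\<integral>\<^sup>+ x. ennreal (u t x powr p) * indicator {x. u t x > 2 * \<delta>} x \<partial>lebesgue)"
          by (rule mult_left_mono) simp
        also have "\<dots> \<le> ennreal (2 * ?E)"
          unfolding k_def by (rule energy_lower_bound[OF t(2,1) uM[OF t(1)] d(1,3) tf Z z(1)])
        finally have "ennreal (k * (p * entropy (truncated_primitive (2 * \<delta>)) b)) \<le> ennreal (2 * ?E)"
          using k by (simp add: ennreal_mult')
        then have "k * (p * entropy (truncated_primitive (2 * \<delta>)) b) \<le> 2 * ?E"
          using E0 by (subst (asm) ennreal_le_iff) auto
        then show "k / 2 * (p * entropy (truncated_primitive (2 * \<delta>)) b) \<le> ?E" by simp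
      qed
    qed
    from energy_inequality_truncated[OF d(1,3) uM ab this] show ?thesis by (simp add: \<delta>_def)
  qed
  have two: "(\<lambda>n. 2 * ?d n) \<longlonglongrightarrow> 0" using tendsto_mult[OF tendsto_const[of 2] cut_level(3)[OF M]] by simp
  have pos2: "0 < 2 * ?d n" for n using cut_level(1)[OF M] by simp
  have l1: "(\<lambda>n. entropy (truncated_primitive (?d n)) b + (k / 2 * (p * entropy (truncated_primitive (2 * ?d n)) b)) * (b - a))
    \<longlonglongrightarrow> ?P b / p + (k / 2 * (p * (?P b / p))) * (b - a)"
    by (intro tendsto_add tendsto_mult tendsto_const entropy_truncated_limit[OF uM[OF b] b cut_level(1,3)[OF M]]
        entropy_truncated_limit[OF uM[OF b] b pos2 two])
  have "?P b / p + (k / 2 * (p * (?P b / p))) * (b - a) \<le> ?P a / p"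
    by (rule LIMSEQ_le[OF l1 entropy_truncated_limit[OF uM[OF ab(1)] ab(1) cut_level(1,3)[OF M]]]) (use step in blast)
  then have "p * (?P b / p + (k / 2 * (p * (?P b / p))) * (b - a)) \<le> p * (?P a / p)"
    using p by (intro mult_left_mono) auto
  then have "?P b + k / 2 * p * ?P b * (b - a) \<le> ?P a" using p by (simp add: distrib_left mult_ac)
  then show ?thesis by (simp add: k_def algebra_simps)
qed

text \<open>The time needed to halve \<open>\<integral>u\<^sup>p\<close> from a level \<open>z\<close> is proportional to \<open>z\<^bsup>\<sigma>/N\<^esup>\<close>, hence the
  successive halving times form a geometric series.\<close>

lemma extinction: "\<exists>T>0. \<forall>t\<ge>T. AE x in lebesgue. u t x = 0"
proof -
  obtain M where M: "M > 0" and uM: "\<And>t. t \<ge> 0 \<Longrightarrow> AE x in lebesgue. u t x \<in> {0..M}"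
    using u_bounded by blast
  have p: "p > 1" by (rule p_gt_1)
  let ?P = "entropy (\<lambda>r. r powr p)"
  define \<beta> where "\<beta> = \<sigma> / real CARD('n)"
  have \<beta>: "\<beta> > 0" using \<sigma> by (simp add: \<beta>_def)
  \<comment> \<open>The summand 1 keeps the levels positive when the initial datum vanishes.\<close>
  define z0 where "z0 = ?P 0 + 1"
  have "0 \<le> ?P 0" unfolding entropy_def by (rule integral_nonneg_AE) simp
  then have z0: "z0 > 0" by (simp add: z0_def)
  \<comment> \<open>Normalised so that a time step of \<open>k * z powr (\<sigma> / N)\<close> makes
    the factor in \<open>power_norm_decay\<close> equal to 2.\<close>
  define k where "k = 2 / (p * decay_constant)"
  have k: "k > 0" using p decay_constant_pos by (simp add: k_def)
  define s where "s j = k * (z0 / 2 ^ j) powr \<beta>" for j :: nat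
  have s_pos: "s j > 0" for j using k z0 by (simp add: s_def)
  have s_geo: "s j = k * z0 powr \<beta> * (2 powr (- \<beta>)) ^ j" for j
  proof -
    have "(2 ^ j) powr \<beta> = (2 powr \<beta>) ^ j" for j by (simp add: powr_powr mult.commute flip: powr_realpow)
    then show ?thesis using z0 by (simp add: s_def powr_divide powr_minus_divide power_one_over)
  qed
  define \<tau> where "\<tau> n = (\<Sum>j<n. s j)" for n
  have \<tau>0: "0 \<le> \<tau> n" for n unfolding \<tau>_def using s_pos by (intro sum_nonneg) (simp add: less_imp_le)
  have q1: "2 powr (- \<beta>) < (1::real)"
    using powr_less_mono[of "- \<beta>" 0 2] \<beta> by simp
  have summ: "summable s" unfolding s_geo[abs_def] using q1 by (intro summable_mult summable_geometric) simp
  \<comment> \<open>All halving times are bounded by the sum of the series; the summand 1 makes the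
    positivity of \<open>T\<close> immediate.\<close>
  define T where "T = suminf s + 1"
  have \<tau>T: "\<tau> n \<le> T" for n
    using sum_le_suminf[OF summ, of "{..<n}"] s_pos by (simp add: \<tau>_def T_def less_imp_le)
  have T: "T > 0" using suminf_nonneg[OF summ] s_pos by (simp add: T_def less_imp_le add_nonneg_pos)
  have halving: "?P (\<tau> n) \<le> z0 / 2 ^ n" for n
  proof (induction n)
    case 0 then show ?case by (simp add: \<tau>_def z0_def)
  next
    case (Suc n)
    let ?z = "z0 / 2 ^ n"
    have z: "?z > 0" using z0 by simp
    have lt: "\<tau> n < \<tau> (Suc n)" and diff: "\<tau> (Suc n) - \<tau> n = k * ?z powr \<beta>"
      using s_pos[of n] by (auto simp: \<tau>_def s_def)
    have one: "?z powr (- \<beta>) * ?z powr \<beta> = 1" using z0 by (simp flip: powr_add)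
    have "decay_constant / 2 * ?z powr (- \<beta>) * p * (k * ?z powr \<beta>) =
        decay_constant / 2 * p * k * (?z powr (- \<beta>) * ?z powr \<beta>)"
      by (simp only: mult_ac)
    also have "\<dots> = decay_constant / 2 * p * k" unfolding one by simp
    also have "\<dots> = 1" using p decay_constant_pos by (simp add: k_def)
    finally have "?P (\<tau> (Suc n)) * 2 \<le> ?P (\<tau> n)"
      using power_norm_decay[OF M uM \<tau>0 lt z Suc.IH] unfolding diff \<beta>_def[symmetric] by simp
    then show ?case using Suc.IH by simp
  qed
  have "AE x in lebesgue. u t x = 0" if t: "t \<ge> T" for t
  proof -
    have t0: "t \<ge> 0" using t T by simp
    have "?P t \<le> z0 / 2 ^ n" for n
      using power_norm_antimono[OF M uM \<tau>0[of n], of t] \<tau>T[of n] t halving[of n] by simp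
    moreover have "(\<lambda>n. z0 / 2 ^ n) \<longlonglongrightarrow> 0"
      using LIMSEQ_divide_realpow_zero[of 2 z0] by simp
    ultimately have "?P t \<le> 0" by (intro LIMSEQ_le_const) auto
    moreover have i: "integrable lebesgue (\<lambda>x. u t x powr p)" by (rule u_powr_integrable[OF uM[OF t0] t0])
    moreover have "0 \<le> ?P t" unfolding entropy_def by (rule integral_nonneg_AE) simp
    ultimately have "?P t = 0" by linarith
    then have "(LINT x|lebesgue. u t x powr p) = 0" by (simp add: entropy_def)
    then have "AE x in lebesgue. u t x powr p = 0"
      using integral_nonneg_eq_0_iff_AE[OF i] by simp
    then show ?thesis by eventually_elim simp
  qed
  then show ?thesis using T by blast
qed

end

theorem theoremA2:
  fixes \<sigma> \<Lambda> m c :: real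
    and J :: "real^'n \<Rightarrow> real^'n \<Rightarrow> real"
    and \<phi> :: "real \<Rightarrow> real"
    and u0 :: "real^'n \<Rightarrow> real"
    and u :: "real \<Rightarrow> real^'n \<Rightarrow> real"
  assumes "0 < \<sigma>" and "\<sigma> < 2" and "\<Lambda> > 0"
    and "admissible_kernel \<sigma> \<Lambda> J"
    and "nonlinearity \<phi>"
    and "0 < m" and "m < max (real CARD('n) - \<sigma>) 0 / real CARD('n)"
    and "weak_solution \<sigma> J \<phi> u0 u"
    and "\<forall>t\<ge>0. AE x in lebesgue. u t x \<ge> 0"
    and "c > 0" and "\<forall>s>0. deriv \<phi> s \<ge> c * s powr (m - 1)"
    and "integrable lebesgue u0" and "\<exists>M. AE x in lebesgue. \<bar>u0 x\<bar> \<le> M"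
  shows "\<exists>T>0. \<forall>t\<ge>T. AE x in lebesgue. u t x = 0"
proof -
  interpret extinction_problem \<sigma> \<Lambda> J \<phi> u0 u m c
    by unfold_locales (use assms in auto)
  show ?thesis by (rule extinction)
qed

end
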